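(* Let $A=KQ/I$ be a gentle tree algebra over an algebraically closed field $K$, with $n$ vertices in $Q$, and let $T(A)=A\ltimes DA$ be its trivial extension. Then: (1) $T(A)$ is a Brauer star algebra if and only if $A\cong K\vec{A}_n$; (2) $T(A)$ is a Brauer line algebra if and only if $\mathrm{rad}^2 A=0$.
   Context: $D=\mathrm{Hom}_K(-,K)$; $T(A)$ has underlying space $A\oplus DA$ with multiplication $(a,f)(b,g)=(ab,ag+fb)$. Gentle: every vertex of $Q$ has at most two incoming and at most two outgoing arrows; for each arrow $\alpha$ there is at most one arrow $\beta$ with $\alpha\beta\in I$, at most one $\gamma$ with $\gamma\alpha\in I$, at most one $\beta'$ with $\alpha\beta'\notin I$ and at most one $\gamma'$ with $\gamma'\alpha\notin I$ (composable arrows); $I$ is admissible and generated by paths of length 2; gentle tree means $Q$ is a tree. $\vec{A}_n$ is the linearly oriented quiver $1\to2\to\cdots\to n$. Brauer graph algebras: for a finite connected graph $G$ with multiplicity $m\equiv1$ and a cyclic ordering of edges around each vertex, $Q_G$ has vertices the edges of $G$ and an arrow $i\to j$ when $E_j$ immediately follows $E_i$ in the cyclic order around a common vertex; each vertex $v$ of $G$ of degree $\ge2$ yields an oriented cycle $C_v$; $I_G$ is generated by $C_v-C_{v'}$ for the two cycles at a vertex $i$ of $Q_G$ ($v,v'$ the endpoints of $E_i$), $C_v\alpha_1$ for each cycle $C_v=\alpha_1\cdots\alpha_k$ at $i$, and $\alpha\beta$ whenever $\alpha\beta$ lies in no such cycle; $B_G=KQ_G/I_G$. A Brauer line algebra is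 $B_G$ with $m\equiv1$ and $G$ a path graph; a Brauer star algebra is $B_G$ with $m\equiv1$ and $G$ a star (all edges incident to one central vertex).
   Formalization: For the Brauer graph with a single edge (multiplicity 1), the Brauer graph algebra is taken to be K[x]/(x^2), the standard convention; the definition as given yields K, and both parts would then fail for n = 1, where T(K) = K[x]/(x^2). *)

theory Defs
  imports "HOL-Computational_Algebra.Polynomial"
begin

record ('v, 'a) quiver =
  verts :: "'v set"
  arrs  :: "'a set"
  src   :: "'a \<Rightarrow> 'v"
  tgt   :: "'a \<Rightarrow> 'v"

definition finite_quiver :: "('v, 'a) quiver \<Rightarrow> bool" where
  "finite_quiver Q \<longleftrightarrow> finite (verts Q) \<and> verts Q \<noteq> {} \<and> finite (arrs Q) \<and>
     (\<forall>a\<in>arrs Q. src Q a \<in> verts Q \<and> tgt Q a \<in> verts Q)"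

text \<open>A path is a pair (start vertex, list of arrows); the empty list gives the trivial
  path e_v.  Paths are composed left to right: p q means first p, then q.\<close>

fun chain :: "('v, 'a) quiver \<Rightarrow> 'v \<Rightarrow> 'a list \<Rightarrow> bool" where
  "chain Q v [] = (v \<in> verts Q)"
| "chain Q v (a # as) = (a \<in> arrs Q \<and> src Q a = v \<and> chain Q (tgt Q a) as)"

fun pend :: "('v, 'a) quiver \<Rightarrow> 'v \<Rightarrow> 'a list \<Rightarrow> 'v" where
  "pend Q v [] = v"
| "pend Q v (a # as) = pend Q (tgt Q a) as"

definition valid_path :: "('v, 'a) quiver \<Rightarrow> 'v \<times> 'a list \<Rightarrow> bool" where
  "valid_path Q p \<longleftrightarrow> chain Q (fst p) (snd p)"

definition pa_carrier :: "('v, 'a) quiver \<Rightarrow> ('v \<times> 'a list \<Rightarrow> 'k::field) set" where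
  "pa_carrier Q = {x. finite {p. x p \<noteq> 0} \<and> (\<forall>p. x p \<noteq> 0 \<longrightarrow> valid_path Q p)}"

definition bvec :: "'v \<times> 'a list \<Rightarrow> ('v \<times> 'a list \<Rightarrow> 'k::field)" where
  "bvec p = (\<lambda>q. if q = p then 1 else 0)"

definition pa_one :: "('v, 'a) quiver \<Rightarrow> ('v \<times> 'a list \<Rightarrow> 'k::field)" where
  "pa_one Q = (\<lambda>p. if snd p = [] \<and> fst p \<in> verts Q then 1 else 0)"

definition pa_mult :: "('v, 'a) quiver \<Rightarrow> ('v \<times> 'a list \<Rightarrow> 'k::field)
    \<Rightarrow> ('v \<times> 'a list \<Rightarrow> 'k) \<Rightarrow> ('v \<times> 'a list \<Rightarrow> 'k)" where
  "pa_mult Q x y = (\<lambda>r. \<Sum>pq \<in> {(p, q). x p \<noteq> 0 \<and> y q \<noteq> 0 \<and> fst q = pend Q (fst p) (snd p)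
        \<and> (fst p, snd p @ snd q) = r}. x (fst pq) * y (snd pq))"

inductive_set ideal_gen :: "('v, 'a) quiver \<Rightarrow> ('v \<times> 'a list \<Rightarrow> 'k::field) set
    \<Rightarrow> ('v \<times> 'a list \<Rightarrow> 'k) set" for Q R where
  gen: "r \<in> R \<Longrightarrow> r \<in> ideal_gen Q R"
| zero: "(\<lambda>_. 0) \<in> ideal_gen Q R"
| add: "x \<in> ideal_gen Q R \<Longrightarrow> y \<in> ideal_gen Q R \<Longrightarrow> (\<lambda>p. x p + y p) \<in> ideal_gen Q R"
| lmult: "x \<in> ideal_gen Q R \<Longrightarrow> a \<in> pa_carrier Q \<Longrightarrow> pa_mult Q a x \<in> ideal_gen Q R"
| rmult: "x \<in> ideal_gen Q R \<Longrightarrow> a \<in> pa_carrier Q \<Longrightarrow> pa_mult Q x a \<in> ideal_gen Q R"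

definition arrow_ideal_pow :: "('v, 'a) quiver \<Rightarrow> nat \<Rightarrow> ('v \<times> 'a list \<Rightarrow> 'k::field) set" where
  "arrow_ideal_pow Q m = {x \<in> pa_carrier Q. \<forall>p. x p \<noteq> 0 \<longrightarrow> length (snd p) \<ge> m}"

record ('k, 'e) alg =
  acarr :: "'e set"
  aadd  :: "'e \<Rightarrow> 'e \<Rightarrow> 'e"
  asmul :: "'k \<Rightarrow> 'e \<Rightarrow> 'e"
  amul  :: "'e \<Rightarrow> 'e \<Rightarrow> 'e"
  aone  :: "'e"
  azero :: "'e"

definition pa_hom_onto :: "('v, 'a) quiver \<Rightarrow> ('k::field, 'e) alg
    \<Rightarrow> (('v \<times> 'a list \<Rightarrow> 'k) \<Rightarrow> 'e) \<Rightarrow> bool" where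
  "pa_hom_onto Q A \<phi> \<longleftrightarrow>
     (\<forall>x\<in>pa_carrier Q. \<phi> x \<in> acarr A) \<and>
     acarr A \<subseteq> \<phi> ` pa_carrier Q \<and>
     \<phi> (\<lambda>_. 0) = azero A \<and>
     \<phi> (pa_one Q) = aone A \<and>
     (\<forall>x\<in>pa_carrier Q. \<forall>y\<in>pa_carrier Q. \<phi> (\<lambda>p. x p + y p) = aadd A (\<phi> x) (\<phi> y)) \<and>
     (\<forall>c. \<forall>x\<in>pa_carrier Q. \<phi> (\<lambda>p. c * x p) = asmul A c (\<phi> x)) \<and>
     (\<forall>x\<in>pa_carrier Q. \<forall>y\<in>pa_carrier Q. \<phi> (pa_mult Q x y) = amul A (\<phi> x) (\<phi> y))"

definition iso_quot :: "('v, 'a) quiver \<Rightarrow> ('v \<times> 'a list \<Rightarrow> 'k::field) set \<Rightarrow> ('k, 'e) alg \<Rightarrow> bool" where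
  "iso_quot Q R A \<longleftrightarrow>
     (\<exists>\<phi>. pa_hom_onto Q A \<phi> \<and> (\<forall>x\<in>pa_carrier Q. \<phi> x = azero A \<longleftrightarrow> x \<in> ideal_gen Q R))"

definition step_from :: "('v, 'a) quiver \<Rightarrow> 'a \<times> bool \<Rightarrow> 'v" where
  "step_from Q ad = (if snd ad then src Q (fst ad) else tgt Q (fst ad))"

definition step_to :: "('v, 'a) quiver \<Rightarrow> 'a \<times> bool \<Rightarrow> 'v" where
  "step_to Q ad = (if snd ad then tgt Q (fst ad) else src Q (fst ad))"

fun uwalk :: "('v, 'a) quiver \<Rightarrow> 'v \<Rightarrow> ('a \<times> bool) list \<Rightarrow> 'v \<Rightarrow> bool" where
  "uwalk Q v [] w = (v = w \<and> v \<in> verts Q)"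
| "uwalk Q v (ad # ws) w = (fst ad \<in> arrs Q \<and> step_from Q ad = v \<and> uwalk Q (step_to Q ad) ws w)"

definition is_tree_quiver :: "('v, 'a) quiver \<Rightarrow> bool" where
  "is_tree_quiver Q \<longleftrightarrow> finite_quiver Q \<and>
     (\<forall>v\<in>verts Q. \<forall>w\<in>verts Q. \<exists>ws. uwalk Q v ws w) \<and>
     \<not> (\<exists>v ws. ws \<noteq> [] \<and> distinct (map fst ws) \<and> uwalk Q v ws v)"

definition rel_elems :: "('v, 'a) quiver \<Rightarrow> ('a \<times> 'a) set \<Rightarrow> ('v \<times> 'a list \<Rightarrow> 'k::field) set" where
  "rel_elems Q Rel = {bvec (src Q a, [a, b]) | a b. (a, b) \<in> Rel}"

definition composable :: "('v, 'a) quiver \<Rightarrow> 'a \<Rightarrow> 'a \<Rightarrow> bool" where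
  "composable Q a b \<longleftrightarrow> a \<in> arrs Q \<and> b \<in> arrs Q \<and> tgt Q a = src Q b"

definition gentle :: "('v, 'a) quiver \<Rightarrow> ('a \<times> 'a) set \<Rightarrow> 'k::field itself \<Rightarrow> bool" where
  "gentle Q Rel (_::'k itself) \<longleftrightarrow>
    (let I = (ideal_gen Q (rel_elems Q Rel) :: ('v \<times> 'a list \<Rightarrow> 'k) set);
         inI = (\<lambda>a b. (bvec (src Q a, [a, b]) :: 'v \<times> 'a list \<Rightarrow> 'k) \<in> I) in
     finite_quiver Q \<and>
     (\<forall>(a, b)\<in>Rel. composable Q a b) \<and>
     (\<forall>v\<in>verts Q. card {a\<in>arrs Q. tgt Q a = v} \<le> 2 \<and> card {a\<in>arrs Q. src Q a = v} \<le> 2) \<and>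
     (\<forall>a\<in>arrs Q.
        card {b. composable Q a b \<and> inI a b} \<le> 1 \<and>
        card {c. composable Q c a \<and> inI c a} \<le> 1 \<and>
        card {b. composable Q a b \<and> \<not> inI a b} \<le> 1 \<and>
        card {c. composable Q c a \<and> \<not> inI c a} \<le> 1) \<and>
     (\<exists>m\<ge>2. arrow_ideal_pow Q m \<subseteq> I) \<and> I \<subseteq> arrow_ideal_pow Q 2)"

definition gentle_tree :: "('v, 'a) quiver \<Rightarrow> ('a \<times> 'a) set \<Rightarrow> 'k::field itself \<Rightarrow> bool" where
  "gentle_tree Q Rel k \<longleftrightarrow> gentle Q Rel k \<and> is_tree_quiver Q"

definition linA :: "nat \<Rightarrow> (nat, nat) quiver" where
  "linA n = \<lparr>verts = {1..n}, arrs = {1..<n}, src = (\<lambda>i. i), tgt = Suc\<rparr>"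

definition lin_functional :: "('k::field, 'e) alg \<Rightarrow> ('e \<Rightarrow> 'k) \<Rightarrow> bool" where
  "lin_functional A f \<longleftrightarrow>
     (\<forall>x\<in>acarr A. \<forall>y\<in>acarr A. f (aadd A x y) = f x + f y) \<and>
     (\<forall>c. \<forall>x\<in>acarr A. f (asmul A c x) = c * f x) \<and>
     (\<forall>x. x \<notin> acarr A \<longrightarrow> f x = 0)"

definition triv_ext :: "('k::field, 'e) alg \<Rightarrow> ('k, 'e \<times> ('e \<Rightarrow> 'k)) alg" where
  "triv_ext A = \<lparr>
     acarr = {(a, f). a \<in> acarr A \<and> lin_functional A f},
     aadd = (\<lambda>(a, f) (b, g). (aadd A a b, \<lambda>x. if x \<in> acarr A then f x + g x else 0)),
     asmul = (\<lambda>c (a, f). (asmul A c a, \<lambda>x. if x \<in> acarr A then c * f x else 0)),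
     amul = (\<lambda>(a, f) (b, g). (amul A a b,
               \<lambda>x. if x \<in> acarr A then g (amul A x a) + f (amul A b x) else 0)),
     aone = (aone A, \<lambda>_. 0),
     azero = (azero A, \<lambda>_. 0)\<rparr>"

definition jac_rad :: "('k::field, 'e) alg \<Rightarrow> 'e set" where
  "jac_rad A = {x \<in> acarr A. \<forall>a\<in>acarr A. \<exists>y\<in>acarr A.
       amul A y (aadd A (aone A) (asmul A (-1) (amul A a x))) = aone A}"

definition rad_sq_zero :: "('k::field, 'e) alg \<Rightarrow> bool" where
  "rad_sq_zero A \<longleftrightarrow> (\<forall>x\<in>jac_rad A. \<forall>y\<in>jac_rad A. amul A x y = azero A)"

section \<open>Brauer graph algebras (multiplicity identically 1)\<close>

text \<open>A (loopless) Brauer graph: edges 0..<m, edge i has endpoints ends i (two distinct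
  vertices), and succ v is the cyclic successor of an edge in the cyclic ordering
  of the edges around the vertex v.\<close>

definition inc :: "nat \<Rightarrow> (nat \<Rightarrow> nat \<times> nat) \<Rightarrow> nat \<Rightarrow> nat set" where
  "inc m ends v = {i. i < m \<and> (fst (ends i) = v \<or> snd (ends i) = v)}"

definition gdeg :: "nat \<Rightarrow> (nat \<Rightarrow> nat \<times> nat) \<Rightarrow> nat \<Rightarrow> nat" where
  "gdeg m ends v = card (inc m ends v)"

definition cyclic_orders :: "nat \<Rightarrow> (nat \<Rightarrow> nat \<times> nat) \<Rightarrow> (nat \<Rightarrow> nat \<Rightarrow> nat) \<Rightarrow> bool" where
  "cyclic_orders m ends succ \<longleftrightarrow>
     (\<forall>v. (\<forall>i\<in>inc m ends v. succ v i \<in> inc m ends v) \<and> inj_on (succ v) (inc m ends v) \<and>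
          (\<forall>i\<in>inc m ends v. \<forall>j\<in>inc m ends v. \<exists>k. (succ v ^^ k) i = j))"

text \<open>Arrows of Q_G are pairs (v, i): the arrow from E_i to the edge following E_i
  around v (only for v of degree at least 2).  Convention: the graph with a single
  edge (multiplicity 1 at both ends) gives K[x]/(x^2).\<close>

definition brauer_quiver :: "nat \<Rightarrow> (nat \<Rightarrow> nat \<times> nat) \<Rightarrow> (nat \<Rightarrow> nat \<Rightarrow> nat)
    \<Rightarrow> (nat, nat \<times> nat) quiver" where
  "brauer_quiver m ends succ =
     (if m = 1 then \<lparr>verts = {0}, arrs = {(0, 0)}, src = (\<lambda>_. 0), tgt = (\<lambda>_. 0)\<rparr>
      else \<lparr>verts = {..<m}, arrs = {(v, i). i \<in> inc m ends v \<and> 2 \<le> gdeg m ends v},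
            src = snd, tgt = (\<lambda>(v, i). succ v i)\<rparr>)"

definition bcycle :: "nat \<Rightarrow> (nat \<Rightarrow> nat \<times> nat) \<Rightarrow> (nat \<Rightarrow> nat \<Rightarrow> nat) \<Rightarrow> nat \<Rightarrow> nat
    \<Rightarrow> (nat \<times> nat) list" where
  "bcycle m ends succ v i = map (\<lambda>k. (v, (succ v ^^ k) i)) [0..<gdeg m ends v]"

definition brauer_rels :: "nat \<Rightarrow> (nat \<Rightarrow> nat \<times> nat) \<Rightarrow> (nat \<Rightarrow> nat \<Rightarrow> nat)
    \<Rightarrow> (nat \<times> (nat \<times> nat) list \<Rightarrow> 'k::field) set" where
  "brauer_rels m ends succ =
    (if m = 1 then {bvec (0, [(0, 0), (0, 0)])}
     else
      {(\<lambda>p. bvec (i, bcycle m ends succ (fst (ends i)) i) p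
             - bvec (i, bcycle m ends succ (snd (ends i)) i) p) | i.
          i < m \<and> 2 \<le> gdeg m ends (fst (ends i)) \<and> 2 \<le> gdeg m ends (snd (ends i))}
      \<union> {bvec (i, bcycle m ends succ v i @ [(v, i)]) | v i.
          i \<in> inc m ends v \<and> 2 \<le> gdeg m ends v}
      \<union> {bvec (snd a, [a, b]) | a b.
          composable (brauer_quiver m ends succ) a b \<and>
          \<not> (\<exists>v i xs ys. i \<in> inc m ends v \<and> 2 \<le> gdeg m ends v \<and>
                 bcycle m ends succ v i = xs @ [a, b] @ ys)})"

definition brauer_graph_alg :: "nat \<Rightarrow> (nat \<Rightarrow> nat \<times> nat) \<Rightarrow> ('k::field, 'e) alg \<Rightarrow> bool" where
  "brauer_graph_alg m ends B \<longleftrightarrow>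
     (\<exists>succ. cyclic_orders m ends succ \<and>
        iso_quot (brauer_quiver m ends succ) (brauer_rels m ends succ) B)"

definition star_ends :: "nat \<Rightarrow> nat \<times> nat" where "star_ends i = (0, Suc i)"
definition line_ends :: "nat \<Rightarrow> nat \<times> nat" where "line_ends i = (i, Suc i)"

definition brauer_star_alg :: "('k::field, 'e) alg \<Rightarrow> bool" where
  "brauer_star_alg B \<longleftrightarrow> (\<exists>m\<ge>1. brauer_graph_alg m star_ends B)"

definition brauer_line_alg :: "('k::field, 'e) alg \<Rightarrow> bool" where
  "brauer_line_alg B \<longleftrightarrow> (\<exists>m\<ge>1. brauer_graph_alg m line_ends B)"

definition alg_closed :: "'k::field itself \<Rightarrow> bool" where
  "alg_closed _ \<longleftrightarrow> (\<forall>p :: 'k poly. degree p \<ge> 1 \<longrightarrow> (\<exists>x. poly p x = 0))"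

end

theory Submission
  imports Defs
begin

text \<open>Write a gentle algebra as A = KQ/I with I spanned by the paths containing a relation.  The
  nonzero paths p and their duals p* form a basis of T(A) that is multiplicative up to zeros, so
  a presentation of T(A) amounts to a map from paths to these basis elements that respects
  products.  This gives the two implications from right to left: for the linear quiver a path of
  the cyclic quiver becomes p* once it has passed the closing arrow, and for radical square zero
  Q is a zigzag whose arrows and their duals alternate along the line.

  Conversely, let T(A) be a quotient of a path algebra of a Brauer quiver.  Radical elements of A
  and elements of DA lift to combinations of nontrivial paths.  In a Brauer line algebra products
  of three such elements vanish; if xy were nonzero with x, y in rad A and f(xy) nonzero, then
  x y f would be a nonzero product of three.  A Brauer star algebra with m edges has a nonzero
  path of length m, and T(A) allows this only if A has a nonzero path of length at least m - 1;
  comparing idempotents gives m at least the number of vertices of Q, so in the tree Q this path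
  visits every vertex and Q is linear without relations.\<close>

section \<open>Path algebras\<close>

text \<open>The two directions meet different obstacles. From right to left a kernel must be
  computed exactly. No dimensions are counted: the coordinates of an image in T(A) are sums over the
  fibres of the map from paths to basis elements, so it is enough that the relations identify any
  two paths of one fibre and kill every path without image. From left to right the given isomorphism
  is arbitrary: it need not match vertices with vertices or arrows with basis elements, so only
  facts independent of the chosen lifts are used. An element that is nilpotent in the quotient has
  no coefficient at a trivial path, a character of T(A) vanishes on an arrow whose square is zero,
  and a filtration of T(A) by path length bounds nonzero products. The loss of one in m - 1 comes
  from DA having square zero. The tree hypothesis acts by excluding closed walks: an arrow joining
  two vertices of a simple walk belongs to the walk, and arrows of Q are radical in A because no
  oriented cycle returns to them.\<close>

definition cat :: "'v \<times> 'a list \<Rightarrow> 'v \<times> 'a list \<Rightarrow> 'v \<times> 'a list" where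
  "cat p q = (fst p, snd p @ snd q)"

text \<open>A relation rather than an operation, because a path times a dual path cancels instead of
  concatenating; such products use this same relation with its arguments permuted.\<close>

definition joins :: "('v, 'a) quiver \<Rightarrow> 'v \<times> 'a list \<Rightarrow> 'v \<times> 'a list \<Rightarrow> 'v \<times> 'a list \<Rightarrow> bool" where
  "joins Q p q r \<longleftrightarrow> fst q = pend Q (fst p) (snd p) \<and> r = cat p q"

lemma pend_append: "pend Q v (as @ bs) = pend Q (pend Q v as) bs"
  by (induction as arbitrary: v) auto

lemma chain_append: "chain Q v (as @ bs) \<longleftrightarrow> chain Q v as \<and> chain Q (pend Q v as) bs"
  if "finite_quiver Q"
proof (induction as arbitrary: v)
  case Nil
  have "chain Q v bs \<Longrightarrow> v \<in> verts Q"
    using that by (cases bs) (auto simp: finite_quiver_def)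
  then show ?case by auto
qed auto

lemma chain_start: "finite_quiver Q \<Longrightarrow> chain Q v as \<Longrightarrow> v \<in> verts Q"
  by (cases as) (auto simp: finite_quiver_def)

lemma chain_end: "chain Q v as \<Longrightarrow> pend Q v as \<in> verts Q"
  by (induction as arbitrary: v) auto

lemma chain_arrs: "chain Q v as \<Longrightarrow> set as \<subseteq> arrs Q"
  by (induction as arbitrary: v) auto

lemma valid_joins:
  "finite_quiver Q \<Longrightarrow> joins Q p q r \<Longrightarrow> valid_path Q r \<longleftrightarrow> valid_path Q p \<and> valid_path Q q"
  by (auto simp: joins_def valid_path_def cat_def chain_append)

text \<open>A factorisation of a path is a choice of the cutting position k. The sum over pairs of
  paths thus becomes a sum over an interval, and bilinearity holds for arbitrary functions, with no
  finiteness of supports to check.\<close>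

lemma pa_mult_split:
  "pa_mult Q x y (v, as) =
     (\<Sum>k\<le>length as. x (v, take k as) * y (pend Q v (take k as), drop k as))"
proof -
  let ?h = "\<lambda>k. ((v, take k as), (pend Q v (take k as), drop k as))"
  let ?S = "{(p, q). x p \<noteq> 0 \<and> y q \<noteq> 0 \<and> fst q = pend Q (fst p) (snd p)
        \<and> (fst p, snd p @ snd q) = (v, as)}"
  let ?f = "\<lambda>pq. x (fst pq) * y (snd pq)"
  have inj: "inj_on ?h {..length as}"
  proof (rule inj_onI)
    fix i j assume "i \<in> {..length as}" "j \<in> {..length as}" "?h i = ?h j"
    then have "length (take i as) = length (take j as)" by auto
    with \<open>i \<in> _\<close> \<open>j \<in> _\<close> show "i = j" by simp
  qed
  have sub: "?S \<subseteq> ?h ` {..length as}"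
  proof
    fix pq assume "pq \<in> ?S"
    then have "pq = ?h (length (snd (fst pq)))" "length (snd (fst pq)) \<le> length as"
      by auto
    then show "pq \<in> ?h ` {..length as}" by blast
  qed
  have "sum ?f ?S = sum ?f (?h ` {..length as})"
    by (rule sum.mono_neutral_left) (use sub in auto)
  also have "\<dots> = (\<Sum>k\<le>length as. x (v, take k as) * y (pend Q v (take k as), drop k as))"
    by (simp add: sum.reindex[OF inj])
  finally show ?thesis unfolding pa_mult_def .
qed

lemma pa_mult_add_left: "pa_mult Q (\<lambda>p. x p + y p) z = (\<lambda>p. pa_mult Q x z p + pa_mult Q y z p)"
  by (rule ext) (auto simp: pa_mult_split sum.distrib algebra_simps)

lemma pa_mult_add_right: "pa_mult Q z (\<lambda>p. x p + y p) = (\<lambda>p. pa_mult Q z x p + pa_mult Q z y p)"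
  by (rule ext) (auto simp: pa_mult_split sum.distrib algebra_simps)

lemma pa_mult_scale_left: "pa_mult Q (\<lambda>p. c * x p) z = (\<lambda>p. c * pa_mult Q x z p)"
  by (rule ext) (auto simp: pa_mult_split sum_distrib_left algebra_simps)

lemma pa_mult_scale_right: "pa_mult Q z (\<lambda>p. c * x p) = (\<lambda>p. c * pa_mult Q z x p)"
  by (rule ext) (auto simp: pa_mult_split sum_distrib_left algebra_simps)

lemma pa_mult_zero_left [simp]: "pa_mult Q (\<lambda>_. 0) z = (\<lambda>_. 0)"
  by (rule ext) (auto simp: pa_mult_split)

lemma pa_mult_zero_right [simp]: "pa_mult Q z (\<lambda>_. 0) = (\<lambda>_. 0)"
  by (rule ext) (auto simp: pa_mult_split)

lemma pa_mult_trivial: "pa_mult Q x y (v, []) = x (v, []) * y (v, [])"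
  by (simp add: pa_mult_split)

lemma pa_mult_support:
  assumes "pa_mult Q x y r \<noteq> 0"
  obtains p q where "x p \<noteq> 0" "y q \<noteq> 0" "joins Q p q r"
proof -
  obtain v as where r: "r = (v, as)" by (cases r)
  from assms obtain k where "k \<le> length as"
    "x (v, take k as) * y (pend Q v (take k as), drop k as) \<noteq> 0"
    unfolding r pa_mult_split by (meson atMost_iff sum.not_neutral_contains_not_neutral)
  then show ?thesis
    by (intro that[of "(v, take k as)" "(pend Q v (take k as), drop k as)"])
      (auto simp: joins_def cat_def r)
qed

lemma pa_mult_bvec: "(pa_mult Q (bvec p) (bvec q) r :: 'k::field) = of_bool (joins Q p q r)"
proof -
  have "{(p', q'). (bvec p p' :: 'k) \<noteq> 0 \<and> (bvec q q' :: 'k) \<noteq> 0 \<and> fst q' = pend Q (fst p') (snd p')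
        \<and> (fst p', snd p' @ snd q') = r} = (if joins Q p q r then {(p, q)} else {})"
    by (auto simp: bvec_def joins_def cat_def split: if_splits)
  then show ?thesis unfolding pa_mult_def by (auto simp: bvec_def)
qed

lemma pa_mult_bvec_joins: "joins Q p q r \<Longrightarrow> pa_mult Q (bvec p) (bvec q) = bvec r"
  by (rule ext, subst pa_mult_bvec) (auto simp: joins_def bvec_def)

lemma pa_carrier_mult:
  assumes "finite_quiver Q" "x \<in> pa_carrier Q" "y \<in> pa_carrier Q"
  shows "pa_mult Q x y \<in> pa_carrier Q"
proof -
  have "{r. pa_mult Q x y r \<noteq> 0} \<subseteq> (\<lambda>(p, q). cat p q) ` ({p. x p \<noteq> 0} \<times> {q. y q \<noteq> 0})"
    by (auto elim!: pa_mult_support simp: joins_def)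
  then have "finite {r. pa_mult Q x y r \<noteq> 0}"
    using assms(2,3) by (auto simp: pa_carrier_def intro: finite_subset)
  moreover have "valid_path Q r" if "pa_mult Q x y r \<noteq> 0" for r
    using that assms by (auto elim!: pa_mult_support simp: valid_joins pa_carrier_def)
  ultimately show ?thesis by (auto simp: pa_carrier_def)
qed

lemma pa_carrier_zero [simp]: "(\<lambda>_. 0) \<in> pa_carrier Q"
  by (simp add: pa_carrier_def)

lemma pa_carrier_add:
  assumes "x \<in> pa_carrier Q" "y \<in> pa_carrier Q"
  shows "(\<lambda>p. x p + y p) \<in> pa_carrier Q"
proof -
  have "{p. x p + y p \<noteq> 0} \<subseteq> {p. x p \<noteq> 0} \<union> {p. y p \<noteq> 0}" by auto
  then show ?thesis using assms
    by (auto simp: pa_carrier_def intro: finite_subset)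
qed

lemma pa_carrier_scale: "x \<in> pa_carrier Q \<Longrightarrow> (\<lambda>p. c * x p) \<in> pa_carrier Q"
  by (auto simp: pa_carrier_def elim: rev_finite_subset)

lemma pa_carrier_bvec [simp]: "bvec p \<in> pa_carrier Q \<longleftrightarrow> valid_path Q p"
proof -
  have "{q. bvec p q \<noteq> (0 :: 'c)} = {p}" by (auto simp: bvec_def)
  then have "finite {q. bvec p q \<noteq> (0 :: 'c)}" by simp
  then show ?thesis unfolding pa_carrier_def by (auto simp: bvec_def simp del: split_paired_All)
qed

lemma pa_carrier_one: "finite_quiver Q \<Longrightarrow> pa_one Q \<in> pa_carrier Q"
proof -
  assume "finite_quiver Q"
  moreover have "{p. pa_one Q p \<noteq> 0} \<subseteq> verts Q \<times> {[]}" by (auto simp: pa_one_def)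
  ultimately show ?thesis
    by (auto simp: pa_carrier_def finite_quiver_def pa_one_def valid_path_def
        intro: finite_subset split: if_splits)
qed

lemma pa_mult_one_left:
  assumes "finite_quiver Q" "x \<in> pa_carrier Q"
  shows "pa_mult Q (pa_one Q) x = x"
proof (rule ext)
  fix r :: "'a \<times> 'b list"
  obtain v as where r: "r = (v, as)" by (cases r)
  have v: "x (v, as) \<noteq> 0 \<Longrightarrow> v \<in> verts Q"
    using assms by (auto simp: pa_carrier_def valid_path_def dest: chain_start)
  have "pa_mult Q (pa_one Q) x (v, as) =
      (\<Sum>k\<le>length as. if k = 0 then pa_one Q (v, []) * x (v, as) else 0)"
    unfolding pa_mult_split by (rule sum.cong) (auto simp: pa_one_def)
  then show "pa_mult Q (pa_one Q) x r = x r"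
    using v by (auto simp: r pa_one_def)
qed

lemma pa_mult_one_right:
  assumes "x \<in> pa_carrier Q"
  shows "pa_mult Q x (pa_one Q) = x"
proof (rule ext)
  fix r :: "'a \<times> 'b list"
  obtain v as where r: "r = (v, as)" by (cases r)
  have v: "x (v, as) \<noteq> 0 \<Longrightarrow> pend Q v as \<in> verts Q"
    using assms by (auto simp: pa_carrier_def valid_path_def dest: chain_end)
  have "pa_mult Q x (pa_one Q) (v, as) =
      (\<Sum>k\<le>length as. if k = length as then x (v, as) * pa_one Q (pend Q v as, []) else 0)"
    unfolding pa_mult_split by (rule sum.cong) (auto simp: pa_one_def)
  then show "pa_mult Q x (pa_one Q) r = x r"
    using v by (auto simp: r pa_one_def)
qed

text \<open>Induction on the size of the support. The condition \<open>x p = 0\<close> keeps the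
  supports of the two summands disjoint, so that no cancellation hides a path;
  \<open>supp_ideal\<close> depends on this.\<close>

lemma pa_induct [consumes 1, case_names zero add]:
  assumes "x \<in> pa_carrier Q"
    and "H (\<lambda>_. 0)"
    and "\<And>x p c. x \<in> pa_carrier Q \<Longrightarrow> H x \<Longrightarrow> x p = 0 \<Longrightarrow> c \<noteq> 0 \<Longrightarrow> valid_path Q p \<Longrightarrow>
      H (\<lambda>r. x r + c * bvec p r)"
  shows "H x"
  using assms(1)
proof (induction "card {p. x p \<noteq> 0}" arbitrary: x)
  case 0
  then have "x = (\<lambda>_. 0)" by (auto simp: pa_carrier_def fun_eq_iff)
  then show ?case using assms(2) by simp
next
  case (Suc n)
  from Suc.hyps(2) obtain p where p: "x p \<noteq> 0"
    by (metis (mono_tags, lifting) Collect_empty_eq card.empty nat.distinct(1))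
  define y where "y = x(p := 0)"
  have fin: "finite {p. x p \<noteq> 0}" and val: "\<And>q. x q \<noteq> 0 \<Longrightarrow> valid_path Q q"
    using Suc.prems by (auto simp: pa_carrier_def)
  have eq: "{q. y q \<noteq> 0} = {q. x q \<noteq> 0} - {p}" by (auto simp: y_def)
  have "y \<in> pa_carrier Q"
    unfolding pa_carrier_def using eq fin val by (auto simp: y_def)
  moreover have "n = card {q. y q \<noteq> 0}" unfolding eq using Suc.hyps(2) p fin by simp
  ultimately have "H y" using Suc.hyps(1) by blast
  moreover have "x = (\<lambda>r. y r + x p * bvec p r)"
    by (auto simp: y_def bvec_def fun_eq_iff)
  ultimately show ?case
    using assms(3)[of y p "x p"] \<open>y \<in> pa_carrier Q\<close> p val by (simp add: y_def)
qed

text \<open>Lets the product formulas for T(A) be checked on pairs of paths. Linearity is assumed in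
  the single shape x + c * x', which is the shape produced by \<open>pa_induct\<close>.\<close>

lemma bilinear_ext:
  fixes F G :: "('v \<times> 'a list \<Rightarrow> 'k::field) \<Rightarrow> ('v \<times> 'a list \<Rightarrow> 'k) \<Rightarrow> 'k"
  assumes "x \<in> pa_carrier Q" "y \<in> pa_carrier Q"
    and F: "\<And>x x' y c. F (\<lambda>p. x p + c * x' p) y = F x y + c * F x' y"
      "\<And>x y y' c. F x (\<lambda>p. y p + c * y' p) = F x y + c * F x y'"
    and G: "\<And>x x' y c. G (\<lambda>p. x p + c * x' p) y = G x y + c * G x' y"
      "\<And>x y y' c. G x (\<lambda>p. y p + c * y' p) = G x y + c * G x y'"
    and eq: "\<And>p q. valid_path Q p \<Longrightarrow> valid_path Q q \<Longrightarrow> F (bvec p) (bvec q) = G (bvec p) (bvec q)"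
  shows "F x y = G x y"
proof -
  have Fz: "F (\<lambda>_. 0) y = 0" "F x (\<lambda>_. 0) = 0" for x y
    using F(1)[of "\<lambda>_. 0" "-1" "\<lambda>_. 0" y] F(2)[of x "\<lambda>_. 0" "-1" "\<lambda>_. 0"] by auto
  have Gz: "G (\<lambda>_. 0) y = 0" "G x (\<lambda>_. 0) = 0" for x y
    using G(1)[of "\<lambda>_. 0" "-1" "\<lambda>_. 0" y] G(2)[of x "\<lambda>_. 0" "-1" "\<lambda>_. 0"] by auto
  have 1: "F (bvec p) y = G (bvec p) y" if "valid_path Q p" for p
    using assms(2) by (induction rule: pa_induct) (use that in \<open>auto simp: Fz Gz F G eq\<close>)
  show ?thesis
    using assms(1) by (induction rule: pa_induct) (auto simp: Fz Gz F G 1)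
qed

section \<open>Ideals of path algebras\<close>

lemma ideal_gen_carrier:
  assumes "finite_quiver Q" "R \<subseteq> pa_carrier Q" "x \<in> ideal_gen Q R"
  shows "x \<in> pa_carrier Q"
  using assms(3) by induction (use assms in \<open>auto intro: pa_carrier_add pa_carrier_mult\<close>)

lemma ideal_gen_scale:
  assumes "finite_quiver Q" "R \<subseteq> pa_carrier Q" "x \<in> ideal_gen Q R"
  shows "(\<lambda>p. c * x p) \<in> ideal_gen Q R"
proof -
  have "pa_mult Q (\<lambda>p. c * pa_one Q p) x \<in> ideal_gen Q R"
    by (intro ideal_gen.lmult assms pa_carrier_scale pa_carrier_one)
  then show ?thesis
    using pa_mult_one_left[OF assms(1) ideal_gen_carrier[OF assms]]
    by (simp add: pa_mult_scale_left)
qed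

text \<open>Multiplication only lengthens paths, so a length bound on the relations passes to the
  ideal. This is the means of showing that something is not in an ideal: trivial paths for both
  graphs, and a path of length m for the star.\<close>

lemma ideal_gen_length:
  assumes "\<And>r p. r \<in> R \<Longrightarrow> r p \<noteq> 0 \<Longrightarrow> N \<le> length (snd p)"
    and "x \<in> ideal_gen Q R" "x p \<noteq> 0"
  shows "N \<le> length (snd p)"
  using assms(2,3)
proof (induction arbitrary: p)
  case (gen r) then show ?case using assms(1) by blast
next
  case (add x y) then show ?case by (metis add.right_neutral)
next
  case (lmult x a)
  from lmult.prems obtain q r where "a q \<noteq> 0" "x r \<noteq> 0" "joins Q q r p"
    by (rule pa_mult_support)
  then show ?case using lmult.IH[of r] by (auto simp: joins_def cat_def)
next
  case (rmult x a)
  from rmult.prems obtain q r where "x q \<noteq> 0" "a r \<noteq> 0" "joins Q q r p"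
    by (rule pa_mult_support)
  then show ?case using rmult.IH[of q] by (auto simp: joins_def cat_def)
qed auto

lemma bvec_ideal_factor:
  fixes R :: "('v \<times> 'a list \<Rightarrow> 'k::field) set"
  assumes "finite_quiver Q" "valid_path Q (v, as @ bs @ cs)"
    and "bvec (pend Q v as, bs) \<in> ideal_gen Q R"
  shows "bvec (v, as @ bs @ cs) \<in> ideal_gen Q R"
proof -
  have v: "valid_path Q (v, as)" "valid_path Q (pend Q v (as @ bs), cs)"
    using assms(1,2) by (auto simp: valid_path_def chain_append pend_append)
  have "pa_mult Q (bvec (v, as)) (bvec (pend Q v as, bs)) = (bvec (v, as @ bs) :: _ \<Rightarrow> 'k)"
    by (rule pa_mult_bvec_joins) (simp add: joins_def cat_def)
  then have 1: "bvec (v, as @ bs) \<in> ideal_gen Q R"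
    using ideal_gen.lmult[OF assms(3), of "bvec (v, as)"] v by simp
  have "pa_mult Q (bvec (v, as @ bs)) (bvec (pend Q v (as @ bs), cs)) = (bvec (v, as @ bs @ cs) :: _ \<Rightarrow> 'k)"
    by (rule pa_mult_bvec_joins) (simp add: joins_def cat_def)
  then show ?thesis
    using ideal_gen.rmult[OF 1, of "bvec (pend Q v (as @ bs), cs)"] v by simp
qed

lemma supp_ideal:
  assumes "finite_quiver Q" "R \<subseteq> pa_carrier Q" "x \<in> pa_carrier Q"
    and "\<And>p. x p \<noteq> 0 \<Longrightarrow> bvec p \<in> ideal_gen Q R"
  shows "x \<in> ideal_gen Q R"
  using assms(3,4)
proof (induction rule: pa_induct)
  case zero show ?case by (rule ideal_gen.zero)
next
  case (add x p c)
  have "bvec q \<in> ideal_gen Q R" if "x q \<noteq> 0" for q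
    using add.prems[of q] that add.hyps by (auto simp: bvec_def split: if_splits)
  then have "x \<in> ideal_gen Q R" by (rule add.IH)
  moreover have "bvec p \<in> ideal_gen Q R"
    using add.prems[of p] add.hyps by (simp add: bvec_def)
  then have "(\<lambda>r. c * bvec p r) \<in> ideal_gen Q R"
    by (rule ideal_gen_scale[OF assms(1,2)])
  ultimately show ?case by (rule ideal_gen.add)
qed

definition has_rel :: "('a \<times> 'a) set \<Rightarrow> 'a list \<Rightarrow> bool" where
  "has_rel Rel as \<longleftrightarrow> (\<exists>xs a b ys. as = xs @ [a, b] @ ys \<and> (a, b) \<in> Rel)"

lemma has_rel_append: "has_rel Rel as \<or> has_rel Rel bs \<Longrightarrow> has_rel Rel (as @ bs)"
  unfolding has_rel_def by (metis append.assoc)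

text \<open>Membership is decided path by path, which turns the kernel of a presentation of A into a
  condition on coordinates.\<close>

lemma monomial_ideal:
  assumes fin: "finite_quiver Q" and comp: "\<forall>(a, b)\<in>Rel. composable Q a b"
  shows "x \<in> ideal_gen Q (rel_elems Q Rel) \<longleftrightarrow>
    x \<in> pa_carrier Q \<and> (\<forall>p. x p \<noteq> 0 \<longrightarrow> has_rel Rel (snd p))"
proof -
  have "valid_path Q (src Q a, [a, b])" if "(a, b) \<in> Rel" for a b
    using that comp fin by (auto simp: valid_path_def composable_def finite_quiver_def)
  then have R: "rel_elems Q Rel \<subseteq> (pa_carrier Q :: ('a \<times> 'b list \<Rightarrow> 'c) set)"
    by (auto simp: rel_elems_def)
  have *: "has_rel Rel (snd p)" if "x \<in> ideal_gen Q (rel_elems Q Rel)" "x p \<noteq> 0" for p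
    using that
  proof (induction arbitrary: p)
    case (gen r)
    then obtain a b where "r = bvec (src Q a, [a, b])" "(a, b) \<in> Rel"
      by (auto simp: rel_elems_def)
    moreover from this gen have "p = (src Q a, [a, b])" by (auto simp: bvec_def split: if_splits)
    ultimately show ?case unfolding has_rel_def by (intro exI[of _ "[]"]) auto
  next
    case (add x y) then show ?case by (metis add.right_neutral)
  next
    case (lmult x a)
    from lmult.prems obtain q r where qr: "a q \<noteq> 0" "x r \<noteq> 0" "joins Q q r p"
      by (rule pa_mult_support)
    then show ?case using lmult.IH[of r] by (simp add: joins_def cat_def has_rel_append)
  next
    case (rmult x a)
    from rmult.prems obtain q r where qr: "x q \<noteq> 0" "a r \<noteq> 0" "joins Q q r p"
      by (rule pa_mult_support)
    then show ?case using rmult.IH[of q] by (simp add: joins_def cat_def has_rel_append)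
  qed auto
  have **: "bvec p \<in> ideal_gen Q (rel_elems Q Rel)" if p: "valid_path Q p" "has_rel Rel (snd p)" for p
  proof -
    obtain xs a b ys where ab: "snd p = xs @ [a, b] @ ys" "(a, b) \<in> Rel"
      using p by (auto simp: has_rel_def)
    moreover have "pend Q (fst p) xs = src Q a"
      using p(1) ab(1) fin by (auto simp: valid_path_def chain_append)
    ultimately have "bvec (pend Q (fst p) xs, [a, b]) \<in> ideal_gen Q (rel_elems Q Rel)"
      by (intro ideal_gen.gen) (auto simp: rel_elems_def)
    then show ?thesis
      using bvec_ideal_factor[OF fin, of "fst p" xs "[a, b]" ys] p ab by (metis prod.collapse)
  qed
  show ?thesis
  proof
    assume "x \<in> ideal_gen Q (rel_elems Q Rel)"
    then show "x \<in> pa_carrier Q \<and> (\<forall>p. x p \<noteq> 0 \<longrightarrow> has_rel Rel (snd p))"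
      using * ideal_gen_carrier[OF fin R] by blast
  next
    assume x: "x \<in> pa_carrier Q \<and> (\<forall>p. x p \<noteq> 0 \<longrightarrow> has_rel Rel (snd p))"
    show "x \<in> ideal_gen Q (rel_elems Q Rel)"
    proof (rule supp_ideal[OF fin R])
      show "x \<in> pa_carrier Q" using x by blast
      fix p assume "x p \<noteq> 0"
      with x have "valid_path Q p" "has_rel Rel (snd p)" unfolding pa_carrier_def by blast+
      then show "bvec p \<in> ideal_gen Q (rel_elems Q Rel)" by (rule **)
    qed
  qed
qed

section \<open>Algebras with a basis of paths and their trivial extensions\<close>

lemma pa_mult_lin_left:
  "pa_mult Q (\<lambda>p. x p + c * x' p) y = (\<lambda>r. pa_mult Q x y r + c * pa_mult Q x' y r)"
  by (simp add: pa_mult_add_left pa_mult_scale_left)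

lemma pa_mult_lin_right:
  "pa_mult Q y (\<lambda>p. x p + c * x' p) = (\<lambda>r. pa_mult Q y x r + c * pa_mult Q y x' r)"
  by (simp add: pa_mult_add_right pa_mult_scale_right)

text \<open>P stands for the set of nonzero paths: an element of A is determined by its coordinates
  on P. Closure of P under factors says that the remaining paths span an ideal.\<close>

locale path_basis =
  fixes Q :: "('v, 'a) quiver" and A :: "('k::field, 'e) alg"
    and \<psi> :: "('v \<times> 'a list \<Rightarrow> 'k) \<Rightarrow> 'e" and P :: "('v \<times> 'a list) set"
  assumes finQ: "finite_quiver Q"
    and hom: "pa_hom_onto Q A \<psi>"
    and ker: "\<And>x. x \<in> pa_carrier Q \<Longrightarrow> \<psi> x = azero A \<longleftrightarrow> (\<forall>p\<in>P. x p = 0)"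
    and finP: "finite P"
    and validP: "\<And>p. p \<in> P \<Longrightarrow> valid_path Q p"
    and factorP: "\<And>p q r. joins Q p q r \<Longrightarrow> r \<in> P \<Longrightarrow> p \<in> P \<and> q \<in> P"
    and trivP: "\<And>v. v \<in> verts Q \<Longrightarrow> (v, []) \<in> P"
begin

lemma psi_in: "x \<in> pa_carrier Q \<Longrightarrow> \<psi> x \<in> acarr A"
  and psi_zero: "\<psi> (\<lambda>_. 0) = azero A"
  and psi_one: "\<psi> (pa_one Q) = aone A"
  and psi_add: "x \<in> pa_carrier Q \<Longrightarrow> y \<in> pa_carrier Q \<Longrightarrow> \<psi> (\<lambda>p. x p + y p) = aadd A (\<psi> x) (\<psi> y)"
  and psi_scale: "x \<in> pa_carrier Q \<Longrightarrow> \<psi> (\<lambda>p. c * x p) = asmul A c (\<psi> x)"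
  and psi_mult: "x \<in> pa_carrier Q \<Longrightarrow> y \<in> pa_carrier Q \<Longrightarrow> \<psi> (pa_mult Q x y) = amul A (\<psi> x) (\<psi> y)"
  using hom unfolding pa_hom_onto_def by blast+

lemma psi_onto:
  assumes "a \<in> acarr A"
  obtains x where "x \<in> pa_carrier Q" "\<psi> x = a"
  using assms hom unfolding pa_hom_onto_def by blast

lemma psi_eq:
  assumes x: "x \<in> pa_carrier Q" and y: "y \<in> pa_carrier Q"
  shows "\<psi> x = \<psi> y \<longleftrightarrow> (\<forall>p\<in>P. x p = y p)"
proof -
  \<comment> \<open>The record \<open>alg\<close> carries no axioms, so the difference is formed in
    the path algebra and carried over by \<psi>.\<close>
  let ?n = "\<lambda>p. (-1) * y p" and ?d = "\<lambda>p. x p + (-1) * y p"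
  have n: "?n \<in> pa_carrier Q" by (rule pa_carrier_scale[OF y])
  have d: "?d \<in> pa_carrier Q" by (rule pa_carrier_add[OF x n])
  have "\<psi> x = \<psi> y \<longleftrightarrow> \<psi> ?d = azero A"
  proof
    assume "\<psi> x = \<psi> y"
    then have "\<psi> ?d = \<psi> (\<lambda>p. y p + (-1) * y p)"
      using psi_add[OF x n] psi_add[OF y n] by simp
    then show "\<psi> ?d = azero A" by (simp add: psi_zero)
  next
    assume d0: "\<psi> ?d = azero A"
    have "\<psi> x = \<psi> (\<lambda>p. ?d p + y p)" by simp
    also have "\<dots> = aadd A (azero A) (\<psi> y)"
      by (simp only: psi_add[OF d y] d0)
    also have "\<dots> = \<psi> (\<lambda>p. 0 + y p)" 
      by (simp only: psi_add[OF pa_carrier_zero y] psi_zero)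
    finally show "\<psi> x = \<psi> y" by simp
  qed
  then show ?thesis using ker[OF d] by simp
qed

lemma sum_bvec_P: "p \<in> P \<Longrightarrow> (\<Sum>r\<in>P. bvec p r * w r) = w p"
proof -
  assume "p \<in> P"
  moreover have "(\<Sum>r\<in>P. bvec p r * w r) = (\<Sum>r\<in>P. if r = p then w p else 0)"
    by (rule sum.cong) (auto simp: bvec_def)
  ultimately show ?thesis using finP by simp
qed

text \<open>An arbitrary preimage is chosen; only its values on P are independent of the
  choice.\<close>

definition coef :: "'e \<Rightarrow> 'v \<times> 'a list \<Rightarrow> 'k" where
  "coef a = (SOME x. x \<in> pa_carrier Q \<and> \<psi> x = a)"

lemma coef_psi: "x \<in> pa_carrier Q \<Longrightarrow> p \<in> P \<Longrightarrow> coef (\<psi> x) p = x p"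
  using someI[of "\<lambda>y. y \<in> pa_carrier Q \<and> \<psi> y = \<psi> x" x] psi_eq
  unfolding coef_def by blast

text \<open>The functional with coordinates c in the dual basis. It is 0 outside A, as
  \<open>lin_functional\<close> demands, so functionals agreeing on A are equal as
  functions.\<close>

definition dual :: "('v \<times> 'a list \<Rightarrow> 'k) \<Rightarrow> 'e \<Rightarrow> 'k" where
  "dual c = (\<lambda>a. if a \<in> acarr A then \<Sum>p\<in>P. c p * coef a p else 0)"

lemma dual_psi: "x \<in> pa_carrier Q \<Longrightarrow> dual c (\<psi> x) = (\<Sum>p\<in>P. c p * x p)"
  by (simp add: dual_def psi_in coef_psi)

lemma dual_linear: "lin_functional A (dual c)"
proof -
  have 1: "dual c (aadd A a b) = dual c a + dual c b" if "a \<in> acarr A" "b \<in> acarr A" for a b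
  proof -
    from that obtain x y where x: "x \<in> pa_carrier Q" "\<psi> x = a" and y: "y \<in> pa_carrier Q" "\<psi> y = b"
      by (meson psi_onto)
    show ?thesis
      using dual_psi[OF pa_carrier_add[OF x(1) y(1)], of c] dual_psi[OF x(1), of c]
        dual_psi[OF y(1), of c] psi_add[OF x(1) y(1)] x y
      by (simp add: sum.distrib algebra_simps)
  qed
  have 2: "dual c (asmul A k a) = k * dual c a" if "a \<in> acarr A" for a k
  proof -
    from that obtain x where x: "x \<in> pa_carrier Q" "\<psi> x = a" by (meson psi_onto)
    show ?thesis
      using dual_psi[OF pa_carrier_scale[OF x(1)], of c k] dual_psi[OF x(1), of c]
        psi_scale[OF x(1), of k] x
      by (simp add: sum_distrib_left algebra_simps)
  qed
  show ?thesis unfolding lin_functional_def using 1 2 by (auto simp: dual_def)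
qed

lemma functional_psi:
  assumes f: "lin_functional A f" and x: "x \<in> pa_carrier Q"
  shows "f (\<psi> x) = (\<Sum>p\<in>P. f (\<psi> (bvec p)) * x p)"
proof -
  \<comment> \<open>Without algebra axioms, f 0 = 0 is obtained by scaling the zero of A, whose
    multiple by 0 is computed in the path algebra.\<close>
  have "f (asmul A 0 (azero A)) = 0 * f (azero A)"
    using f psi_in[OF pa_carrier_zero] unfolding lin_functional_def psi_zero by blast
  moreover have "asmul A 0 (azero A) = azero A"
    using psi_scale[OF pa_carrier_zero, of 0] by (simp add: psi_zero)
  ultimately have f0: "f (azero A) = 0" by simp
  show ?thesis using x
  proof (induction rule: pa_induct)
    case zero then show ?case by (simp add: psi_zero f0)
  next
    case (add x p c)
    have b: "bvec p \<in> pa_carrier Q" using add.hyps by simp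
    have "f (\<psi> (\<lambda>r. x r + c * bvec p r)) = f (\<psi> x) + c * f (\<psi> (bvec p))"
      using f psi_add[OF add.hyps(1) pa_carrier_scale[OF b, of c]] psi_scale[OF b, of c]
        psi_in[OF add.hyps(1)] psi_in[OF b] psi_in[OF pa_carrier_scale[OF b, of c]]
      unfolding lin_functional_def by simp
    moreover have "f (\<psi> (bvec p)) = (\<Sum>r\<in>P. f (\<psi> (bvec r)) * bvec p r)"
    proof (cases "p \<in> P")
      case True
      then show ?thesis
        using sum_bvec_P[OF True, of "\<lambda>r. f (\<psi> (bvec r))"] by (simp add: mult.commute)
    next
      case False
      then have "\<psi> (bvec p) = azero A" using ker[OF b] by (auto simp: bvec_def)
      moreover have "(\<Sum>r\<in>P. f (\<psi> (bvec r)) * bvec p r) = 0"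
        using False by (intro sum.neutral) (auto simp: bvec_def)
      ultimately show ?thesis using f0 by simp
    qed
    ultimately show ?case
      by (simp add: add.IH algebra_simps sum.distrib sum_distrib_left)
  qed
qed

lemma functional_dual:
  assumes f: "lin_functional A f"
  shows "f = dual (\<lambda>p. f (\<psi> (bvec p)))"
proof
  fix a
  show "f a = dual (\<lambda>p. f (\<psi> (bvec p))) a"
  proof (cases "a \<in> acarr A")
    case True
    then obtain x where "x \<in> pa_carrier Q" "\<psi> x = a" by (meson psi_onto)
    then show ?thesis using functional_psi[OF f, of x] dual_psi by auto
  qed (use f in \<open>simp_all add: dual_def lin_functional_def\<close>)
qed

lemma triv_ext_elem:
  assumes "t \<in> acarr (triv_ext A)"
  obtains u c where "u \<in> pa_carrier Q" "t = (\<psi> u, dual c)"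
proof -
  obtain a f where t: "t = (a, f)" "a \<in> acarr A" "lin_functional A f"
    using assms by (auto simp: triv_ext_def)
  then show ?thesis by (metis that functional_dual psi_onto)
qed

lemma triv_ext_mult:
  assumes "u \<in> pa_carrier Q" "v \<in> pa_carrier Q"
  shows "amul (triv_ext A) (\<psi> u, f) (\<psi> v, h) = (\<psi> (pa_mult Q u v),
    \<lambda>z. if z \<in> acarr A then h (amul A z (\<psi> u)) + f (amul A (\<psi> v) z) else 0)"
  using psi_mult[OF assms] by (simp add: triv_ext_def)

end

text \<open>The pair (p, True) stands for the basis element p of A and (p, False) for the dual
  basis element of DA; basis_prod Q s t u says that u is the product of s and t in T(A).\<close>

fun basis_prod :: "('v, 'a) quiver \<Rightarrow> ('v \<times> 'a list) \<times> bool \<Rightarrow> ('v \<times> 'a list) \<times> bool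
    \<Rightarrow> ('v \<times> 'a list) \<times> bool \<Rightarrow> bool" where
  "basis_prod Q (p, True) (q, True) (r, b) \<longleftrightarrow> b \<and> joins Q p q r"
| "basis_prod Q (p, True) (q, False) (r, b) \<longleftrightarrow> \<not> b \<and> joins Q r p q"
| "basis_prod Q (p, False) (q, True) (r, b) \<longleftrightarrow> \<not> b \<and> joins Q q r p"
| "basis_prod Q (p, False) (q, False) (r, b) \<longleftrightarrow> False"

text \<open>The vertices whose idempotents fix a basis element from the left and from the right;
  passing to the dual swaps them.\<close>

definition basis_ends :: "('v, 'a) quiver \<Rightarrow> ('v \<times> 'a list) \<times> bool \<Rightarrow> 'v \<times> 'v" where
  "basis_ends Q s = (let v = fst (fst s); w = pend Q (fst (fst s)) (snd (fst s)) in
     if snd s then (v, w) else (w, v))"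

lemma basis_prod_dual_left [simp]: "\<not> basis_prod Q (p, False) s (r, True)"
  by (cases s; cases "snd s") auto

lemma basis_prod_ends:
  "basis_prod Q s t u \<Longrightarrow> snd (basis_ends Q s) = fst (basis_ends Q t)"
  by (cases "(Q, s, t, u)" rule: basis_prod.cases)
    (auto simp: basis_ends_def joins_def cat_def pend_append Let_def)

lemma basis_prod_one_left:
  assumes "fst (basis_ends Q t) = v"
  shows "basis_prod Q ((v, []), True) t u \<longleftrightarrow> u = t"
proof -
  obtain x as b y bs b' where "t = ((x, as), b)" "u = ((y, bs), b')" by (metis prod.collapse)
  then show ?thesis using assms
    by (cases b) (auto simp: basis_ends_def joins_def cat_def)
qed

lemma basis_prod_one_right:
  assumes "snd (basis_ends Q t) = v"
  shows "basis_prod Q t ((v, []), True) u \<longleftrightarrow> u = t"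
proof -
  obtain x as b y bs b' where "t = ((x, as), b)" "u = ((y, bs), b')" by (metis prod.collapse)
  then show ?thesis using assms
    by (cases b) (auto simp: basis_ends_def joins_def cat_def)
qed

text \<open>The value of g is the basis element of T(A) represented by a path, with
  \<open>None\<close> for zero. Multiplicativity is demanded for nontrivial factors only, the rest
  following from \<open>g_triv\<close> and \<open>g_ends\<close>. Relations are zero relations or
  commutativity relations: \<open>R_sound\<close> says that they hold in T(A), while
  \<open>R_none\<close> and \<open>R_equal\<close> say that there are enough of them.\<close>

locale triv_ext_presentation = path_basis Q A \<psi> P
  for Q :: "('v, 'a) quiver" and A :: "('k::field, 'e) alg" and \<psi> P +
  fixes QB :: "('w, 'b) quiver" and R :: "('w \<times> 'b list \<Rightarrow> 'k) set"
    and g :: "'w \<times> 'b list \<Rightarrow> (('v \<times> 'a list) \<times> bool) option" and \<omega> :: "'w \<Rightarrow> 'v"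
  assumes finQB: "finite_quiver QB"
    and bij: "bij_betw \<omega> (verts QB) (verts Q)"
    and g_triv: "\<And>i. i \<in> verts QB \<Longrightarrow> g (i, []) = Some ((\<omega> i, []), True)"
    and g_trivD: "\<And>q v. g q = Some ((v, []), True) \<Longrightarrow> snd q = []"
    and g_valid: "\<And>q p b. g q = Some (p, b) \<Longrightarrow> valid_path QB q \<and> p \<in> P"
    and g_fin: "finite {q. g q \<noteq> None}"
    and g_onto: "\<And>p b. p \<in> P \<Longrightarrow> \<exists>q. g q = Some (p, b)"
    and g_ends: "\<And>q s. g q = Some s \<Longrightarrow>
      basis_ends Q s = (\<omega> (fst q), \<omega> (pend QB (fst q) (snd q)))"
    and g_mult: "\<And>q1 q2 q r b. joins QB q1 q2 q \<Longrightarrow> valid_path QB q \<Longrightarrow> snd q1 \<noteq> [] \<Longrightarrow> snd q2 \<noteq> [] \<Longrightarrow>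
      r \<in> P \<Longrightarrow> g q = Some (r, b) \<longleftrightarrow>
        (\<exists>s1 s2. g q1 = Some s1 \<and> g q2 = Some s2 \<and> basis_prod Q s1 s2 (r, b))"
    and R_sound: "\<And>x. x \<in> R \<Longrightarrow> (\<exists>q. valid_path QB q \<and> g q = None \<and> x = bvec q) \<or>
      (\<exists>q q'. g q \<noteq> None \<and> g q' = g q \<and> x = (\<lambda>p. bvec q p - bvec q' p))"
    and R_none: "\<And>q. valid_path QB q \<Longrightarrow> g q = None \<Longrightarrow> bvec q \<in> ideal_gen QB R"
    and R_equal: "\<And>q q'. g q \<noteq> None \<Longrightarrow> g q' = g q \<Longrightarrow> (\<lambda>p. bvec q p - bvec q' p) \<in> ideal_gen QB R"
begin


section \<open>Fibre sums, the coordinates of an image in T(A)\<close>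

definition fib :: "('w \<times> 'b list \<Rightarrow> 'k) \<Rightarrow> ('v \<times> 'a list) \<times> bool \<Rightarrow> 'k" where
  "fib x s = (\<Sum>q | g q = Some s. x q)"

lemma fib_lin: "fib (\<lambda>p. x p + c * y p) s = fib x s + c * fib y s"
  by (simp add: fib_def sum.distrib sum_distrib_left)

lemma fib_finite: "finite {q. g q = Some s}"
  by (rule finite_subset[OF _ g_fin]) (auto simp del: not_None_eq)

lemma fib_zero [simp]: "fib (\<lambda>_. 0) s = 0"
  by (simp add: fib_def)

lemma fib_bvec: "fib (bvec q) s = of_bool (g q = Some s)"
proof -
  have "fib (bvec q) s = (\<Sum>q' | g q' = Some s. if q' = q then 1 else 0)"
    unfolding fib_def bvec_def by simp
  then show ?thesis using fib_finite[of s] by (auto simp: of_bool_def)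
qed

lemma fib_nonzero: "fib x (p, b) \<noteq> 0 \<Longrightarrow> p \<in> P"
  using sum.neutral[of "{q. g q = Some (p, b)}" x] g_valid[of _ p b] unfolding fib_def by force

definition alg_part :: "('w \<times> 'b list \<Rightarrow> 'k) \<Rightarrow> 'v \<times> 'a list \<Rightarrow> 'k" where
  "alg_part x = (\<lambda>p. fib x (p, True))"

definition dual_part :: "('w \<times> 'b list \<Rightarrow> 'k) \<Rightarrow> 'v \<times> 'a list \<Rightarrow> 'k" where
  "dual_part x = (\<lambda>p. fib x (p, False))"

lemma alg_part_carrier: "alg_part x \<in> pa_carrier Q"
proof -
  have "{p. alg_part x p \<noteq> 0} \<subseteq> P" by (auto simp: alg_part_def dest: fib_nonzero)
  then show ?thesis
    using finP validP unfolding pa_carrier_def by (blast intro: finite_subset)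
qed

lemma alg_part_lin: "alg_part (\<lambda>p. x p + c * y p) = (\<lambda>p. alg_part x p + c * alg_part y p)"
  and dual_part_lin: "dual_part (\<lambda>p. x p + c * y p) = (\<lambda>p. dual_part x p + c * dual_part y p)"
  by (simp_all add: alg_part_def dual_part_def fib_lin)

lemma alg_part_bvec:
  "alg_part (bvec q) = (case g q of Some (p, True) \<Rightarrow> bvec p | _ \<Rightarrow> (\<lambda>_. 0))"
  unfolding alg_part_def fib_bvec by (auto simp: bvec_def split: option.splits bool.splits)

lemma dual_part_bvec:
  "dual_part (bvec q) = (case g q of Some (p, False) \<Rightarrow> bvec p | _ \<Rightarrow> (\<lambda>_. 0))"
  unfolding dual_part_def fib_bvec by (auto simp: bvec_def split: option.splits bool.splits)

lemma omega_inj: "i \<in> verts QB \<Longrightarrow> j \<in> verts QB \<Longrightarrow> \<omega> i = \<omega> j \<Longrightarrow> i = j"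
  using bij by (auto simp: bij_betw_def inj_on_def)

text \<open>A trivial factor acts as the idempotent at its vertex. For paths that do not compose, a
  nonzero product of their images would force two ends to have the same image under \<omega>, which
  is injective on vertices.\<close>

lemma g_mult_full:
  assumes v: "valid_path QB q1" "valid_path QB q2" and r: "r \<in> P"
  shows "(\<exists>q. joins QB q1 q2 q \<and> g q = Some (r, b)) \<longleftrightarrow>
    (\<exists>s1 s2. g q1 = Some s1 \<and> g q2 = Some s2 \<and> basis_prod Q s1 s2 (r, b))"
proof (cases "fst q2 = pend QB (fst q1) (snd q1)")
  case False
  have "\<not> basis_prod Q s1 s2 (r, b)" if "g q1 = Some s1" "g q2 = Some s2" for s1 s2
  proof
    assume "basis_prod Q s1 s2 (r, b)"
    then have "\<omega> (pend QB (fst q1) (snd q1)) = \<omega> (fst q2)"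
      using basis_prod_ends g_ends[OF that(1)] g_ends[OF that(2)] by fastforce
    moreover have "pend QB (fst q1) (snd q1) \<in> verts QB" "fst q2 \<in> verts QB"
      using v by (auto simp: valid_path_def intro: chain_end chain_start[OF finQB])
    ultimately show False using False omega_inj by fastforce
  qed
  then show ?thesis using False by (auto simp: joins_def)
next
  case True
  then have j: "joins QB q1 q2 (cat q1 q2)" by (simp add: joins_def)
  have vc: "valid_path QB (cat q1 q2)" using valid_joins[OF finQB j] v by simp
  have *: "g (cat q1 q2) = Some (r, b) \<longleftrightarrow>
    (\<exists>s1 s2. g q1 = Some s1 \<and> g q2 = Some s2 \<and> basis_prod Q s1 s2 (r, b))"
  proof (cases "snd q1 = []")
    case T: True
    then have q1: "q1 = (fst q1, [])" by (simp add: prod_eq_iff)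
    have eq: "cat q1 q2 = q2" "fst q2 = fst q1"
      using T True by (simp_all add: cat_def prod_eq_iff)
    have "fst q1 \<in> verts QB" using v(1) T by (simp add: valid_path_def)
    then have g1: "g q1 = Some ((\<omega> (fst q1), []), True)" using g_triv q1 by metis
    have "basis_prod Q ((\<omega> (fst q1), []), True) s (r, b) \<longleftrightarrow> (r, b) = s" if "g q2 = Some s" for s
      by (rule basis_prod_one_left) (use g_ends[OF that] eq in simp)
    then show ?thesis using g1 eq
      by (cases "g q2") (auto simp del: split_paired_All split_paired_Ex)
  next
    case nT: False
    show ?thesis
    proof (cases "snd q2 = []")
      case T: True
      then have q2: "q2 = (fst q2, [])" by (simp add: prod_eq_iff)
      have eq: "cat q1 q2 = q1" using T by (simp add: cat_def)
      have "fst q2 \<in> verts QB" using v(2) T by (simp add: valid_path_def)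
      then have g2: "g q2 = Some ((\<omega> (fst q2), []), True)" using g_triv q2 by metis
      have "basis_prod Q s ((\<omega> (fst q2), []), True) (r, b) \<longleftrightarrow> (r, b) = s" if "g q1 = Some s" for s
        by (rule basis_prod_one_right) (use g_ends[OF that] True in simp)
      then show ?thesis using g2 eq
        by (cases "g q1") (auto simp del: split_paired_All split_paired_Ex)
    next
      case False
      then show ?thesis using g_mult[OF j vc nT False r] by blast
    qed
  qed
  show ?thesis using * j by (auto simp: joins_def)
qed

lemma fib_mult_bvec:
  "fib (pa_mult QB (bvec q1) (bvec q2)) s = of_bool (\<exists>q. joins QB q1 q2 q \<and> g q = Some s)"
proof (cases "\<exists>q. joins QB q1 q2 q")
  case True
  then obtain q where q: "joins QB q1 q2 q" by blast
  then have "q' = q" if "joins QB q1 q2 q'" for q' using that by (simp add: joins_def)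
  then have "(\<exists>q'. joins QB q1 q2 q' \<and> g q' = Some s) \<longleftrightarrow> g q = Some s" using q by blast
  then show ?thesis by (simp add: pa_mult_bvec_joins[OF q] fib_bvec)
next
  case False
  then have "pa_mult QB (bvec q1) (bvec q2) = (\<lambda>_. 0 :: 'k)" by (auto simp: pa_mult_bvec)
  then show ?thesis using False by auto
qed

lemma alg_part_mult:
  assumes "x \<in> pa_carrier QB" "y \<in> pa_carrier QB" "r \<in> P"
  shows "alg_part (pa_mult QB x y) r = pa_mult Q (alg_part x) (alg_part y) r"
proof (rule bilinear_ext[OF assms(1,2)])
  fix q1 q2 assume v: "valid_path QB q1" "valid_path QB q2"
  show "alg_part (pa_mult QB (bvec q1) (bvec q2)) r = pa_mult Q (alg_part (bvec q1)) (alg_part (bvec q2)) r"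
    unfolding alg_part_bvec unfolding alg_part_def fib_mult_bvec g_mult_full[OF v assms(3)]
    by (simp split: option.split bool.split) (auto simp: pa_mult_bvec)
qed (simp_all add: pa_mult_lin_left pa_mult_lin_right alg_part_lin)

text \<open>The rule (a,f)(b,g) = (ab, ag + fb) in coordinates: at the test path r the first sum is
  g evaluated at r a, the second is f evaluated at b r.\<close>

lemma dual_part_mult_bvec:
  assumes "x \<in> pa_carrier QB" "y \<in> pa_carrier QB" "r \<in> P"
  shows "dual_part (pa_mult QB x y) r =
    (\<Sum>p\<in>P. dual_part y p * pa_mult Q (bvec r) (alg_part x) p) +
    (\<Sum>p\<in>P. dual_part x p * pa_mult Q (alg_part y) (bvec r) p)"
proof (rule bilinear_ext[OF assms(1,2)])
  fix q1 q2 assume v: "valid_path QB q1" "valid_path QB q2"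
  have P: "\<And>p b. g q1 = Some (p, b) \<Longrightarrow> p \<in> P" "\<And>p b. g q2 = Some (p, b) \<Longrightarrow> p \<in> P"
    using g_valid by blast+
  show "dual_part (pa_mult QB (bvec q1) (bvec q2)) r =
    (\<Sum>p\<in>P. dual_part (bvec q2) p * pa_mult Q (bvec r) (alg_part (bvec q1)) p) +
    (\<Sum>p\<in>P. dual_part (bvec q1) p * pa_mult Q (alg_part (bvec q2)) (bvec r) p)"
    unfolding alg_part_bvec dual_part_bvec
    unfolding dual_part_def fib_mult_bvec g_mult_full[OF v assms(3)]
    by (simp add: P sum_bvec_P split: option.split bool.split) (auto simp: pa_mult_bvec)
qed (simp_all add: pa_mult_lin_left pa_mult_lin_right alg_part_lin dual_part_lin
    sum.distrib sum_distrib_left algebra_simps)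

lemma dual_part_mult:
  assumes x: "x \<in> pa_carrier QB" and y: "y \<in> pa_carrier QB" and "w \<in> pa_carrier Q"
  shows "(\<Sum>r\<in>P. dual_part (pa_mult QB x y) r * w r) =
    (\<Sum>p\<in>P. dual_part y p * pa_mult Q w (alg_part x) p) +
    (\<Sum>p\<in>P. dual_part x p * pa_mult Q (alg_part y) w p)"
  using assms(3)
proof (induction rule: pa_induct)
  case zero then show ?case by simp
next
  case (add w r c)
  have "(\<Sum>p\<in>P. dual_part (pa_mult QB x y) p * bvec r p) =
    (\<Sum>p\<in>P. dual_part y p * pa_mult Q (bvec r) (alg_part x) p) +
    (\<Sum>p\<in>P. dual_part x p * pa_mult Q (alg_part y) (bvec r) p)"
  proof (cases "r \<in> P")
    case True
    then show ?thesis
      using dual_part_mult_bvec[OF x y True] sum_bvec_P[OF True, of "dual_part (pa_mult QB x y)"]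
      by (simp add: mult.commute)
  next
    case False
    have 0: "bvec r p = (0 :: 'k)" if "p \<in> P" for p using that False by (auto simp: bvec_def)
    \<comment> \<open>A test path outside P is zero in A, and so is each of its multiples, so both
      sides vanish.\<close>
    have "\<not> joins Q r q p \<and> \<not> joins Q q r p" if "p \<in> P" for p q
      using factorP that False by blast
    then have "pa_mult Q (bvec r) z p = 0 \<and> pa_mult Q z (bvec r) p = 0" if "p \<in> P"
      for z :: "'v \<times> 'a list \<Rightarrow> 'k" and p
      using that by (metis bvec_def pa_mult_support)
    then show ?thesis using 0 by simp
  qed
  moreover have "(\<Sum>p\<in>P. f p * (a p + c * b p)) = (\<Sum>p\<in>P. f p * a p) + c * (\<Sum>p\<in>P. f p * b p)"
    for f a b :: "'v \<times> 'a list \<Rightarrow> 'k"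
    by (simp add: sum.distrib sum_distrib_left algebra_simps)
  ultimately show ?case
    by (simp add: pa_mult_lin_left pa_mult_lin_right add.IH distrib_left)
qed

section \<open>The homomorphism onto T(A) and its kernel\<close>

definition \<Phi> :: "('w \<times> 'b list \<Rightarrow> 'k) \<Rightarrow> 'e \<times> ('e \<Rightarrow> 'k)" where
  "\<Phi> x = (\<psi> (alg_part x), dual (dual_part x))"

lemma Phi_mult:
  assumes x: "x \<in> pa_carrier QB" and y: "y \<in> pa_carrier QB"
  shows "\<Phi> (pa_mult QB x y) = amul (triv_ext A) (\<Phi> x) (\<Phi> y)"
proof -
  have "\<psi> (alg_part (pa_mult QB x y)) = \<psi> (pa_mult Q (alg_part x) (alg_part y))"
    using alg_part_mult[OF x y]
    by (subst psi_eq) (auto intro: alg_part_carrier pa_carrier_mult finQ)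
  moreover have "dual (dual_part (pa_mult QB x y)) z =
      (if z \<in> acarr A then dual (dual_part y) (amul A z (\<psi> (alg_part x))) +
        dual (dual_part x) (amul A (\<psi> (alg_part y)) z) else 0)" for z
  proof (cases "z \<in> acarr A")
    case True
    then obtain w where w: "w \<in> pa_carrier Q" "z = \<psi> w" by (metis psi_onto)
    have a: "alg_part x \<in> pa_carrier Q" for x by (rule alg_part_carrier)
    have "amul A z (\<psi> (alg_part x)) = \<psi> (pa_mult Q w (alg_part x))"
      "amul A (\<psi> (alg_part y)) z = \<psi> (pa_mult Q (alg_part y) w)"
      by (simp_all only: w(2) psi_mult[OF w(1) a] psi_mult[OF a w(1)])
    then show ?thesis
      using dual_part_mult[OF x y w(1)] True
      by (simp add: dual_psi a w(1) pa_carrier_mult[OF finQ]) (simp add: w dual_psi)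
  qed (simp add: dual_def)
  ultimately show ?thesis
    unfolding \<Phi>_def by (simp add: triv_ext_mult alg_part_carrier fun_eq_iff)
qed

lemma alg_part_one: "alg_part (pa_one QB) = pa_one Q"
  and dual_part_one: "dual_part (pa_one QB) = (\<lambda>_. 0)"
proof -
  have *: "fib (pa_one QB) s = of_bool (\<exists>v\<in>verts Q. s = ((v, []), True))" for s
  proof (cases "\<exists>v\<in>verts Q. s = ((v, []), True)")
    case True
    then obtain i where i: "i \<in> verts QB" "s = ((\<omega> i, []), True)"
      using bij by (auto simp: bij_betw_def)
    have "q = (i, [])" if q: "g q = Some s" for q
    proof -
      have "snd q = []" using q g_trivD i(2) by blast
      then have "q = (fst q, [])" by (simp add: prod_eq_iff)
      moreover have "valid_path QB q" using g_valid q i(2) by blast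
      ultimately have "fst q \<in> verts QB" by (metis chain.simps(1) snd_conv valid_path_def)
      moreover from this have "\<omega> (fst q) = \<omega> i"
        using g_triv[of "fst q"] \<open>q = (fst q, [])\<close> q i(2) by simp
      ultimately show ?thesis using omega_inj[OF _ i(1)] \<open>q = (fst q, [])\<close> by metis
    qed
    then have "{q. g q = Some s} = {(i, [])}" using g_triv[OF i(1)] i(2) by blast
    then have "fib (pa_one QB) s = 1" using i(1) by (simp add: fib_def pa_one_def)
    then show ?thesis using True by simp
  next
    case False
    have "pa_one QB q = (0::'k)" if q: "g q = Some s" for q
    proof (rule ccontr)
      assume "pa_one QB q \<noteq> (0::'k)"
      then have 1: "snd q = []" "fst q \<in> verts QB" by (auto simp: pa_one_def split: if_splits)
      then have "q = (fst q, [])" by (simp add: prod_eq_iff)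
      then have "s = ((\<omega> (fst q), []), True)" using g_triv[OF 1(2)] q by simp
      moreover have "\<omega> (fst q) \<in> verts Q" using 1 bij by (auto simp: bij_betw_def)
      ultimately show False using False by blast
    qed
    then have "fib (pa_one QB) s = 0" unfolding fib_def by (intro sum.neutral) blast
    then show ?thesis using False by simp
  qed
  show "alg_part (pa_one QB) = pa_one Q" "dual_part (pa_one QB) = (\<lambda>_. 0)"
    unfolding alg_part_def dual_part_def * by (auto simp: fun_eq_iff pa_one_def)
qed

lemma Phi_onto:
  assumes u: "u \<in> pa_carrier Q"
  obtains x where "x \<in> pa_carrier QB" "\<Phi> x = (\<psi> u, dual c)"
proof -
  define h where "h s = (SOME q. g q = Some s)" for s
  have h: "g (h (p, b)) = Some (p, b)" if "p \<in> P" for p b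
    unfolding h_def by (rule someI_ex) (rule g_onto[OF that])
  define val where "val s = (if snd s then u (fst s) else c (fst s))" for s
  \<comment> \<open>The preimage is supported on one chosen path per basis element, so each of its
    fibre sums has a single term.\<close>
  define x where "x q = (case g q of None \<Rightarrow> 0 | Some s \<Rightarrow> if h s = q then val s else 0)" for q
  have "{q. x q \<noteq> 0} \<subseteq> {q. g q \<noteq> None}" 
    by (auto simp: x_def simp del: not_None_eq split: option.splits)
  then have "finite {q. x q \<noteq> 0}" using g_fin by (rule finite_subset)
  moreover have "valid_path QB q" if "x q \<noteq> 0" for q
    using that g_valid[of q] by (auto simp: x_def split: option.splits if_splits)
  ultimately have xc: "x \<in> pa_carrier QB" by (simp add: pa_carrier_def)
  have fib: "fib x (p, b) = val (p, b)" if "p \<in> P" for p b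
  proof -
    have "fib x (p, b) = (\<Sum>q | g q = Some (p, b). if q = h (p, b) then val (p, b) else 0)"
      unfolding fib_def by (rule sum.cong) (auto simp: x_def)
    then show ?thesis using h[OF that] fib_finite by simp
  qed
  have "\<psi> (alg_part x) = \<psi> u"
    using fib psi_eq[OF alg_part_carrier u] by (simp add: alg_part_def val_def)
  moreover have "dual (dual_part x) = dual c"
    by (auto simp: dual_def dual_part_def fib val_def fun_eq_iff intro: sum.cong)
  ultimately show ?thesis using that[OF xc] by (simp add: \<Phi>_def)
qed

lemma Phi_zero_iff:
  "\<Phi> x = azero (triv_ext A) \<longleftrightarrow> (\<forall>s. fib x s = 0)"
proof
  assume L: "\<Phi> x = azero (triv_ext A)"
  have "fib x (p, b) = 0" for p b
  proof (cases "p \<in> P")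
    case True
    have "alg_part x p = 0"
      using L ker[OF alg_part_carrier, of x] True by (simp add: \<Phi>_def triv_ext_def)
    moreover have "dual_part x p = 0"
    proof -
      have "0 = dual (dual_part x) (\<psi> (bvec p))" using L by (simp add: \<Phi>_def triv_ext_def)
      also have "\<dots> = (\<Sum>r\<in>P. bvec p r * dual_part x r)"
        by (simp add: dual_psi validP True mult.commute)
      also have "\<dots> = dual_part x p" by (rule sum_bvec_P[OF True])
      finally show ?thesis ..
    qed
    ultimately show ?thesis by (cases b) (auto simp: alg_part_def dual_part_def)
  qed (use fib_nonzero in blast)
  then show "\<forall>s. fib x s = 0" by simp
next
  assume "\<forall>s. fib x s = 0"
  then have "alg_part x = (\<lambda>_. 0)" "dual_part x = (\<lambda>_. 0)"
    by (auto simp: alg_part_def dual_part_def)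
  then show "\<Phi> x = azero (triv_ext A)"
    by (auto simp: \<Phi>_def triv_ext_def psi_zero dual_def)
qed

lemma fib_zero_iff: "(\<forall>s. fib x s = 0) \<longleftrightarrow> (\<forall>p\<in>P. alg_part x p = 0 \<and> dual_part x p = 0)"
proof
  assume 0: "\<forall>p\<in>P. alg_part x p = 0 \<and> dual_part x p = 0"
  have "fib x (p, b) = 0" for p b
    using 0 fib_nonzero[of x p b]
    by (cases b; cases "p \<in> P") (auto simp: alg_part_def dual_part_def simp del: split_paired_All)
  then show "\<forall>s. fib x s = 0" by simp
qed (simp add: alg_part_def dual_part_def del: split_paired_All)

lemma R_carrier: "R \<subseteq> pa_carrier QB"
proof
  fix x assume "x \<in> R"
  then consider q where "valid_path QB q" "x = bvec q"
    | q q' where "g q \<noteq> None" "g q' = g q" "x = (\<lambda>p. bvec q p + (-1) * bvec q' p)"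
    using R_sound[of x] by fastforce
  then show "x \<in> pa_carrier QB"
  proof cases
    case 2
    then have "valid_path QB q" "valid_path QB q'" using g_valid by (metis not_None_eq surj_pair)+
    then show ?thesis unfolding 2(3) by (intro pa_carrier_add pa_carrier_scale) simp_all
  qed simp
qed

text \<open>The product formulas see x only through \<open>alg_part x\<close> and
  \<open>dual_part x\<close>, so the elements with vanishing fibre sums are closed under
  multiplication from both sides.\<close>

lemma ideal_fib:
  assumes "x \<in> ideal_gen QB R"
  shows "\<forall>s. fib x s = 0"
  using assms
proof induction
  case (gen x)
  from R_sound[OF gen] show ?case
  proof (elim disjE exE conjE)
    fix q q' assume "g q' = g q" "x = (\<lambda>p. bvec q p - bvec q' p)"
    then show ?thesis
      using fib_lin[of "bvec q" "-1" "bvec q'"] by (simp add: fib_bvec)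
  qed (simp add: fib_bvec)
next
  case zero then show ?case by simp
next
  case (add x y) then show ?case using fib_lin[of x 1 y] by simp
next
  case (lmult x a)
  have x: "x \<in> pa_carrier QB" using ideal_gen_carrier[OF finQB R_carrier lmult.hyps(1)] .
  have "alg_part x = (\<lambda>_. 0)" "dual_part x = (\<lambda>_. 0)"
    using lmult.IH by (auto simp: alg_part_def dual_part_def)
  then show ?case
    unfolding fib_zero_iff by (simp add: alg_part_mult dual_part_mult_bvec lmult.hyps x del: split_paired_All)
next
  case (rmult x a)
  have x: "x \<in> pa_carrier QB" using ideal_gen_carrier[OF finQB R_carrier rmult.hyps(1)] .
  have "alg_part x = (\<lambda>_. 0)" "dual_part x = (\<lambda>_. 0)"
    using rmult.IH by (auto simp: alg_part_def dual_part_def)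
  then show ?case
    unfolding fib_zero_iff by (simp add: alg_part_mult dual_part_mult_bvec rmult.hyps x del: split_paired_All)
qed

text \<open>Choosing a representative h s in every fibre of g, each x is congruent to
  the combination of representatives whose coefficients are its fibre sums.\<close>

lemma fib_ideal:
  assumes "x \<in> pa_carrier QB" "\<forall>s. fib x s = 0"
  shows "x \<in> ideal_gen QB R"
proof -
  define h where "h s = (SOME q. g q = Some s)" for s
  have h: "g (h s) = g q" if "g q = Some s" for q s
    using someI[of "\<lambda>q. g q = Some s", OF that] that by (simp add: h_def)
  let ?S = "P \<times> (UNIV :: bool set)"
  have finS: "finite ?S" using finP by simp
  have red: "(\<lambda>r. bvec q r - (\<Sum>s\<in>?S. fib (bvec q) s * bvec (h s) r)) \<in> ideal_gen QB R"
    if q: "valid_path QB q" for q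
  proof (cases "g q")
    case None
    then show ?thesis using R_none[OF q] by (simp add: fib_bvec)
  next
    case (Some s)
    have "s \<in> ?S" using g_valid[of q "fst s" "snd s"] Some by (cases s) auto
    have "(\<Sum>s'\<in>?S. fib (bvec q) s' * bvec (h s') r) = bvec (h s) r" for r
    proof -
      have "(\<Sum>s'\<in>?S. fib (bvec q) s' * bvec (h s') r) =
          (\<Sum>s'\<in>?S. if s' = s then bvec (h s) r else 0)"
        by (rule sum.cong) (auto simp: fib_bvec Some)
      then show ?thesis using finS \<open>s \<in> ?S\<close> by simp
    qed
    then show ?thesis using R_equal[of q "h s"] h[OF Some] Some by simp
  qed
  have "(\<lambda>r. x r - (\<Sum>s\<in>?S. fib x s * bvec (h s) r)) \<in> ideal_gen QB R"
    using assms(1)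
  proof (induction rule: pa_induct)
    case zero then show ?case by (simp add: ideal_gen.zero)
  next
    case (add x q c)
    have "(\<lambda>r. (x r - (\<Sum>s\<in>?S. fib x s * bvec (h s) r)) +
        c * (bvec q r - (\<Sum>s\<in>?S. fib (bvec q) s * bvec (h s) r))) \<in> ideal_gen QB R"
      by (intro ideal_gen.add add.IH ideal_gen_scale[OF finQB R_carrier] red add.hyps)
    moreover have "(\<lambda>r. (x r - (\<Sum>s\<in>?S. fib x s * bvec (h s) r)) +
        c * (bvec q r - (\<Sum>s\<in>?S. fib (bvec q) s * bvec (h s) r))) =
      (\<lambda>r. (x r + c * bvec q r) - (\<Sum>s\<in>?S. fib (\<lambda>r. x r + c * bvec q r) s * bvec (h s) r))"
      by (simp add: fib_lin algebra_simps sum.distrib sum_distrib_left)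
    ultimately show ?case by simp
  qed
  then show ?thesis using assms(2) by simp
qed

lemma presentation: "iso_quot QB R (triv_ext A)"
proof -
  have "pa_hom_onto QB (triv_ext A) \<Phi>"
    unfolding pa_hom_onto_def
  proof (intro conjI ballI allI)
    fix x :: "'w \<times> 'b list \<Rightarrow> 'k" assume "x \<in> pa_carrier QB"
    show "\<Phi> x \<in> acarr (triv_ext A)"
      by (simp add: \<Phi>_def triv_ext_def psi_in alg_part_carrier dual_linear)
  next
    show "acarr (triv_ext A) \<subseteq> \<Phi> ` pa_carrier QB"
    proof
      fix t assume "t \<in> acarr (triv_ext A)"
      then obtain u c where "u \<in> pa_carrier Q" "t = (\<psi> u, dual c)" by (rule triv_ext_elem)
      then show "t \<in> \<Phi> ` pa_carrier QB" by (metis Phi_onto image_eqI)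
    qed
  next
    show "\<Phi> (\<lambda>_. 0) = azero (triv_ext A)" by (simp add: Phi_zero_iff)
  next
    show "\<Phi> (pa_one QB) = aone (triv_ext A)"
      by (simp add: \<Phi>_def alg_part_one dual_part_one psi_one triv_ext_def dual_def fun_eq_iff)
  next
    fix x y :: "'w \<times> 'b list \<Rightarrow> 'k" assume "x \<in> pa_carrier QB" "y \<in> pa_carrier QB"
    have "\<psi> (\<lambda>p. alg_part x p + alg_part y p) = aadd A (\<psi> (alg_part x)) (\<psi> (alg_part y))"
      by (intro psi_add alg_part_carrier)
    then show "\<Phi> (\<lambda>p. x p + y p) = aadd (triv_ext A) (\<Phi> x) (\<Phi> y)"
      using alg_part_lin[of x 1 y] dual_part_lin[of x 1 y]
      by (auto simp: \<Phi>_def triv_ext_def dual_def sum.distrib algebra_simps)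
  next
    fix c and x :: "'w \<times> 'b list \<Rightarrow> 'k" assume "x \<in> pa_carrier QB"
    have "\<psi> (\<lambda>p. c * alg_part x p) = asmul A c (\<psi> (alg_part x))"
      by (intro psi_scale alg_part_carrier)
    then show "\<Phi> (\<lambda>p. c * x p) = asmul (triv_ext A) c (\<Phi> x)"
      using alg_part_lin[of "\<lambda>_. 0" c x] dual_part_lin[of "\<lambda>_. 0" c x]
      by (auto simp: \<Phi>_def triv_ext_def dual_def sum_distrib_left algebra_simps
          alg_part_def[of "\<lambda>_. 0"] dual_part_def[of "\<lambda>_. 0"])
  next
    fix x y :: "'w \<times> 'b list \<Rightarrow> 'k" assume "x \<in> pa_carrier QB" "y \<in> pa_carrier QB"
    then show "\<Phi> (pa_mult QB x y) = amul (triv_ext A) (\<Phi> x) (\<Phi> y)" by (rule Phi_mult)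
  qed
  then show ?thesis
    unfolding iso_quot_def using Phi_zero_iff ideal_fib fib_ideal by metis
qed

end

abbreviation nonzero_paths :: "('v, 'a) quiver \<Rightarrow> ('a \<times> 'a) set \<Rightarrow> ('v \<times> 'a list) set" where
  "nonzero_paths Q Rel \<equiv> {p. valid_path Q p \<and> \<not> has_rel Rel (snd p)}"

lemma path_basis_of_iso:
  fixes A :: "('k::field, 'e) alg"
  assumes fin: "finite_quiver Q" and comp: "\<forall>(a, b)\<in>Rel. composable Q a b"
    and iso: "iso_quot Q (rel_elems Q Rel) A"
    and finP: "finite (nonzero_paths Q Rel)"
  obtains \<psi> where "path_basis Q A \<psi> (nonzero_paths Q Rel)"
proof -
  obtain \<psi> where hom: "pa_hom_onto Q A \<psi>"
    and ker: "\<And>x. x \<in> pa_carrier Q \<Longrightarrow> \<psi> x = azero A \<longleftrightarrow> x \<in> ideal_gen Q (rel_elems Q Rel)"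
    using iso unfolding iso_quot_def by blast
  have "path_basis Q A \<psi> (nonzero_paths Q Rel)"
  proof
    fix x :: "'a \<times> 'b list \<Rightarrow> 'k" assume x: "x \<in> pa_carrier Q"
    then show "\<psi> x = azero A \<longleftrightarrow> (\<forall>p\<in>(nonzero_paths Q Rel). x p = 0)"
      unfolding ker[OF x] monomial_ideal[OF fin comp] by (auto simp: pa_carrier_def)
  next
    fix p q r assume j: "joins Q p q r" and r: "r \<in> (nonzero_paths Q Rel)"
    have "has_rel Rel (snd r)" if "has_rel Rel (snd p) \<or> has_rel Rel (snd q)"
      using that j by (simp add: joins_def cat_def has_rel_append)
    then show "p \<in> (nonzero_paths Q Rel) \<and>
        q \<in> (nonzero_paths Q Rel)"
      using r valid_joins[OF fin j] by blast
  next
    fix v assume "v \<in> verts Q"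
    then show "(v, []) \<in> (nonzero_paths Q Rel)"
      by (simp add: valid_path_def has_rel_def)
  qed (use fin hom finP in auto)
  then show ?thesis by (rule that)
qed

lemma not_has_rel_empty [simp]: "\<not> has_rel {} as"
  by (simp add: has_rel_def)

lemma rel_elems_empty [simp]: "rel_elems Q {} = {}"
  by (simp add: rel_elems_def)

section \<open>The trivial extension of the linear quiver\<close>

text \<open>Arrow i of \<open>linA\<close> runs from i to i + 1, so this arrow list leads from
  vertex a to vertex b.\<close>

definition seg :: "nat \<Rightarrow> nat \<Rightarrow> nat \<times> nat list" where
  "seg a b = (a, [a..<b])"

lemma linA_simps [simp]:
  "verts (linA n) = {1..n}" "arrs (linA n) = {1..<n}" "src (linA n) i = i" "tgt (linA n) i = Suc i"
  by (simp_all add: linA_def)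

lemma finite_linA: "1 \<le> n \<Longrightarrow> finite_quiver (linA n)"
  by (auto simp: finite_quiver_def)

lemma linA_chain: "chain (linA n) v as \<longleftrightarrow> 1 \<le> v \<and> v + length as \<le> n \<and> as = [v..<v + length as]"
proof (induction as arbitrary: v)
  case (Cons a as)
  have "[v..<v + length (a # as)] = v # [Suc v..<Suc v + length as]"
    by (simp add: upt_conv_Cons del: upt_Suc)
  then show ?case using Cons.IH[of "Suc a"] by auto
qed auto

lemma linA_valid: "valid_path (linA n) p \<longleftrightarrow> (\<exists>a b. 1 \<le> a \<and> a \<le> b \<and> b \<le> n \<and> p = seg a b)"
proof
  assume "valid_path (linA n) p"
  then have "1 \<le> fst p" "fst p \<le> fst p + length (snd p)" "fst p + length (snd p) \<le> n"
    "p = seg (fst p) (fst p + length (snd p))"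
    by (simp_all add: valid_path_def linA_chain seg_def prod_eq_iff)
  then show "\<exists>a b. 1 \<le> a \<and> a \<le> b \<and> b \<le> n \<and> p = seg a b" by blast
qed (auto simp: valid_path_def linA_chain seg_def simp del: upt_Suc)

lemma seg_valid: "1 \<le> a \<Longrightarrow> a \<le> b \<Longrightarrow> b \<le> n \<Longrightarrow> valid_path (linA n) (seg a b)"
  unfolding linA_valid by blast

lemma linA_pend: "a \<le> b \<Longrightarrow> pend (linA n) a [a..<b] = b"
  by (induction b) (auto simp: pend_append le_Suc_eq)

lemma upt_eq_iff: "a \<le> b \<Longrightarrow> a \<le> c \<Longrightarrow> [a..<b] = [a..<c] \<longleftrightarrow> b = (c::nat)"
  by (metis diff_add_inverse2 le_add_diff_inverse2 length_upt)

lemma seg_eq_iff: "a \<le> b \<Longrightarrow> c \<le> d \<Longrightarrow> seg a b = seg c d \<longleftrightarrow> a = c \<and> b = d"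
  by (auto simp: seg_def upt_eq_iff)

lemma seg_joins:
  assumes "a \<le> b" "c \<le> d" "e \<le> f"
  shows "joins (linA n) (seg a b) (seg c d) (seg e f) \<longleftrightarrow> c = b \<and> e = a \<and> f = d"
proof -
  have "cat (seg a b) (seg b d) = seg a d" if "b \<le> d"
    using upt_add_eq_append[of a b "d - b"] assms that by (simp add: cat_def seg_def)
  then have "joins (linA n) (seg a b) (seg c d) (seg e f) \<longleftrightarrow> c = b \<and> seg e f = seg a d"
    using assms by (auto simp: joins_def seg_def linA_pend)
  then show ?thesis using assms by (auto simp: seg_eq_iff)
qed

lemma finite_linA_paths: "finite {p. valid_path (linA n) p}"
proof -
  have "{p. valid_path (linA n) p} \<subseteq> (\<lambda>(a, b). seg a b) ` ({..n} \<times> {..n})"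
    unfolding linA_valid by force
  then show ?thesis by (rule finite_subset) simp
qed

section \<open>Paths in a cyclic quiver\<close>

definition cyc :: "nat \<Rightarrow> nat \<Rightarrow> nat \<Rightarrow> nat \<times> (nat \<times> nat) list" where
  "cyc m i l = (i, map (\<lambda>k. (0, (i + k) mod m)) [0..<l])"

lemma cyc_Suc: "cyc m i (Suc l) = (i, (0, i mod m) # snd (cyc m (Suc i) l))"
proof -
  have "[0..<Suc l] = 0 # map Suc [0..<l]" by (simp add: upt_conv_Cons map_Suc_upt del: upt_Suc)
  then show ?thesis by (simp add: cyc_def del: upt_Suc)
qed

text \<open>Stated by properties so that it covers both the central cycle of a star with several
  edges and the separately defined loop of a single edge.\<close>

locale cyclic_quiver =
  fixes m :: nat and QB :: "(nat, nat \<times> nat) quiver"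
  assumes m: "1 \<le> m" and vertsQB: "verts QB = {..<m}" and arrsQB: "arrs QB = Pair 0 ` {..<m}"
    and srcQB: "\<And>i. i < m \<Longrightarrow> src QB (0, i) = i"
    and tgtQB: "\<And>i. i < m \<Longrightarrow> tgt QB (0, i) = (i + 1) mod m"
begin

lemma finQB: "finite_quiver QB"
  using m by (auto simp: finite_quiver_def vertsQB arrsQB srcQB tgtQB lessThan_empty_iff)

lemma chain_cyc: "chain QB i as \<longleftrightarrow> i < m \<and> (i, as) = cyc m i (length as)"
proof (induction as arbitrary: i)
  case Nil then show ?case by (simp add: vertsQB cyc_def)
next
  case (Cons a as)
  have *: "snd (cyc m ((i + 1) mod m) l) = snd (cyc m (Suc i) l)" for l
    by (simp add: cyc_def mod_add_left_eq)
  show ?case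
  proof (cases "i < m")
    case True
    have "chain QB i (a # as) \<longleftrightarrow> a = (0, i) \<and> chain QB ((i + 1) mod m) as"
      using True by (auto simp: arrsQB srcQB tgtQB)
    also have "\<dots> \<longleftrightarrow> a = (0, i) \<and> as = snd (cyc m (Suc i) (length as))"
      using m Cons.IH[of "(i + 1) mod m"] *[of "length as"] by (simp add: prod_eq_iff cyc_def[of m "_ mod m"])
    also have "\<dots> \<longleftrightarrow> (i, a # as) = cyc m i (length (a # as))"
      using True by (auto simp: cyc_Suc)
    finally show ?thesis using True by simp
  next
    case False
    then show ?thesis by (auto simp: arrsQB srcQB)
  qed
qed

lemma valid_cyc: "valid_path QB q \<longleftrightarrow> (\<exists>i l. i < m \<and> q = cyc m i l)"
proof
  assume "valid_path QB q"
  then show "\<exists>i l. i < m \<and> q = cyc m i l"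
    unfolding valid_path_def chain_cyc by (metis prod.collapse)
qed (auto simp: valid_path_def chain_cyc cyc_def)

lemma pend_cyc: "i < m \<Longrightarrow> pend QB i (snd (cyc m i l)) = (i + l) mod m"
proof (induction l)
  case (Suc l)
  have "snd (cyc m i (Suc l)) = snd (cyc m i l) @ [(0, (i + l) mod m)]" by (simp add: cyc_def)
  then show ?case using Suc m by (simp add: pend_append tgtQB mod_Suc_eq)
qed (simp add: cyc_def)

lemma cat_cyc: "cat (cyc m i l) (cyc m ((i + l) mod m) k) = cyc m i (l + k)"
proof -
  have "[0..<l + k] = [0..<l] @ map (\<lambda>x. x + l) [0..<k]"
    
    using upt_add_eq_append[of 0 l k] by (simp only: map_add_upt le0 add.commute[of l k])
  then show ?thesis by (simp add: cyc_def cat_def mod_add_left_eq add.assoc add.commute[of l])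
qed

end

text \<open>In the cyclic quiver the path of length l from i stays a path of the linear quiver as
  long as it does not use the arrow from m - 1 to 0; otherwise it is dual to the
  path that completes it to the full cycle at i.\<close>

lemma star_presentation:
  fixes A :: "('k::field, 'e) alg" and R :: "(nat \<times> (nat \<times> nat) list \<Rightarrow> 'k) set"
  assumes iso: "iso_quot (linA m) ({} :: (nat \<times> nat list \<Rightarrow> 'k) set) A"
    and cq: "cyclic_quiver m QB"
    and R1: "\<And>x. x \<in> R \<Longrightarrow> \<exists>i<m. x = bvec (cyc m i (m + 1))"
    and R2: "\<And>i. i < m \<Longrightarrow> bvec (cyc m i (m + 1)) \<in> R"
  shows "iso_quot QB R (triv_ext A)"
proof -
  interpret cyclic_quiver m QB by fact
  let ?P = "{p. valid_path (linA m) p}"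
  obtain \<psi> where "path_basis (linA m) A \<psi> ?P"
    using path_basis_of_iso[OF finite_linA[OF m], of "{}" A] iso finite_linA_paths by auto
  then interpret path_basis "linA m" A \<psi> ?P .
  \<comment> \<open>Vertex i of the cycle corresponds to i + 1 of the linear quiver. After the
    closing arrow, l steps from i end at i + l - m, and m - l further steps lead back to i; that
    completing path is the one dualised. For l = m it is trivial, so the full cycle at i represents
    the dual of the idempotent at i + 1.\<close>
  define g where "g q = (let i = fst q; l = length (snd q) in
    if valid_path QB q \<and> l \<le> m then Some (if i + l < m then (seg (i + 1) (i + l + 1), True)
      else (seg (i + l + 1 - m) (i + 1), False)) else None)" for q
  have g: "g (cyc m i l) = (if l \<le> m then Some (if i + l < m then (seg (i + 1) (i + l + 1), True)
      else (seg (i + l + 1 - m) (i + 1), False)) else None)" if "i < m" for i l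
  proof -
    have "valid_path QB (cyc m i l)" using that valid_cyc by blast
    then show ?thesis unfolding g_def by (simp add: cyc_def Let_def del: upt_Suc)
  qed
  have g_some: "\<exists>i l. i < m \<and> l \<le> m \<and> q = cyc m i l" if "g q = Some s" for q s
  proof -
    have "valid_path QB q \<and> length (snd q) \<le> m"
    proof (rule ccontr)
      assume "\<not> (valid_path QB q \<and> length (snd q) \<le> m)"
      then have "g q = None" unfolding g_def Let_def by (rule if_not_P)
      then show False using that by simp
    qed
    moreover from this obtain i l where "i < m" "q = cyc m i l" unfolding valid_cyc by blast
    moreover have "length (snd (cyc m i l)) = l" for i l by (simp add: cyc_def)
    ultimately show ?thesis by auto
  qed
  have g_inj: "q' = q" if "g q \<noteq> None" "g q' = g q" for q q'
  proof -
    obtain s where "g q = Some s" "g q' = Some s" using \<open>g q \<noteq> None\<close> \<open>g q' = g q\<close> by (metis not_None_eq)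
    then obtain i l i' l' where "i < m" "l \<le> m" "q = cyc m i l" "i' < m" "l' \<le> m" "q' = cyc m i' l'"
      using g_some by blast
    moreover from this that have "g (cyc m i' l') = g (cyc m i l)" by simp
    ultimately show ?thesis unfolding g[OF \<open>i < m\<close>] g[OF \<open>i' < m\<close>]
      by (auto simp: seg_eq_iff split: if_splits intro!: arg_cong[of _ _ "cyc m i"])
  qed
  have Rc: "R \<subseteq> pa_carrier QB"
  proof
    fix x assume "x \<in> R"
    then obtain i where "i < m" "x = bvec (cyc m i (m + 1))" using R1 by blast
    then show "x \<in> pa_carrier QB" using valid_cyc by auto
  qed
  interpret triv_ext_presentation "linA m" A \<psi> ?P QB R g Suc
  proof
    show "finite_quiver QB" by (rule finQB)
    show "bij_betw Suc (verts QB) (verts (linA m))"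
      by (simp add: vertsQB bij_betw_def image_Suc_lessThan)
    fix i assume "i \<in> verts QB"
    then show "g (i, []) = Some ((Suc i, []), True)"
      using g[of i 0] by (simp add: vertsQB cyc_def seg_def)
  next
    fix q v assume q: "g q = Some ((v, []), True)"
    then obtain i l where "i < m" "l \<le> m" "q = cyc m i l" using g_some by blast
    then show "snd q = []" using q g by (simp add: seg_def cyc_def split: if_splits)
  next
    fix q p b assume q: "g q = Some (p, b)"
    then obtain i l where il: "i < m" "l \<le> m" "q = cyc m i l" using g_some by blast
    then have "valid_path (linA m) p"
      using q g[OF il(1), of l] by (auto split: if_splits intro!: seg_valid)
    then show "valid_path QB q \<and> p \<in> ?P" using il valid_cyc by blast
  next
    have "{q. g q \<noteq> None} \<subseteq> (\<lambda>(i, l). cyc m i l) ` ({..m} \<times> {..m})"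
      using g_some by fastforce
    then show "finite {q. g q \<noteq> None}" by (rule finite_subset) simp
  next
    fix p b assume "p \<in> ?P"
    then obtain x y where xy: "1 \<le> x" "x \<le> y" "y \<le> m" "p = seg x y" unfolding linA_valid by blast
    show "\<exists>q. g q = Some (p, b)"
    proof (cases b)
      case True
      then show ?thesis using xy g[of "x - 1" "y - x"] by (intro exI[of _ "cyc m (x - 1) (y - x)"]) auto
    next
      case False
      then show ?thesis using xy g[of "y - 1" "x + m - y"]
        by (intro exI[of _ "cyc m (y - 1) (x + m - y)"]) auto
    qed
  next
    fix q s assume q: "g q = Some s"
    then obtain i l where il: "i < m" "l \<le> m" "q = cyc m i l" using g_some by blast
    have f: "fst q = i" using il by (simp add: cyc_def)
    have md: "(i + l) mod m = (if i + l < m then i + l else i + l - m)"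
      using il by (simp add: mod_if)
    show "basis_ends (linA m) s = (Suc (fst q), Suc (pend QB (fst q) (snd q)))"
      using q il f pend_cyc[OF il(1), of l] g[OF il(1), of l] md
      by (auto simp: basis_ends_def seg_def linA_pend Let_def simp del: upt_Suc)
  next
    fix q1 q2 q r b
    assume j: "joins QB q1 q2 q" and v: "valid_path QB q" and r: "r \<in> ?P"
    obtain i l where il: "i < m" "q1 = cyc m i l" using valid_joins[OF finQB j] v valid_cyc by blast
    obtain k where k: "q2 = cyc m ((i + l) mod m) k"
      using valid_joins[OF finQB j] v valid_cyc j pend_cyc[OF il(1), of l] il
      by (auto simp: joins_def cyc_def)
    have q: "q = cyc m i (l + k)" using j il k cat_cyc by (simp add: joins_def)
    obtain x y where xy: "1 \<le> x" "x \<le> y" "y \<le> m" "r = seg x y" using r unfolding linA_valid by blast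
    have md: "(i + l) mod m = (if i + l < m then i + l else i + l - m)" if "l \<le> m"
      using il that by (simp add: mod_if)
    have mm: "(i + l) mod m < m" using m by simp
    show "g q = Some (r, b) \<longleftrightarrow>
      (\<exists>s1 s2. g q1 = Some s1 \<and> g q2 = Some s2 \<and> basis_prod (linA m) s1 s2 (r, b))"
    proof (cases "l \<le> m \<and> k \<le> m")
      case True
      let ?j = "(i + l) mod m"
      \<comment> \<open>The cases record which factors pass the closing arrow. If both do, the total
        length exceeds m, in accordance with the product of two elements of DA being zero.\<close>
      consider "i + l < m" "?j + k < m" | "i + l < m" "\<not> ?j + k < m"
        | "\<not> i + l < m" "?j + k < m" | "\<not> i + l < m" "\<not> ?j + k < m" by blast
      then show ?thesis
        unfolding q il(2) k g[OF il(1)] g[OF mm]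
        by cases (use True xy md il(1) in \<open>auto simp: seg_joins seg_eq_iff simp del: upt_Suc\<close>)
    next
      case False
      then show ?thesis unfolding q il(2) k g[OF il(1)] g[OF mm] by auto
    qed
  next
    fix x assume "x \<in> R"
    then obtain i where "i < m" "x = bvec (cyc m i (m + 1))" using R1 by blast
    moreover from this have "valid_path QB (cyc m i (m + 1))" using valid_cyc by blast
    ultimately show "(\<exists>q. valid_path QB q \<and> g q = None \<and> x = bvec q) \<or>
      (\<exists>q q'. g q \<noteq> None \<and> g q' = g q \<and> x = (\<lambda>p. bvec q p - bvec q' p))"
      using g[of i "m + 1"] by (intro disjI1 exI[of _ "cyc m i (m + 1)"]) simp
  next
    fix q assume v: "valid_path QB q" and "g q = None"
    then obtain i l where il: "i < m" "q = cyc m i l" "m < l" using valid_cyc g by fastforce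
    \<comment> \<open>A path of length above m begins with one of length m + 1, which is a
      relation.\<close>
    have q: "q = cat (cyc m i (m + 1)) (cyc m ((i + (m + 1)) mod m) (l - (m + 1)))"
      unfolding cat_cyc using il by simp
    have "bvec (i, [] @ snd (cyc m i (m + 1)) @ snd (cyc m ((i + (m + 1)) mod m) (l - (m + 1))))
        \<in> ideal_gen QB R"
    proof (rule bvec_ideal_factor[OF finQB])
      show "valid_path QB (i, [] @ snd (cyc m i (m + 1)) @ snd (cyc m ((i + (m + 1)) mod m) (l - (m + 1))))"
        using v q by (simp add: cat_def cyc_def)
      have "bvec (cyc m i (m + 1)) \<in> ideal_gen QB R" by (rule ideal_gen.gen[OF R2[OF il(1)]])
      then show "bvec (pend QB i [], snd (cyc m i (m + 1))) \<in> ideal_gen QB R"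
        by (simp add: cyc_def)
    qed
    then show "bvec q \<in> ideal_gen QB R" using q by (simp add: cat_def cyc_def)
  next
    fix q q' assume "g q \<noteq> None" "g q' = g q"
    then have "q' = q" by (rule g_inj)
    then show "(\<lambda>p. bvec q p - bvec q' p) \<in> ideal_gen QB R" by (simp add: ideal_gen.zero)
  qed
  show ?thesis by (rule presentation)
qed

section \<open>Presentations of a trivial extension\<close>

fun pa_pow :: "('v, 'a) quiver \<Rightarrow> ('v \<times> 'a list \<Rightarrow> 'k::field) \<Rightarrow> nat \<Rightarrow> 'v \<times> 'a list \<Rightarrow> 'k" where
  "pa_pow Q x 0 = pa_one Q"
| "pa_pow Q x (Suc k) = pa_mult Q x (pa_pow Q x k)"

lemma pa_pow_carrier: "finite_quiver Q \<Longrightarrow> x \<in> pa_carrier Q \<Longrightarrow> pa_pow Q x k \<in> pa_carrier Q"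
  by (induction k) (auto intro: pa_carrier_one pa_carrier_mult)

lemma pa_pow_trivial: "v \<in> verts Q \<Longrightarrow> pa_pow Q x k (v, []) = x (v, []) ^ k"
  by (induction k) (auto simp: pa_mult_trivial pa_one_def)

lemma pa_pow_length:
  assumes "\<And>v. x (v, []) = 0" "pa_pow Q x k p \<noteq> 0"
  shows "k \<le> length (snd p)"
  using assms(2)
proof (induction k arbitrary: p)
  case (Suc k)
  from Suc.prems obtain q r where "x q \<noteq> 0" "pa_pow Q x k r \<noteq> 0" "joins Q q r p"
    by (auto elim: pa_mult_support)
  moreover from this assms(1)[of "fst q"] have "1 \<le> length (snd q)"
    by (cases q; cases "snd q") auto
  ultimately show ?case using Suc.IH[of r] by (simp add: joins_def cat_def)
qed simp

lemma pa_carrier_not_vert: "x \<in> pa_carrier Q \<Longrightarrow> v \<notin> verts Q \<Longrightarrow> x (v, []) = 0"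
  unfolding pa_carrier_def valid_path_def by (metis (mono_tags, lifting) chain.simps(1) mem_Collect_eq prod.sel)

context path_basis
begin

lemma psi_lin:
  "x \<in> pa_carrier Q \<Longrightarrow> y \<in> pa_carrier Q \<Longrightarrow>
    \<psi> (\<lambda>p. x p + c * y p) = aadd A (\<psi> x) (asmul A c (\<psi> y))"
  using psi_add[of x "\<lambda>p. c * y p"] psi_scale[of y c] pa_carrier_scale[of y Q c] by simp

lemma functional_azero:
  assumes "lin_functional A f"
  shows "f (azero A) = 0"
  using functional_psi[OF assms pa_carrier_zero] by (simp add: psi_zero)

text \<open>The coefficient at a trivial path is multiplicative. If it were nonzero, 1 minus a
  scalar multiple of u would have coefficient 0 there and could have no left inverse.\<close>

lemma jac_rad_trivial:
  assumes x: "\<psi> u \<in> jac_rad A" and u: "u \<in> pa_carrier Q"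
  shows "u (v, []) = 0"
proof (cases "v \<in> verts Q")
  case True
  show ?thesis
  proof (rule ccontr)
    assume c: "u (v, []) \<noteq> 0"
    let ?a = "\<lambda>p. (1 / u (v, [])) * pa_one Q p"
    let ?d = "\<lambda>p. pa_one Q p + (-1) * pa_mult Q ?a u p"
    have one: "pa_one Q \<in> pa_carrier Q" by (rule pa_carrier_one[OF finQ])
    have a: "?a \<in> pa_carrier Q" by (rule pa_carrier_scale[OF one])
    have au: "pa_mult Q ?a u \<in> pa_carrier Q" by (rule pa_carrier_mult[OF finQ a u])
    have d: "?d \<in> pa_carrier Q" by (intro pa_carrier_add one pa_carrier_scale au)
    obtain y where y: "y \<in> acarr A"
      "amul A y (aadd A (aone A) (asmul A (-1) (amul A (\<psi> ?a) (\<psi> u)))) = aone A"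
      using x psi_in[OF a] unfolding jac_rad_def by blast
    obtain w where w: "w \<in> pa_carrier Q" "\<psi> w = y" using y(1) by (rule psi_onto)
    have "\<psi> (pa_mult Q w ?d) = \<psi> (pa_one Q)"
      using y(2) by (simp only: psi_mult[OF w(1) d] psi_lin[OF one au] psi_mult[OF a u] psi_one w(2))
    then have "pa_mult Q w ?d (v, []) = pa_one Q (v, [])"
      using psi_eq[OF pa_carrier_mult[OF finQ w(1) d] one] trivP[OF True] by blast
    then show False using c True by (simp add: pa_mult_trivial pa_one_def)
  qed
qed (use pa_carrier_not_vert[OF u] in blast)

end

text \<open>An arbitrary presentation of T(A). Nothing is known about the images of vertices and
  arrows, only that the kernel has no coefficient at a trivial path.\<close>

locale triv_ext_quotient = path_basis Q A \<psi> P
  for Q :: "('v, 'a) quiver" and A :: "('k::field, 'e) alg" and \<psi> P +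
  fixes QB :: "('w, 'b) quiver" and I :: "('w \<times> 'b list \<Rightarrow> 'k) set"
    and \<Phi> :: "('w \<times> 'b list \<Rightarrow> 'k) \<Rightarrow> 'e \<times> ('e \<Rightarrow> 'k)"
  assumes finQB: "finite_quiver QB"
    and homB: "pa_hom_onto QB (triv_ext A) \<Phi>"
    and kerB: "\<And>x. x \<in> pa_carrier QB \<Longrightarrow> \<Phi> x = azero (triv_ext A) \<longleftrightarrow> x \<in> I"
    and I_triv: "\<And>x i. x \<in> I \<Longrightarrow> x (i, []) = 0"
begin

lemma Phi_in: "x \<in> pa_carrier QB \<Longrightarrow> \<Phi> x \<in> acarr (triv_ext A)"
  and Phi_zero: "\<Phi> (\<lambda>_. 0) = azero (triv_ext A)"
  and Phi_one: "\<Phi> (pa_one QB) = aone (triv_ext A)"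
  and Phi_add: "x \<in> pa_carrier QB \<Longrightarrow> y \<in> pa_carrier QB \<Longrightarrow>
    \<Phi> (\<lambda>p. x p + y p) = aadd (triv_ext A) (\<Phi> x) (\<Phi> y)"
  and Phi_scale: "x \<in> pa_carrier QB \<Longrightarrow> \<Phi> (\<lambda>p. c * x p) = asmul (triv_ext A) c (\<Phi> x)"
  and Phi_mult: "x \<in> pa_carrier QB \<Longrightarrow> y \<in> pa_carrier QB \<Longrightarrow>
    \<Phi> (pa_mult QB x y) = amul (triv_ext A) (\<Phi> x) (\<Phi> y)"
  using homB unfolding pa_hom_onto_def by blast+

lemma Phi_onto:
  assumes "u \<in> pa_carrier Q"
  obtains X where "X \<in> pa_carrier QB" "\<Phi> X = (\<psi> u, dual c)"
proof -
  have "(\<psi> u, dual c) \<in> acarr (triv_ext A)"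
    using psi_in[OF assms] dual_linear by (simp add: triv_ext_def)
  then show ?thesis using that homB unfolding pa_hom_onto_def by force
qed

lemma Phi_elem:
  assumes "X \<in> pa_carrier QB"
  obtains u f where "u \<in> pa_carrier Q" "lin_functional A f" "\<Phi> X = (\<psi> u, f)"
  using triv_ext_elem[OF Phi_in[OF assms]] dual_linear by metis

lemma dual_zero: "dual (\<lambda>_. 0) = (\<lambda>_. 0)"
  by (auto simp: dual_def)

lemma Phi_pow:
  assumes X: "X \<in> pa_carrier QB" and u: "u \<in> pa_carrier Q" and f: "\<Phi> X = (\<psi> u, f)"
  shows "\<exists>h. lin_functional A h \<and> \<Phi> (pa_pow QB X k) = (\<psi> (pa_pow Q u k), h)"
proof -
  have "fst (\<Phi> (pa_pow QB X k)) = \<psi> (pa_pow Q u k)"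
  proof (induction k)
    case 0 show ?case by (simp add: Phi_one psi_one triv_ext_def)
  next
    case (Suc k)
    obtain w h where "\<Phi> (pa_pow QB X k) = (w, h)" by (cases "\<Phi> (pa_pow QB X k)")
    then show ?case
      using Suc f by (simp add: Phi_mult[OF X pa_pow_carrier[OF finQB X]]
          psi_mult[OF u pa_pow_carrier[OF finQ u]] triv_ext_def)
  qed
  moreover obtain w h where "lin_functional A h" "\<Phi> (pa_pow QB X k) = (\<psi> w, h)"
    by (rule Phi_elem[OF pa_pow_carrier[OF finQB X]])
  ultimately show ?thesis by auto
qed

text \<open>X is nilpotent modulo I, while evaluation at a trivial path is a character that kills I.\<close>

lemma lift_trivial_zero:
  assumes X: "X \<in> pa_carrier QB" and u: "u \<in> pa_carrier Q" and f: "\<Phi> X = (\<psi> u, f)"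
    and u0: "\<And>v. u (v, []) = 0"
  shows "X (i, []) = 0"
proof (cases "i \<in> verts QB")
  case True
  \<comment> \<open>No path of P has length k, so the A-component of the k-th power of X is zero and
    that power lands in DA; one more squaring puts it into I.\<close>
  define k where "k = Suc (Max ((\<lambda>p. length (snd p)) ` P))"
  have k: "length (snd p) < k" if "p \<in> P" for p
    using that finP by (simp add: k_def less_Suc_eq_le)
  let ?Y = "pa_pow QB X k"
  have Y: "?Y \<in> pa_carrier QB" by (rule pa_pow_carrier[OF finQB X])
  obtain h where h: "lin_functional A h" "\<Phi> ?Y = (\<psi> (pa_pow Q u k), h)"
    using Phi_pow[OF X u f] by blast
  have "\<forall>p\<in>P. pa_pow Q u k p = 0"
    using k pa_pow_length[of u Q k, OF u0] by (meson leD)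
  then have "\<psi> (pa_pow Q u k) = azero A"
    using ker[OF pa_pow_carrier[OF finQ u]] by blast
  then have "\<Phi> (pa_mult QB ?Y ?Y) = amul (triv_ext A) (\<psi> (\<lambda>_. 0), h) (\<psi> (\<lambda>_. 0), h)"
    using h(2) Phi_mult[OF Y Y] by (simp add: psi_zero)
  also have "\<dots> = azero (triv_ext A)"
  proof -
    have "amul A z (azero A) = azero A" "amul A (azero A) z = azero A" if "z \<in> acarr A" for z
    proof -
      obtain w where w: "w \<in> pa_carrier Q" "\<psi> w = z" using \<open>z \<in> acarr A\<close> by (rule psi_onto)
      show "amul A z (azero A) = azero A"
        using psi_mult[OF w(1) pa_carrier_zero] w(2) by (simp add: psi_zero)
      show "amul A (azero A) z = azero A"
        using psi_mult[OF pa_carrier_zero w(1)] w(2) by (simp add: psi_zero)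
    qed
    then show ?thesis unfolding triv_ext_mult[OF pa_carrier_zero pa_carrier_zero]
      by (auto simp: triv_ext_def psi_zero functional_azero[OF h(1)])
  qed
  finally have "pa_mult QB ?Y ?Y \<in> I"
    using kerB[OF pa_carrier_mult[OF finQB Y Y]] by blast
  then have "pa_mult QB ?Y ?Y (i, []) = 0" by (rule I_triv)
  then show ?thesis using True by (simp add: pa_mult_trivial pa_pow_trivial)
qed (use pa_carrier_not_vert[OF X] in blast)

lemma rad_sq_zeroI:
  assumes cube: "\<And>x. x \<in> pa_carrier QB \<Longrightarrow> (\<And>p. x p \<noteq> 0 \<Longrightarrow> 3 \<le> length (snd p)) \<Longrightarrow> x \<in> I"
  shows "rad_sq_zero A"
  unfolding rad_sq_zero_def
proof (intro ballI, rule ccontr)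
  fix x y assume x: "x \<in> jac_rad A" and y: "y \<in> jac_rad A" and xy: "amul A x y \<noteq> azero A"
  obtain u v where u: "u \<in> pa_carrier Q" "\<psi> u = x" and v: "v \<in> pa_carrier Q" "\<psi> v = y"
    using x y unfolding jac_rad_def by (metis (no_types, lifting) mem_Collect_eq psi_onto)
  have uv: "pa_mult Q u v \<in> pa_carrier Q" by (rule pa_carrier_mult[OF finQ u(1) v(1)])
  have u0: "u (w, []) = 0" and v0: "v (w, []) = 0" for w
    using jac_rad_trivial x y u v by blast+
  have "\<psi> (pa_mult Q u v) \<noteq> azero A" using xy u v psi_mult[OF u(1) v(1)] by simp
  then obtain p where p: "p \<in> P" "pa_mult Q u v p \<noteq> 0" using ker[OF uv] by blast
  obtain X where X: "X \<in> pa_carrier QB" "\<Phi> X = (\<psi> u, dual (\<lambda>_. 0))" by (rule Phi_onto[OF u(1)])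
  obtain Y where Y: "Y \<in> pa_carrier QB" "\<Phi> Y = (\<psi> v, dual (\<lambda>_. 0))" by (rule Phi_onto[OF v(1)])
  \<comment> \<open>Z lifts the dual of a path p occurring in uv. The functional component of X Y Z,
    evaluated at 1, is then the coefficient of p in uv.\<close>
  obtain Z where Z: "Z \<in> pa_carrier QB" "\<Phi> Z = (\<psi> (\<lambda>_. 0), dual (bvec p))"
    by (rule Phi_onto[OF pa_carrier_zero])
  have 0: "X (i, []) = 0" "Y (i, []) = 0" "Z (i, []) = 0" for i
    using lift_trivial_zero[OF X(1) u(1) X(2) u0] lift_trivial_zero[OF Y(1) v(1) Y(2) v0]
      lift_trivial_zero[OF Z(1) pa_carrier_zero Z(2)] by auto
  have len: "1 \<le> length (snd q)" if "x q \<noteq> 0" "\<And>i. x (i, []) = 0"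
    for x :: "'w \<times> 'b list \<Rightarrow> 'k" and q
    using that by (cases q; cases "snd q") auto
  have XY: "pa_mult QB X Y \<in> pa_carrier QB" by (rule pa_carrier_mult[OF finQB X(1) Y(1)])
  let ?T = "pa_mult QB (pa_mult QB X Y) Z"
  have "?T \<in> I"
  proof (rule cube)
    show "?T \<in> pa_carrier QB" by (rule pa_carrier_mult[OF finQB XY Z(1)])
    fix q assume "?T q \<noteq> 0"
    then obtain q1 q2 where q: "pa_mult QB X Y q1 \<noteq> 0" "Z q2 \<noteq> 0" "joins QB q1 q2 q"
      by (rule pa_mult_support)
    from q(1) obtain q3 q4 where q': "X q3 \<noteq> 0" "Y q4 \<noteq> 0" "joins QB q3 q4 q1"
      by (rule pa_mult_support)
    show "3 \<le> length (snd q)"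
      using q q' len[OF q'(1) 0(1)] len[OF q'(2) 0(2)] len[OF q(2) 0(3)]
      by (simp add: joins_def cat_def)
  qed
  then have "\<Phi> ?T = azero (triv_ext A)"
    using kerB[OF pa_carrier_mult[OF finQB XY Z(1)]] by blast
  moreover have "snd (\<Phi> ?T) (aone A) = pa_mult Q u v p"
  proof -
    have "fst (\<Phi> (pa_mult QB X Y)) = \<psi> (pa_mult Q u v)"
      using Phi_mult[OF X(1) Y(1)] X(2) Y(2) psi_mult[OF u(1) v(1)] by (simp add: triv_ext_def)
    moreover obtain w h where h: "lin_functional A h" "\<Phi> (pa_mult QB X Y) = (\<psi> w, h)"
      by (rule Phi_elem[OF XY])
    ultimately have "\<Phi> ?T = amul (triv_ext A) (\<psi> (pa_mult Q u v), h) (\<psi> (\<lambda>_. 0), dual (bvec p))"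
      using Phi_mult[OF XY Z(1)] Z(2) by simp
    then have "snd (\<Phi> ?T) (aone A) =
        dual (bvec p) (amul A (aone A) (\<psi> (pa_mult Q u v))) + h (amul A (\<psi> (\<lambda>_. 0)) (aone A))"
      using psi_in[OF pa_carrier_one[OF finQ]] by (simp add: triv_ext_mult[OF uv] psi_one)
    also have "amul A (\<psi> (\<lambda>_. 0)) (aone A) = azero A"
      using psi_mult[OF pa_carrier_zero pa_carrier_one[OF finQ]] by (simp add: psi_zero psi_one)
    also have "amul A (aone A) (\<psi> (pa_mult Q u v)) = \<psi> (pa_mult Q u v)"
      using psi_mult[OF pa_carrier_one[OF finQ] uv] pa_mult_one_left[OF finQ uv] by (simp add: psi_one)
    also have "dual (bvec p) (\<psi> (pa_mult Q u v)) = pa_mult Q u v p"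
      by (simp add: dual_psi[OF uv] sum_bvec_P[OF p(1)])
    finally show ?thesis by (simp add: functional_azero[OF h(1)])
  qed
  ultimately show False using p by (simp add: triv_ext_def)
qed

text \<open>The simple module at v as a character: T(A) projects onto A, and A onto the coefficient
  at the trivial path of v.\<close>

definition char :: "'v \<Rightarrow> ('w \<times> 'b list \<Rightarrow> 'k) \<Rightarrow> 'k" where
  "char v X = coef (fst (\<Phi> X)) (v, [])"

lemma char_eq: "u \<in> pa_carrier Q \<Longrightarrow> \<Phi> X = (\<psi> u, f) \<Longrightarrow> v \<in> verts Q \<Longrightarrow> char v X = u (v, [])"
  by (simp add: char_def coef_psi trivP)

lemma char_lin:
  assumes X: "X \<in> pa_carrier QB" and Y: "Y \<in> pa_carrier QB" and v: "v \<in> verts Q"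
  shows "char v (\<lambda>p. X p + c * Y p) = char v X + c * char v Y"
proof -
  obtain u f where u: "u \<in> pa_carrier Q" "lin_functional A f" "\<Phi> X = (\<psi> u, f)" by (rule Phi_elem[OF X])
  obtain w h where w: "w \<in> pa_carrier Q" "lin_functional A h" "\<Phi> Y = (\<psi> w, h)" by (rule Phi_elem[OF Y])
  have "fst (\<Phi> (\<lambda>p. X p + c * Y p)) = \<psi> (\<lambda>p. u p + c * w p)"
    unfolding Phi_add[OF X pa_carrier_scale[OF Y]] Phi_scale[OF Y] psi_lin[OF u(1) w(1)] u(3) w(3)
    by (simp add: triv_ext_def)
  moreover have "(\<lambda>p. u p + c * w p) \<in> pa_carrier Q" using u w by (intro pa_carrier_add pa_carrier_scale)
  ultimately show ?thesis
    using u w v by (simp add: char_def coef_psi trivP)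
qed

lemma char_mult:
  assumes X: "X \<in> pa_carrier QB" and Y: "Y \<in> pa_carrier QB" and v: "v \<in> verts Q"
  shows "char v (pa_mult QB X Y) = char v X * char v Y"
proof -
  obtain u f where u: "u \<in> pa_carrier Q" "lin_functional A f" "\<Phi> X = (\<psi> u, f)" by (rule Phi_elem[OF X])
  obtain w h where w: "w \<in> pa_carrier Q" "lin_functional A h" "\<Phi> Y = (\<psi> w, h)" by (rule Phi_elem[OF Y])
  have "fst (\<Phi> (pa_mult QB X Y)) = \<psi> (pa_mult Q u w)"
    unfolding Phi_mult[OF X Y] u(3) w(3) triv_ext_mult[OF u(1) w(1)] by simp
  then show ?thesis
    using u w v pa_carrier_mult[OF finQ u(1) w(1)]
    by (simp add: char_def coef_psi trivP pa_mult_trivial)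
qed

lemma char_zero: "v \<in> verts Q \<Longrightarrow> char v (\<lambda>_. 0) = 0"
  using char_eq[of "\<lambda>_. 0" "\<lambda>_. 0" "\<lambda>_. 0" v] by (simp add: Phi_zero triv_ext_def psi_zero)

text \<open>This holds for a star: an arrow that is not a loop does not compose with itself, and the
  loop of the one-edge graph has its square as relation. A multiplicative function to a field must
  then vanish on every arrow.\<close>

context
  assumes arrow_nilpotent: "\<And>a. a \<in> arrs QB \<Longrightarrow>
    pa_mult QB (bvec (src QB a, [a])) (bvec (src QB a, [a])) \<in> I"
begin

section \<open>Characters, lifted idempotents and the length filtration\<close>

lemma arrow_valid: "a \<in> arrs QB \<Longrightarrow> valid_path QB (src QB a, [a])"
  using finQB by (auto simp: valid_path_def finite_quiver_def)

lemma char_arrow: "a \<in> arrs QB \<Longrightarrow> v \<in> verts Q \<Longrightarrow> char v (bvec (src QB a, [a])) = 0"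
proof -
  assume a: "a \<in> arrs QB" and v: "v \<in> verts Q"
  let ?b = "bvec (src QB a, [a])"
  have b: "?b \<in> pa_carrier QB" using arrow_valid[OF a] by simp
  have "\<Phi> (pa_mult QB ?b ?b) = \<Phi> (\<lambda>_. 0)"
    using arrow_nilpotent[OF a] kerB[OF pa_carrier_mult[OF finQB b b]] by (simp add: Phi_zero)
  then have "char v (pa_mult QB ?b ?b) = char v (\<lambda>_. 0)" by (simp add: char_def)
  then show ?thesis using char_mult[OF b b v] char_zero[OF v] by simp
qed

lemma bvec_Cons: "valid_path QB (i, a # as) \<Longrightarrow>
  a \<in> arrs QB \<and> src QB a = i \<and> valid_path QB (tgt QB a, as) \<and>
  (bvec (i, a # as) :: _ \<Rightarrow> 'k) = pa_mult QB (bvec (src QB a, [a])) (bvec (tgt QB a, as))"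
  by (subst pa_mult_bvec_joins[of QB "(src QB a, [a])" "(tgt QB a, as)" "(i, a # as)"])
    (auto simp: valid_path_def joins_def cat_def)

text \<open>A nontrivial path starts with an arrow, which the character kills.\<close>

lemma char_trivial_zero:
  assumes "X \<in> pa_carrier QB" "\<And>i. X (i, []) = 0" "v \<in> verts Q"
  shows "char v X = 0"
  using assms(1,2)
proof (induction rule: pa_induct)
  case zero show ?case by (rule char_zero[OF assms(3)])
next
  case (add X p c)
  have p: "snd p \<noteq> []"
  proof
    assume "snd p = []"
    then have "p = (fst p, [])" by (simp add: prod_eq_iff)
    then show False using add.prems[of "fst p"] add.hyps by (auto simp: bvec_def)
  qed
  then obtain i a as where ia: "p = (i, a # as)" by (cases p; cases "snd p") auto
  have X0: "X (i, []) = 0" for i using add.prems[of i] p by (auto simp: bvec_def split: if_splits)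
  have b: "a \<in> arrs QB" "valid_path QB (tgt QB a, as)"
    "(bvec p :: _ \<Rightarrow> 'k) = pa_mult QB (bvec (src QB a, [a])) (bvec (tgt QB a, as))"
    using bvec_Cons[of i a as] add.hyps ia by auto
  have "char v (bvec p) = 0"
    unfolding b(3) using b arrow_valid char_arrow[OF b(1) assms(3)] by (simp add: char_mult assms(3))
  then show ?case
    using char_lin[OF add.hyps(1) _ assms(3), of "bvec p" c] add.IH[OF X0] add.hyps by simp
qed

text \<open>Lift the idempotent of each v to some X v. The character at v is 1 on X v, so X v has a
  nonzero coefficient at some trivial path \<iota> v. For v and w different, the product of X v and
  X w lies in I and so has no coefficient at trivial paths; hence \<iota> is injective.\<close>

lemma card_verts_le: "card (verts Q) \<le> card (verts QB)"
proof -
  have "\<exists>X. X \<in> pa_carrier QB \<and> \<Phi> X = (\<psi> (bvec (v, [])), dual (\<lambda>_. 0))" if "v \<in> verts Q" for v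
    using that Phi_onto[of "bvec (v, [])" "\<lambda>_. 0"] by (metis chain.simps(1) pa_carrier_bvec prod.sel valid_path_def)
  then obtain X where X: "\<And>v. v \<in> verts Q \<Longrightarrow> X v \<in> pa_carrier QB"
    "\<And>v. v \<in> verts Q \<Longrightarrow> \<Phi> (X v) = (\<psi> (bvec (v, [])), dual (\<lambda>_. 0))"
    by metis
  have e: "bvec (v, []) \<in> pa_carrier Q" if "v \<in> verts Q" for v
    using that by (simp add: valid_path_def)
  have "\<exists>i\<in>verts QB. X v (i, []) \<noteq> 0" if v: "v \<in> verts Q" for v
  proof (rule ccontr)
    assume "\<not> (\<exists>i\<in>verts QB. X v (i, []) \<noteq> 0)"
    then have "X v (i, []) = 0" for i using pa_carrier_not_vert[OF X(1)[OF v], of i] by blast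
    then have "char v (X v) = 0" using char_trivial_zero[OF X(1)[OF v] _ v] by blast
    then show False using char_eq[OF e[OF v] X(2)[OF v] v] by (simp add: bvec_def)
  qed
  then obtain \<iota> where \<iota>: "\<And>v. v \<in> verts Q \<Longrightarrow> \<iota> v \<in> verts QB \<and> X v (\<iota> v, []) \<noteq> 0"
    by metis
  have "inj_on \<iota> (verts Q)"
  proof (rule inj_onI, rule ccontr)
    fix v w assume v: "v \<in> verts Q" and w: "w \<in> verts Q" and eq: "\<iota> v = \<iota> w" and ne: "v \<noteq> w"
    have "pa_mult Q (bvec (v, [])) (bvec (w, [])) = (\<lambda>_. 0 :: 'k)"
      using ne by (auto simp: pa_mult_bvec joins_def)
    then have "\<Phi> (pa_mult QB (X v) (X w)) = azero (triv_ext A)"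
      unfolding Phi_mult[OF X(1)[OF v] X(1)[OF w]] X(2)[OF v] X(2)[OF w]
        triv_ext_mult[OF e[OF v] e[OF w]]
      by (auto simp: triv_ext_def psi_zero dual_zero)
    then have "pa_mult QB (X v) (X w) \<in> I"
      using kerB[OF pa_carrier_mult[OF finQB X(1)[OF v] X(1)[OF w]]] by blast
    then have "pa_mult QB (X v) (X w) (\<iota> v, []) = 0" by (rule I_triv)
    then show False using \<iota>[OF v] \<iota>[OF w] eq by (simp add: pa_mult_trivial)
  qed
  then show ?thesis
    using \<iota> finQB card_inj_on_le[of \<iota> "verts Q" "verts QB"] by (auto simp: finite_quiver_def)
qed

text \<open>A filtration of T(A), with L the length of the longest path of P. The constant 2 makes
  the condition on the functional empty for k = 1, since paths of length L + 1 are already zero in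
  A: an arrow may have any component in DA. At k = L + 2 both components are forced to be
  zero.\<close>

definition lvl :: "nat \<Rightarrow> nat \<Rightarrow> ('e \<times> ('e \<Rightarrow> 'k)) \<Rightarrow> bool" where
  "lvl L k t \<longleftrightarrow> (\<exists>u f. t = (\<psi> u, f) \<and> u \<in> pa_carrier Q \<and> lin_functional A f \<and>
     (\<forall>p. u p \<noteq> 0 \<longrightarrow> k \<le> length (snd p)) \<and>
     (\<forall>w\<in>pa_carrier Q. (\<forall>p. w p \<noteq> 0 \<longrightarrow> L + 2 - k \<le> length (snd p)) \<longrightarrow> f (\<psi> w) = 0))"

lemma psi_long:
  assumes L: "\<And>p. p \<in> P \<Longrightarrow> length (snd p) \<le> L"
    and "w \<in> pa_carrier Q" "\<And>p. w p \<noteq> 0 \<Longrightarrow> L < length (snd p)"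
  shows "\<psi> w = azero A"
  unfolding ker[OF assms(2)] using assms(3) L by (meson leD)

text \<open>Prepending an arrow raises the level by one. Its A-component u has no trivial part,
  because characters kill arrows. In the functional z -> h(zu) + f(wz) of the product, zu is one
  step longer than z, hence long enough for h, and wz is longer than every path of P.\<close>

lemma lvl_path:
  assumes L: "\<And>p. p \<in> P \<Longrightarrow> length (snd p) \<le> L" and "valid_path QB (i, as)"
  shows "lvl L (length as) (\<Phi> (bvec (i, as)))"
  using assms(2)
proof (induction as arbitrary: i)
  case Nil
  then have "bvec (i, []) \<in> pa_carrier QB" by simp
  then obtain u f where u: "u \<in> pa_carrier Q" "lin_functional A f" "\<Phi> (bvec (i, [])) = (\<psi> u, f)"
    by (rule Phi_elem)
  have "f (\<psi> w) = 0" if "w \<in> pa_carrier Q" "\<forall>p. w p \<noteq> 0 \<longrightarrow> L + 2 \<le> length (snd p)" for w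
    using psi_long[OF L that(1)] that(2) functional_azero[OF u(2)] by fastforce
  then show ?case using u unfolding lvl_def by auto
next
  case (Cons a as)
  let ?k = "length as"
  let ?b = "bvec (src QB a, [a])" and ?c = "bvec (tgt QB a, as)"
  have a: "a \<in> arrs QB" "valid_path QB (tgt QB a, as)"
    and bc: "(bvec (i, a # as) :: _ \<Rightarrow> 'k) = pa_mult QB ?b ?c"
    using bvec_Cons[OF Cons.prems] by auto
  have b: "?b \<in> pa_carrier QB" and c: "?c \<in> pa_carrier QB" using arrow_valid a by auto
  obtain u f where u: "u \<in> pa_carrier Q" "lin_functional A f" "\<Phi> ?b = (\<psi> u, f)"
    by (rule Phi_elem[OF b])
  have u0: "u (v, []) = 0" for v
    using char_arrow[OF a(1), of v] char_eq[OF u(1,3), of v] pa_carrier_not_vert[OF u(1), of v]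
    by (cases "v \<in> verts Q") auto
  have u1: "1 \<le> length (snd p)" if "u p \<noteq> 0" for p
    using that u0 by (cases p; cases "snd p") auto
  obtain w h where w: "\<Phi> ?c = (\<psi> w, h)" "w \<in> pa_carrier Q" "lin_functional A h"
    and wk: "\<And>p. w p \<noteq> 0 \<Longrightarrow> ?k \<le> length (snd p)"
    and hk: "\<And>z. z \<in> pa_carrier Q \<Longrightarrow> (\<And>p. z p \<noteq> 0 \<Longrightarrow> L + 2 - ?k \<le> length (snd p)) \<Longrightarrow> h (\<psi> z) = 0"
    using Cons.IH[OF a(2)] unfolding lvl_def by blast
  let ?f = "\<lambda>z. if z \<in> acarr A then h (amul A z (\<psi> u)) + f (amul A (\<psi> w) z) else 0"
  have eq: "\<Phi> (bvec (i, a # as)) = (\<psi> (pa_mult Q u w), ?f)"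
    unfolding bc Phi_mult[OF b c] u(3) w(1) by (rule triv_ext_mult[OF u(1) w(2)])
  have uw: "pa_mult Q u w \<in> pa_carrier Q" by (rule pa_carrier_mult[OF finQ u(1) w(2)])
  have "bvec (i, a # as) \<in> pa_carrier QB" using Cons.prems by simp
  from Phi_in[OF this] have "lin_functional A ?f" unfolding eq by (simp add: triv_ext_def)
  moreover have "Suc ?k \<le> length (snd p)" if "pa_mult Q u w p \<noteq> 0" for p
  proof -
    obtain q r where "u q \<noteq> 0" "w r \<noteq> 0" "joins Q q r p" using \<open>pa_mult Q u w p \<noteq> 0\<close> by (rule pa_mult_support)
    then show ?thesis using u1[of q] wk[of r] by (simp add: joins_def cat_def)
  qed
  moreover have "?f (\<psi> z) = 0" if z: "z \<in> pa_carrier Q" "\<And>p. z p \<noteq> 0 \<Longrightarrow> L + 2 - Suc ?k \<le> length (snd p)" for z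
  proof -
    have zu: "pa_mult Q z u \<in> pa_carrier Q" and wz: "pa_mult Q w z \<in> pa_carrier Q"
      using pa_carrier_mult[OF finQ] z u w by auto
    have "h (\<psi> (pa_mult Q z u)) = 0"
    proof (rule hk[OF zu])
      fix p assume "pa_mult Q z u p \<noteq> 0"
      then obtain q r where "z q \<noteq> 0" "u r \<noteq> 0" "joins Q q r p" by (rule pa_mult_support)
      then show "L + 2 - ?k \<le> length (snd p)" using z(2)[of q] u1[of r] by (simp add: joins_def cat_def)
    qed
    moreover have "\<psi> (pa_mult Q w z) = azero A"
    proof (rule psi_long[OF L wz])
      fix p assume "pa_mult Q w z p \<noteq> 0"
      then obtain q r where "w q \<noteq> 0" "z r \<noteq> 0" "joins Q q r p" by (rule pa_mult_support)
      then show "L < length (snd p)" using wk[of q] z(2)[of r] by (simp add: joins_def cat_def)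
    qed
    ultimately show ?thesis
      using functional_azero[OF u(2)] by (simp add: psi_mult z u w)
  qed
  ultimately show ?case
    unfolding lvl_def eq using uw
    by (intro exI[of _ "pa_mult Q u w"] exI[of _ ?f] conjI ballI allI impI)
      (simp_all del: split_paired_All)
qed

text \<open>A nonzero path of length m in the presentation uses at most one element of DA,
  so its remaining m - 1 factors multiply to something nonzero in A.\<close>

lemma long_path:
  assumes "valid_path QB (i, as)" "bvec (i, as) \<notin> I"
  shows "\<exists>p\<in>P. length as \<le> length (snd p) + 1"
proof -
  define L where "L = Max ((\<lambda>p. length (snd p)) ` P)"
  have L: "length (snd p) \<le> L" if "p \<in> P" for p using that finP by (simp add: L_def)
  have "verts Q \<noteq> {}" using finQ by (simp add: finite_quiver_def)
  then have "P \<noteq> {}" using trivP by blast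
  then have "L \<in> (\<lambda>p. length (snd p)) ` P" unfolding L_def using finP by (intro Max_in) auto
  moreover have "length as \<le> L + 1"
  proof (rule ccontr)
    assume "\<not> length as \<le> L + 1"
    \<comment> \<open>The truncated difference being 0, the functional kills every element of
      A.\<close>
    then have l: "L + 2 - length as = 0" "L < length as" by auto
    obtain u f where u: "\<Phi> (bvec (i, as)) = (\<psi> u, f)" "u \<in> pa_carrier Q" "lin_functional A f"
      "\<And>p. u p \<noteq> 0 \<Longrightarrow> length as \<le> length (snd p)" "\<And>w. w \<in> pa_carrier Q \<Longrightarrow> f (\<psi> w) = 0"
      using lvl_path[OF L assms(1)] unfolding lvl_def l(1) by auto
    have "\<psi> u = azero A" using psi_long[OF L u(2)] u(4) l(2) by fastforce
    moreover have "f = (\<lambda>_. 0)"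
    proof
      fix x show "f x = 0"
      proof (cases "x \<in> acarr A")
        case True then show ?thesis using u(5) by (metis psi_onto)
      qed (use u(3) in \<open>simp add: lin_functional_def\<close>)
    qed
    ultimately have "\<Phi> (bvec (i, as)) = azero (triv_ext A)" by (simp add: u(1) triv_ext_def)
    then show False using kerB[of "bvec (i, as)"] assms by simp
  qed
  ultimately show ?thesis by auto
qed

end

end

section \<open>Tree quivers\<close>

lemma ideal_gen_empty: "x \<in> ideal_gen Q {} \<longleftrightarrow> x = (\<lambda>_. 0)"
proof
  assume "x \<in> ideal_gen Q {}"
  then show "x = (\<lambda>_. 0)" by induction auto
qed (simp add: ideal_gen.zero)

text \<open>Needed because Q and \<open>linA\<close> live on different types. G carries paths of Q
  bijectively to paths of Q', and \<theta> pulls functions back along G, which reverses the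
  direction: presentations move from Q to Q'.\<close>

lemma iso_quot_quiver_iso:
  fixes A :: "('k::field, 'e) alg" and Q :: "('v, 'a) quiver" and Q' :: "('w, 'b) quiver"
  assumes finQ: "finite_quiver Q" and finQ': "finite_quiver Q'"
    and fv: "bij_betw fv (verts Q) (verts Q')" and fa: "bij_betw fa (arrs Q) (arrs Q')"
    and st: "\<And>a. a \<in> arrs Q \<Longrightarrow> src Q' (fa a) = fv (src Q a) \<and> tgt Q' (fa a) = fv (tgt Q a)"
    and iso: "iso_quot Q {} A"
  shows "iso_quot Q' {} A"
proof -
  define G where "G p = (fv (fst p), map fa (snd p))" for p :: "'v \<times> 'a list"
  \<comment> \<open>The maps on vertices and arrows are injective only on Q itself, so the guard
    keeps values at pairs that are not paths of Q equal to 0.\<close>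
  define \<theta> where "\<theta> x p = (if valid_path Q p then x (G p) else 0)"
    for x :: "'w \<times> 'b list \<Rightarrow> 'k" and p
  have inQ: "src Q a \<in> verts Q" "tgt Q a \<in> verts Q" if "a \<in> arrs Q" for a
    using finQ that by (auto simp: finite_quiver_def)
  have chG: "chain Q' (fv v) (map fa as)" if "chain Q v as" for v as
    using that fv fa by (induction as arbitrary: v) (auto simp: st bij_betw_def)
  have pendG: "pend Q' (fv v) (map fa as) = fv (pend Q v as)" if "chain Q v as" for v as
    using that by (induction as arbitrary: v) (auto simp: st)
  have validG: "valid_path Q' (G p)" if "valid_path Q p" for p
    using chG that by (simp add: G_def valid_path_def)
  have liftG: "\<exists>bs. chain Q v bs \<and> map fa bs = as" if "chain Q' (fv v) as" "v \<in> verts Q" for v as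
    using that
  proof (induction as arbitrary: v)
    case (Cons b as)
    then have "b \<in> fa ` arrs Q" using fa by (simp add: bij_betw_def)
    then obtain a where a: "a \<in> arrs Q" "b = fa a" by blast
    have "fv (src Q a) = fv v" using Cons.prems a by (simp add: st)
    then have "src Q a = v" using fv inQ[OF a(1)] Cons.prems(2) by (auto simp: bij_betw_def inj_on_def)
    moreover obtain bs where "chain Q (tgt Q a) bs" "map fa bs = as"
      using Cons.IH[of "tgt Q a"] Cons.prems a inQ by (auto simp: st)
    ultimately show ?case using a by (intro exI[of _ "a # bs"]) auto
  qed simp
  have surjG: "\<exists>p. valid_path Q p \<and> G p = q" if "valid_path Q' q" for q
  proof -
    have "fst q \<in> verts Q'" using that chain_start[OF finQ'] by (auto simp: valid_path_def)
    then obtain v where v: "v \<in> verts Q" "fst q = fv v" using fv by (auto simp: bij_betw_def)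
    have "chain Q' (fv v) (snd q)" using that v(2) by (simp add: valid_path_def)
    then obtain bs where "chain Q v bs" "map fa bs = snd q" using liftG v(1) by blast
    then show ?thesis using v by (intro exI[of _ "(v, bs)"]) (simp add: G_def valid_path_def prod_eq_iff)
  qed
  have injG: "inj_on G {p. valid_path Q p}"
  proof (rule inj_onI)
    fix p q assume "p \<in> {p. valid_path Q p}" "q \<in> {p. valid_path Q p}" and eq: "G p = G q"
    then have c: "chain Q (fst p) (snd p)" "chain Q (fst q) (snd q)" by (auto simp: valid_path_def)
    have "fst p = fst q"
      using eq fv chain_start[OF finQ] c by (auto simp: G_def bij_betw_def inj_on_def)
    moreover have "inj_on fa (set (snd p) \<union> set (snd q))"
      using fa chain_arrs[OF c(1)] chain_arrs[OF c(2)] by (auto simp: bij_betw_def intro: inj_on_subset)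
    then have "snd p = snd q" using eq by (auto simp: G_def dest: map_inj_on)
    ultimately show "p = q" by (simp add: prod_eq_iff)
  qed
  have \<theta>_carrier: "\<theta> x \<in> pa_carrier Q" if "x \<in> pa_carrier Q'" for x
  proof -
    have "G ` {p. \<theta> x p \<noteq> 0} \<subseteq> {q. x q \<noteq> 0}" by (auto simp: \<theta>_def split: if_splits)
    moreover have "finite {q. x q \<noteq> 0}" using that by (simp add: pa_carrier_def)
    ultimately have "finite (G ` {p. \<theta> x p \<noteq> 0})" by (rule finite_subset)
    moreover have "inj_on G {p. \<theta> x p \<noteq> 0}"
      by (rule inj_on_subset[OF injG]) (auto simp: \<theta>_def)
    ultimately have "finite {p. \<theta> x p \<noteq> 0}" by (rule finite_imageD)
    then show ?thesis by (auto simp: pa_carrier_def \<theta>_def)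
  qed
  have \<theta>_mult: "\<theta> (pa_mult Q' x y) = pa_mult Q (\<theta> x) (\<theta> y)"
    if "x \<in> pa_carrier Q'" "y \<in> pa_carrier Q'" for x y
  proof (rule ext)
    fix r :: "'v \<times> 'a list"
    obtain v as where r: "r = (v, as)" by (cases r)
    show "\<theta> (pa_mult Q' x y) r = pa_mult Q (\<theta> x) (\<theta> y) r"
    proof (cases "valid_path Q r")
      case True
      have "chain Q v (take k as) \<and> chain Q (pend Q v (take k as)) (drop k as)" for k
        using True chain_append[OF finQ, of v "take k as" "drop k as"] by (simp add: r valid_path_def)
      then show ?thesis
        using True unfolding r
        by (simp add: \<theta>_def G_def pa_mult_split valid_path_def take_map drop_map pendG)
    next
      case False
      have "pa_mult Q (\<theta> x) (\<theta> y) \<in> pa_carrier Q"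
        by (intro pa_carrier_mult finQ \<theta>_carrier that)
      then have "pa_mult Q (\<theta> x) (\<theta> y) r = 0" using False unfolding pa_carrier_def by blast
      then show ?thesis using False by (simp add: \<theta>_def)
    qed
  qed
  have \<theta>_one: "\<theta> (pa_one Q') = pa_one Q"
  proof (rule ext)
    fix p :: "'v \<times> 'a list"
    show "\<theta> (pa_one Q') p = pa_one Q p"
      using fv by (cases p; cases "snd p") (auto simp: \<theta>_def pa_one_def G_def valid_path_def bij_betw_def)
  qed
  have \<theta>_onto: "\<exists>x\<in>pa_carrier Q'. \<theta> x = y" if y: "y \<in> pa_carrier Q" for y
  proof -
    define H where "H = inv_into {p. valid_path Q p} G"
    have HG: "H (G p) = p" if "valid_path Q p" for p
      unfolding H_def using inv_into_f_f[OF injG] that by simp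
    define x where "x q = (if valid_path Q' q then y (H q) else 0)" for q
    have "\<theta> x p = y p" for p
    proof (cases "valid_path Q p")
      case True then show ?thesis using HG validG by (simp add: \<theta>_def x_def)
    next
      case False
      then have "y p = 0" using y unfolding pa_carrier_def by blast
      then show ?thesis using False by (simp add: \<theta>_def)
    qed
    moreover have "x \<in> pa_carrier Q'"
    proof -
      have "{q. x q \<noteq> 0} \<subseteq> G ` {p. y p \<noteq> 0}"
      proof
        fix q assume "q \<in> {q. x q \<noteq> 0}"
        then have q: "valid_path Q' q" "y (H q) \<noteq> 0" by (auto simp: x_def split: if_splits)
        then obtain p where "valid_path Q p" "G p = q" using surjG by blast
        then show "q \<in> G ` {p. y p \<noteq> 0}" using q HG[of p] by force
      qed
      moreover have "finite {p. y p \<noteq> 0}" using y by (simp add: pa_carrier_def)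
      ultimately have "finite {q. x q \<noteq> 0}" by (meson finite_imageI finite_subset)
      then show ?thesis by (auto simp: pa_carrier_def x_def)
    qed
    ultimately show ?thesis by (intro bexI[of _ x]) auto
  qed
  obtain \<psi> where hom: "pa_hom_onto Q A \<psi>"
    and ker: "\<And>x. x \<in> pa_carrier Q \<Longrightarrow> \<psi> x = azero A \<longleftrightarrow> x = (\<lambda>_. 0)"
    using iso unfolding iso_quot_def ideal_gen_empty by blast
  have "pa_hom_onto Q' A (\<lambda>x. \<psi> (\<theta> x))"
    unfolding pa_hom_onto_def
  proof (intro conjI ballI allI)
    show "acarr A \<subseteq> (\<lambda>x. \<psi> (\<theta> x)) ` pa_carrier Q'"
    proof
      fix a assume "a \<in> acarr A"
      then obtain y where "y \<in> pa_carrier Q" "a = \<psi> y" using hom unfolding pa_hom_onto_def by blast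
      then show "a \<in> (\<lambda>x. \<psi> (\<theta> x)) ` pa_carrier Q'" using \<theta>_onto by blast
    qed
    have "\<theta> (\<lambda>_. 0) = (\<lambda>_. 0)" by (auto simp: \<theta>_def)
    then show "\<psi> (\<theta> (\<lambda>_. 0)) = azero A" using hom unfolding pa_hom_onto_def by simp
    show "\<psi> (\<theta> (pa_one Q')) = aone A" using hom unfolding pa_hom_onto_def \<theta>_one by simp
  next
    fix x :: "'w \<times> 'b list \<Rightarrow> 'k" assume x: "x \<in> pa_carrier Q'"
    then show "\<psi> (\<theta> x) \<in> acarr A" using hom \<theta>_carrier unfolding pa_hom_onto_def by blast
    fix c
    have "\<theta> (\<lambda>p. c * x p) = (\<lambda>p. c * \<theta> x p)" by (auto simp: \<theta>_def)
    then show "\<psi> (\<theta> (\<lambda>p. c * x p)) = asmul A c (\<psi> (\<theta> x))"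
      using hom \<theta>_carrier[OF x] unfolding pa_hom_onto_def by auto
  next
    fix x y :: "'w \<times> 'b list \<Rightarrow> 'k" assume x: "x \<in> pa_carrier Q'" and y: "y \<in> pa_carrier Q'"
    have "\<theta> (\<lambda>p. x p + y p) = (\<lambda>p. \<theta> x p + \<theta> y p)" by (auto simp: \<theta>_def)
    then show "\<psi> (\<theta> (\<lambda>p. x p + y p)) = aadd A (\<psi> (\<theta> x)) (\<psi> (\<theta> y))"
      using hom \<theta>_carrier[OF x] \<theta>_carrier[OF y] unfolding pa_hom_onto_def by auto
    show "\<psi> (\<theta> (pa_mult Q' x y)) = amul A (\<psi> (\<theta> x)) (\<psi> (\<theta> y))"
      unfolding \<theta>_mult[OF x y]
      using hom \<theta>_carrier[OF x] \<theta>_carrier[OF y] unfolding pa_hom_onto_def by blast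
  qed
  moreover have "\<psi> (\<theta> x) = azero A \<longleftrightarrow> x \<in> ideal_gen Q' {}" if x: "x \<in> pa_carrier Q'" for x
  proof -
    have "\<theta> x = (\<lambda>_. 0) \<longleftrightarrow> x = (\<lambda>_. 0)"
    proof
      assume 0: "\<theta> x = (\<lambda>_. 0)"
      show "x = (\<lambda>_. 0)"
      proof (rule ext, rule ccontr)
        fix q assume "x q \<noteq> 0"
        then have "valid_path Q' q" using x unfolding pa_carrier_def by blast
        then obtain p where "valid_path Q p" "G p = q" using surjG by blast
        then show False using fun_cong[OF 0, of p] \<open>x q \<noteq> 0\<close> by (simp add: \<theta>_def)
      qed
    qed (auto simp: \<theta>_def)
    then show ?thesis using ker[OF \<theta>_carrier[OF x]] by (simp add: ideal_gen_empty)
  qed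
  ultimately show ?thesis unfolding iso_quot_def by blast
qed

section \<open>Simple walks in a tree and the recognition of a linear quiver\<close>

definition simple_walk :: "('v, 'a) quiver \<Rightarrow> nat \<Rightarrow> (nat \<Rightarrow> 'v) \<Rightarrow> (nat \<Rightarrow> 'a) \<Rightarrow> bool" where
  "simple_walk Q N w a \<longleftrightarrow> w ` {..N} \<subseteq> verts Q \<and> inj_on w {..N} \<and>
     (\<forall>k<N. a k \<in> arrs Q \<and> {src Q (a k), tgt Q (a k)} = {w k, w (Suc k)})"

lemma simple_walk_inj: "simple_walk Q N w a \<Longrightarrow> i \<le> N \<Longrightarrow> j \<le> N \<Longrightarrow> w i = w j \<Longrightarrow> i = j"
  unfolding simple_walk_def by (meson atMost_iff inj_onD)

lemma simple_walk_arrow: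
  "simple_walk Q N w a \<Longrightarrow> k < N \<Longrightarrow> {src Q (a k), tgt Q (a k)} = {w k, w (Suc k)}"
  by (simp add: simple_walk_def)

lemma simple_walk_inj_arrows:
  assumes "simple_walk Q N w a"
  shows "inj_on a {..<N}"
proof (rule linorder_inj_onI)
  fix k l assume kl: "k < l" "k \<in> {..<N}" "l \<in> {..<N}"
  show "a k \<noteq> a l"
  proof
    assume "a k = a l"
    then have "{w k, w (Suc k)} = {w l, w (Suc l)}"
      using simple_walk_arrow[OF assms, of k] simple_walk_arrow[OF assms, of l] kl by simp
    then have "w k = w l \<or> w k = w (Suc l)" by blast
    then show False
      using simple_walk_inj[OF assms, of k l] simple_walk_inj[OF assms, of k "Suc l"] kl by auto
  qed
qed auto

lemma uwalk_append: "uwalk Q u xs v \<Longrightarrow> uwalk Q v ys w \<Longrightarrow> uwalk Q u (xs @ ys) w"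
  by (induction xs arbitrary: u) auto

lemma simple_walk_uwalk:
  assumes "simple_walk Q N w a" "i \<le> j" "j \<le> N"
  shows "uwalk Q (w i) (map (\<lambda>k. (a k, src Q (a k) = w k)) [i..<j]) (w j)"
  using assms(2,3)
proof (induction j)
  case 0
  then show ?case using assms(1) by (auto simp: simple_walk_def)
next
  case (Suc j)
  show ?case
  proof (cases "i = Suc j")
    case True
    then show ?thesis using Suc assms(1) by (auto simp: simple_walk_def)
  next
    case False
    then have ij: "i \<le> j" using Suc.prems by simp
    have *: "a j \<in> arrs Q" "{src Q (a j), tgt Q (a j)} = {w j, w (Suc j)}" "w (Suc j) \<in> verts Q"
      using assms(1) Suc.prems by (auto simp: simple_walk_def)
    have "uwalk Q (w j) [(a j, src Q (a j) = w j)] (w (Suc j))"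
      using * by (auto simp: step_from_def step_to_def doubleton_eq_iff)
    moreover have "uwalk Q (w i) (map (\<lambda>k. (a k, src Q (a k) = w k)) [i..<j]) (w j)"
      using Suc.IH ij Suc.prems by simp
    ultimately have "uwalk Q (w i) (map (\<lambda>k. (a k, src Q (a k) = w k)) [i..<j] @
        [(a j, src Q (a j) = w j)]) (w (Suc j))" by (intro uwalk_append)
    then show ?thesis using ij by simp
  qed
qed

text \<open>An arrow outside the walk with both ends on it would close the segment between these
  ends to a cycle. For a loop the segment is empty and the arrow alone is the cycle.\<close>

lemma tree_arrow_in_walk:
  assumes tree: "is_tree_quiver Q" and w: "simple_walk Q N w a"
    and b: "b \<in> arrs Q" "src Q b \<in> w ` {..N}" "tgt Q b \<in> w ` {..N}"
  shows "b \<in> a ` {..<N}"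
proof (rule ccontr)
  assume nb: "b \<notin> a ` {..<N}"
  obtain i j where ij: "i \<le> N" "j \<le> N" "src Q b = w i" "tgt Q b = w j" using b by auto
  have V: "w i \<in> verts Q" "w j \<in> verts Q" using w ij by (auto simp: simple_walk_def)
  let ?ws = "\<lambda>i j. map (\<lambda>k. (a k, src Q (a k) = w k)) [i..<j]"
  have d: "distinct (map fst (?ws i j)) \<and> b \<notin> set (map fst (?ws i j))" if "j \<le> N" for i j
  proof -
    have "inj_on a {i..<j}"
      using simple_walk_inj_arrows[OF w] that by (auto intro: inj_on_subset)
    then show ?thesis using nb that by (auto simp: distinct_map comp_def)
  qed
  have no: False if "uwalk Q u (?ws i j @ [(b, c)]) u" "j \<le> N" for i j u c
  proof -
    have "distinct (map fst (?ws i j @ [(b, c)]))" using d[OF that(2), of i] by simp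
    then show False using tree that(1) unfolding is_tree_quiver_def by blast
  qed
  show False
  proof (cases "i \<le> j")
    case True
    have "uwalk Q (w j) [(b, False)] (w i)" using b ij V by (simp add: step_from_def step_to_def)
    from uwalk_append[OF simple_walk_uwalk[OF w True ij(2)] this] show False
      by (rule no[OF _ ij(2)])
  next
    case False
    then have "j \<le> i" by simp
    have "uwalk Q (w i) [(b, True)] (w j)" using b ij V by (simp add: step_from_def step_to_def)
    from uwalk_append[OF simple_walk_uwalk[OF w \<open>j \<le> i\<close> ij(1)] this] show False
      by (rule no[OF _ ij(1)])
  qed
qed

lemma chain_nth:
  assumes "chain Q v as" "k < length as"
  shows "as ! k \<in> arrs Q \<and> src Q (as ! k) = pend Q v (take k as) \<and>
    tgt Q (as ! k) = pend Q v (take (Suc k) as)"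
  using assms
proof (induction as arbitrary: v k)
  case (Cons a as)
  then show ?case by (cases k) auto
qed simp

lemma chain_pend_verts:
  assumes "finite_quiver Q" "chain Q v as"
  shows "pend Q v (take k as) \<in> verts Q"
  using chain_append[OF assms(1), of v "take k as" "drop k as"] assms(2) chain_end by fastforce

text \<open>If arrow N ended at a vertex visited before, \<open>tree_arrow_in_walk\<close> would
  make it equal to an earlier arrow k; comparing sources, vertices N and k would coincide.\<close>

lemma tree_chain_walk:
  assumes tree: "is_tree_quiver Q" and ch: "chain Q v as"
  shows "simple_walk Q (length as) (\<lambda>k. pend Q v (take k as)) (\<lambda>k. as ! k)"
proof -
  let ?w = "\<lambda>k. pend Q v (take k as)"
  have fin: "finite_quiver Q" using tree by (simp add: is_tree_quiver_def)
  have "simple_walk Q N ?w (\<lambda>k. as ! k)" if "N \<le> length as" for N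
    using that
  proof (induction N)
    case 0
    then show ?case using chain_pend_verts[OF fin ch, of 0] by (simp add: simple_walk_def)
  next
    case (Suc N)
    then have w: "simple_walk Q N ?w (\<lambda>k. as ! k)" by simp
    have "?w (Suc N) \<notin> ?w ` {..N}"
    proof
      assume "?w (Suc N) \<in> ?w ` {..N}"
      then have "as ! N \<in> (\<lambda>k. as ! k) ` {..<N}"
        using chain_nth[OF ch, of N] Suc.prems
        by (intro tree_arrow_in_walk[OF tree w]) (simp_all del: take_Suc)
      then obtain k where "k < N" "as ! N = as ! k" by auto
      then have "?w N = ?w k"
        using chain_nth[OF ch, of N] chain_nth[OF ch, of k] Suc.prems by simp
      then show False using simple_walk_inj[OF w, of N k] \<open>k < N\<close> by simp
    qed
    then have "inj_on ?w {..Suc N}"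
      using w unfolding atMost_Suc simple_walk_def by (auto simp only: inj_on_insert)
    moreover have "\<forall>k<Suc N. as ! k \<in> arrs Q \<and> {src Q (as ! k), tgt Q (as ! k)} = {?w k, ?w (Suc k)}"
      using chain_nth[OF ch] Suc.prems by simp
    moreover have "?w ` {..Suc N} \<subseteq> verts Q" using chain_pend_verts[OF fin ch] by blast
    ultimately show ?case unfolding simple_walk_def by blast
  qed
  then show ?thesis by simp
qed

lemma tree_no_cycle:
  assumes "is_tree_quiver Q" "chain Q v as" "as \<noteq> []"
  shows "pend Q v as \<noteq> v"
  using tree_chain_walk[OF assms(1,2)] assms(3)
  unfolding simple_walk_def inj_on_def by (metis atMost_iff le0 length_0_conv order_refl pend.simps(1) take0 take_all_iff)

lemma simple_walk_card:
  assumes "finite_quiver Q" "simple_walk Q N w a"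
  shows "N < card (verts Q)"
proof -
  have "card (w ` {..N}) = Suc N" using assms(2) by (simp add: simple_walk_def card_image)
  moreover have "card (w ` {..N}) \<le> card (verts Q)"
    using assms by (intro card_mono) (auto simp: simple_walk_def finite_quiver_def)
  ultimately show ?thesis by simp
qed

lemma simple_walk_spanning:
  assumes tree: "is_tree_quiver Q" and w: "simple_walk Q N w a" and N: "card (verts Q) \<le> Suc N"
  shows "w ` {..N} = verts Q" "a ` {..<N} = arrs Q"
proof -
  have fin: "finite_quiver Q" using tree by (simp add: is_tree_quiver_def)
  have "card (w ` {..N}) = Suc N" using w by (simp add: simple_walk_def card_image)
  then show V: "w ` {..N} = verts Q"
    using w fin N by (intro card_seteq) (auto simp: simple_walk_def finite_quiver_def)
  show "a ` {..<N} = arrs Q"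
  proof
    show "a ` {..<N} \<subseteq> arrs Q" using w by (auto simp: simple_walk_def)
    show "arrs Q \<subseteq> a ` {..<N}"
    proof
      fix b assume "b \<in> arrs Q"
      then show "b \<in> a ` {..<N}"
        using fin V by (intro tree_arrow_in_walk[OF tree w]) (auto simp: finite_quiver_def)
    qed
  qed
qed

text \<open>The chain visits every vertex, hence uses every arrow, and numbering along it is the
  isomorphism with the linear quiver.\<close>

lemma spanning_chain_iso_linA:
  fixes A :: "('k::field, 'e) alg"
  assumes tree: "is_tree_quiver Q" and ch: "chain Q v as" and n: "card (verts Q) \<le> Suc (length as)"
    and comp: "\<forall>(a, b)\<in>Rel. composable Q a b" and nr: "\<not> has_rel Rel as"
    and iso: "iso_quot Q (rel_elems Q Rel) A"
  shows "iso_quot (linA (card (verts Q))) {} A"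
proof -
  let ?w = "\<lambda>k. pend Q v (take k as)" and ?a = "\<lambda>k. as ! k" and ?N = "length as"
  have fin: "finite_quiver Q" using tree by (simp add: is_tree_quiver_def)
  have w: "simple_walk Q ?N ?w ?a" by (rule tree_chain_walk[OF tree ch])
  have n: "card (verts Q) = Suc ?N" using simple_walk_card[OF fin w] n by simp
  have span: "?w ` {..?N} = verts Q" "?a ` {..<?N} = arrs Q"
    using simple_walk_spanning[OF tree w] n by simp_all
  have injw: "inj_on ?w {..?N}" using w by (simp add: simple_walk_def)
  \<comment> \<open>The two arrows of a relation lie on the chain. As no vertex repeats, they are
    consecutive there, so the chain would contain the relation.\<close>
  have "Rel = {}"
  proof (rule ccontr)
    assume "Rel \<noteq> {}"
    then obtain b c where bc: "(b, c) \<in> Rel" by auto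
    then have comp: "b \<in> arrs Q" "c \<in> arrs Q" "tgt Q b = src Q c"
      using comp by (auto simp: composable_def)
    then obtain k l where kl: "k < ?N" "b = as ! k" "l < ?N" "c = as ! l" using span(2) by blast
    then have "?w (Suc k) = ?w l" using chain_nth[OF ch] comp by metis
    then have l: "l = Suc k" using injw kl by (auto simp: inj_on_def)
    have "as = take k as @ [as ! k, as ! Suc k] @ drop (Suc (Suc k)) as"
      using kl l by (metis Cons_nth_drop_Suc append_Cons append_Nil append_take_drop_id)
    then show False using nr bc kl l unfolding has_rel_def by blast
  qed
  then have iso': "iso_quot Q {} A" using iso by simp
  let ?n = "card (verts Q)"
  have fv: "bij_betw (\<lambda>x. Suc (inv_into {..?N} ?w x)) (verts Q) (verts (linA ?n))"
  proof -
    have "bij_betw (inv_into {..?N} ?w) (verts Q) {..?N}"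
      using injw span(1) by (intro bij_betw_inv_into) (simp add: bij_betw_def)
    moreover have "bij_betw Suc {..?N} (verts (linA ?n))"
      by (simp add: bij_betw_def n image_Suc_atMost)
    ultimately have "bij_betw (Suc \<circ> inv_into {..?N} ?w) (verts Q) (verts (linA ?n))"
      by (rule bij_betw_trans)
    then show ?thesis by (simp add: comp_def)
  qed
  have inja: "inj_on ?a {..<?N}" by (rule simple_walk_inj_arrows[OF w])
  have fa: "bij_betw (\<lambda>x. Suc (inv_into {..<?N} ?a x)) (arrs Q) (arrs (linA ?n))"
  proof -
    have "bij_betw (inv_into {..<?N} ?a) (arrs Q) {..<?N}"
      using inja span(2) by (intro bij_betw_inv_into) (simp add: bij_betw_def)
    moreover have "bij_betw Suc {..<?N} (arrs (linA ?n))"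
      by (auto simp add: bij_betw_def n image_Suc_lessThan)
    ultimately have "bij_betw (Suc \<circ> inv_into {..<?N} ?a) (arrs Q) (arrs (linA ?n))"
      by (rule bij_betw_trans)
    then show ?thesis by (simp add: comp_def)
  qed
  have iw: "inv_into {..?N} ?w (?w k) = k" if "k \<le> ?N" for k
    using inv_into_f_f[OF injw, of k] that by simp
  have ia: "inv_into {..<?N} ?a (?a k) = k" if "k < ?N" for k
    using inv_into_f_f[OF inja, of k] that by simp
  show ?thesis
  proof (rule iso_quot_quiver_iso[OF fin _ fv fa _ iso'])
    show "finite_quiver (linA ?n)" by (rule finite_linA) (simp add: n)
    fix b assume "b \<in> arrs Q"
    then obtain k where k: "k < ?N" "b = as ! k" using span(2) by blast
    show "src (linA ?n) (Suc (inv_into {..<?N} ?a b)) = Suc (inv_into {..?N} ?w (src Q b)) \<and>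
      tgt (linA ?n) (Suc (inv_into {..<?N} ?a b)) = Suc (inv_into {..?N} ?w (tgt Q b))"
      using k ia[OF k(1)] iw[of k] iw[of "Suc k"] chain_nth[OF ch k(1)] by simp
  qed
qed

section \<open>Brauer star algebras\<close>

lemma inc_star: "inc m star_ends v = (if v = 0 then {..<m} else {i. i < m \<and> v = Suc i})"
  by (auto simp: inc_def star_ends_def)

lemma gdeg_star: "2 \<le> gdeg m star_ends v \<longleftrightarrow> v = 0 \<and> 2 \<le> m"
proof (cases v)
  case (Suc i)
  have "{j. j < m \<and> v = Suc j} \<subseteq> {i}" using Suc by auto
  then have "card {j. j < m \<and> v = Suc j} \<le> card {i}" by (intro card_mono) auto
  then show ?thesis using Suc by (auto simp: gdeg_def inc_star)
qed (simp add: gdeg_def inc_star)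

lemma gdeg_star_center: "gdeg m star_ends 0 = m"
  by (simp add: gdeg_def inc_star)

lemma brauer_star_quiver:
  assumes "1 \<le> m"
  shows "verts (brauer_quiver m star_ends succ) = {..<m}"
    "arrs (brauer_quiver m star_ends succ) = Pair 0 ` {..<m}"
    "i < m \<Longrightarrow> src (brauer_quiver m star_ends succ) (0, i) = i"
    "2 \<le> m \<Longrightarrow> tgt (brauer_quiver m star_ends succ) (0, i) = succ 0 i"
    "m = 1 \<Longrightarrow> tgt (brauer_quiver m star_ends succ) (0, i) = 0"
  using assms by (auto simp: brauer_quiver_def inc_star gdeg_star)

text \<open>Leaves have degree one, so no edge carries two cycles to be identified; and any two
  composable arrows are consecutive on the central cycle, so there are no zero relations of length
  two. Only the cycles followed by their first arrow remain.\<close>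

lemma brauer_star_rels:
  assumes m: "2 \<le> m"
  shows "(x :: _ \<Rightarrow> 'k::field) \<in> brauer_rels m star_ends succ \<longleftrightarrow>
    (\<exists>i<m. x = bvec (i, bcycle m star_ends succ 0 i @ [(0, i)]))"
proof -
  let ?sub = "\<lambda>a b. \<exists>v i xs ys. i \<in> inc m star_ends v \<and> 2 \<le> gdeg m star_ends v \<and>
      bcycle m star_ends succ v i = xs @ [a, b] @ ys"
  have *: "?sub a b"
    if ab: "composable (brauer_quiver m star_ends succ) a b" for a b
  proof -
    obtain i where i: "i < m" "a = (0, i)" "b = (0, succ 0 i)"
      using ab m by (auto simp: composable_def brauer_star_quiver)
    \<comment> \<open>As m is at least 2, the cycle at i lists a and then b.\<close>
    have "[0..<m] = 0 # 1 # [2..<m]" using m by (simp add: upt_conv_Cons numeral_2_eq_2)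
    then have "bcycle m star_ends succ 0 i =
        [] @ [a, b] @ map (\<lambda>k. (0, (succ 0 ^^ k) i)) [2..<m]"
      using i by (simp add: bcycle_def gdeg_star_center)
    then show ?thesis using i m by (intro exI[of _ 0] exI[of _ i]) (auto simp: inc_star gdeg_star)
  qed
  have third: "{bvec (snd a, [a, b]) :: _ \<Rightarrow> 'k | a b.
      composable (brauer_quiver m star_ends succ) a b \<and>
      \<not> ?sub a b} = {}"
    using * by blast
  show ?thesis unfolding brauer_rels_def third
    using m by (auto simp: gdeg_star inc_star star_ends_def)
qed

lemma brauer_star_of_linA:
  fixes A :: "('k::field, 'e) alg"
  assumes iso: "iso_quot (linA n) {} A" and n: "1 \<le> n"
  shows "brauer_graph_alg n star_ends (triv_ext A)"
proof -
  define succ :: "nat \<Rightarrow> nat \<Rightarrow> nat" 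
    where "succ v i = (if v = 0 then if Suc i = n then 0 else Suc i else i)" for v i
  have pow: "(succ 0 ^^ k) i = (i + k) mod n" if "i < n" for i k
    using that n by (induction k) (simp_all add: succ_def mod_Suc)
  have "cyclic_orders n star_ends succ"
    unfolding cyclic_orders_def
  proof (intro allI conjI ballI)
    fix v i assume "i \<in> inc n star_ends v"
    then show "succ v i \<in> inc n star_ends v"
      using n by (cases "v = 0") (auto simp: inc_star succ_def)
  next
    fix v
    show "inj_on (succ v) (inc n star_ends v)"
      by (auto simp: inj_on_def succ_def split: if_splits)
  next
    fix v i j assume ij: "i \<in> inc n star_ends v" "j \<in> inc n star_ends v"
    show "\<exists>k. (succ v ^^ k) i = j"
    proof (cases "v = 0")
      case True
      then have "i < n" "j < n" using ij by (auto simp: inc_star)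
      \<comment> \<open>Adding n prevents truncation of the difference and disappears modulo
        n.\<close>
      then have "(succ 0 ^^ (j + n - i)) i = j" using pow[of i "j + n - i"] by simp
      then show ?thesis using True by blast
    next
      case False
      then show ?thesis using ij by (intro exI[of _ 0]) (auto simp: inc_star)
    qed
  qed
  moreover have "iso_quot (brauer_quiver n star_ends succ) (brauer_rels n star_ends succ) (triv_ext A)"
  proof (rule star_presentation[OF iso])
    show "cyclic_quiver n (brauer_quiver n star_ends succ)"
    proof
      fix i assume "i < n"
      then show "tgt (brauer_quiver n star_ends succ) (0, i) = (i + 1) mod n"
        using n by (cases "n = 1") (simp_all add: brauer_star_quiver succ_def mod_Suc)
    qed (use n in \<open>simp_all add: brauer_star_quiver\<close>)
    have cy: "bcycle n star_ends succ 0 i @ [(0, i)] = snd (cyc n i (n + 1))" if "i < n" for i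
      using that pow by (simp add: bcycle_def gdeg_star_center cyc_def)
    have *: "x \<in> brauer_rels n star_ends succ \<longleftrightarrow> (\<exists>i<n. x = bvec (cyc n i (n + 1)))"
      for x :: "nat \<times> (nat \<times> nat) list \<Rightarrow> 'k"
    proof (cases "n = 1")
      case True
      then show ?thesis by (auto simp: brauer_rels_def cyc_def)
    next
      case False
      then show ?thesis using n cy by (subst brauer_star_rels) (auto simp: cyc_def)
    qed
    show "\<exists>i<n. x = bvec (cyc n i (n + 1))" if "x \<in> brauer_rels n star_ends succ"
      for x :: "nat \<times> (nat \<times> nat) list \<Rightarrow> 'k"
      using * that by blast
    show "bvec (cyc n i (n + 1)) \<in> (brauer_rels n star_ends succ :: (_ \<Rightarrow> 'k) set)" if "i < n" for i
      using * that by blast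
  qed
  ultimately show ?thesis unfolding brauer_graph_alg_def by blast
qed

lemma linA_of_brauer_star:
  fixes A :: "('k::field, 'e) alg"
  assumes tree: "is_tree_quiver Q" and pb: "path_basis Q A \<psi> (nonzero_paths Q Rel)"
    and comp: "\<forall>(a, b)\<in>Rel. composable Q a b" and iso: "iso_quot Q (rel_elems Q Rel) A"
    and m: "1 \<le> m" and B: "brauer_graph_alg m star_ends (triv_ext A)"
  shows "iso_quot (linA (card (verts Q))) {} A"
proof -
  obtain succ where cyc: "cyclic_orders m star_ends succ"
    and iq: "iso_quot (brauer_quiver m star_ends succ) (brauer_rels m star_ends succ) (triv_ext A)"
    using B unfolding brauer_graph_alg_def by blast
  obtain \<Phi> where homQB: "pa_hom_onto (brauer_quiver m star_ends succ) (triv_ext A) \<Phi>"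
    and kerQB: "\<And>x. x \<in> pa_carrier (brauer_quiver m star_ends succ) \<Longrightarrow> \<Phi> x = azero (triv_ext A) \<longleftrightarrow>
      x \<in> ideal_gen (brauer_quiver m star_ends succ) (brauer_rels m star_ends succ)"
    using iq unfolding iso_quot_def by auto
  let ?QB = "brauer_quiver m star_ends succ"
  let ?I = "ideal_gen ?QB (brauer_rels m star_ends succ) :: (nat \<times> (nat \<times> nat) list \<Rightarrow> 'k) set"
  have succ: "succ 0 i < m" if "i < m" for i
  proof -
    have "\<forall>i\<in>inc m star_ends 0. succ 0 i \<in> inc m star_ends 0"
      using cyc unfolding cyclic_orders_def by blast
    then show ?thesis using that by (simp add: inc_star)
  qed
  have tgt: "tgt ?QB (0, i) < m" if "i < m" for i
    using that m succ by (cases "m = 1") (auto simp: brauer_star_quiver)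
  \<comment> \<open>The bound is uniform: for one edge the relation is the square of the loop, of
    length 2 = m + 1.\<close>
  have len: "m + 1 \<le> length (snd p)"
    if r: "r \<in> (brauer_rels m star_ends succ :: (_ \<Rightarrow> 'k) set)" "r p \<noteq> 0" for r p
  proof (cases "m = 1")
    case True
    then show ?thesis using that by (auto simp: brauer_rels_def bvec_def split: if_splits)
  next
    case False
    then have m2: "2 \<le> m" using m by simp
    obtain i where "r = bvec (i, bcycle m star_ends succ 0 i @ [(0, i)])"
      using r(1) unfolding brauer_star_rels[OF m2] by blast
    then show ?thesis using r(2)
      by (auto simp: bvec_def bcycle_def gdeg_star_center split: if_splits)
  qed
  have Ilen: "m + 1 \<le> length (snd p)" if "x \<in> ?I" "x p \<noteq> 0" for x p
    by (rule ideal_gen_length[OF _ that]) (rule len)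
  interpret path_basis Q A \<psi> "nonzero_paths Q Rel" by fact
  interpret triv_ext_quotient Q A \<psi> "nonzero_paths Q Rel" ?QB ?I \<Phi>
  proof
    show "finite_quiver ?QB"
      using m tgt by (auto simp: finite_quiver_def brauer_star_quiver lessThan_empty_iff)
    show "x (i, []) = 0" if "x \<in> ?I" for x i
      using Ilen[OF that, of "(i, [])"] by auto
  qed (rule homQB | erule kerQB)+
  have nil: "pa_mult ?QB (bvec (src ?QB a, [a])) (bvec (src ?QB a, [a])) \<in> ?I" if a: "a \<in> arrs ?QB" for a
  proof (cases "m = 1")
    case True
    then have a: "a = (0, 0)" "src ?QB a = 0" using a by (auto simp: brauer_quiver_def)
    have "pa_mult ?QB (bvec (0, [(0, 0)])) (bvec (0, [(0, 0)])) = (bvec (0, [(0, 0), (0, 0)]) :: _ \<Rightarrow> 'k)"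
      by (rule pa_mult_bvec_joins) (simp add: joins_def cat_def brauer_quiver_def True)
    then show ?thesis using a True by (auto simp: brauer_rels_def intro: ideal_gen.gen)
  next
    case False
    then have m2: "2 \<le> m" using m by simp
    obtain i where i: "i < m" "a = (0, i)" using a m by (auto simp: brauer_star_quiver)
    \<comment> \<open>A fixed point could not reach the other edges around the centre; hence the
      arrow is not a loop and does not compose with itself.\<close>
    have "succ 0 i \<noteq> i"
    proof
      assume fx: "succ 0 i = i"
      define j where "j = (if i = 0 then 1 else 0 :: nat)"
      have "j < m" "j \<noteq> i" using m2 by (auto simp: j_def)
      moreover have "(succ 0 ^^ k) i = i" for k by (induction k) (auto simp: fx)
      moreover have "i \<in> inc m star_ends 0" "j \<in> inc m star_ends 0"
        using i \<open>j < m\<close> by (simp_all add: inc_star)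
      ultimately show False using cyc unfolding cyclic_orders_def by metis
    qed
    then have "pa_mult ?QB (bvec (src ?QB a, [a])) (bvec (src ?QB a, [a])) = (\<lambda>_. 0 :: 'k)"
      using i m m2 by (auto simp: pa_mult_bvec joins_def brauer_star_quiver)
    then show ?thesis by (simp add: ideal_gen.zero)
  qed
  have "\<exists>as. chain ?QB i as \<and> length as = k" if "i < m" for i k
    using that
  proof (induction k arbitrary: i)
    case 0 then show ?case using m by (simp add: brauer_star_quiver)
  next
    case (Suc k)
    then obtain as where "chain ?QB (tgt ?QB (0, i)) as" "length as = k" using tgt by blast
    then show ?case
      using Suc.prems m by (intro exI[of _ "(0, i) # as"]) (simp add: brauer_star_quiver)
  qed
  \<comment> \<open>A path of length m is shorter than anything occurring in the ideal, so it is
    nonzero in T(A).\<close>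
  from this[of 0 m] obtain bs where bs: "chain ?QB 0 bs" "length bs = m" using m by auto
  have "bvec (0, bs) \<notin> ?I" using Ilen[of "bvec (0, bs)" "(0, bs)"] bs by (auto simp: bvec_def)
  then obtain p where p: "valid_path Q p" "\<not> has_rel Rel (snd p)" "m \<le> length (snd p) + 1"
    using long_path[OF nil, of 0 bs] bs by (auto simp: valid_path_def)
  \<comment> \<open>Together with the previous bound, Q has at most one vertex more than p has
    arrows, as \<open>spanning_chain_iso_linA\<close> requires.\<close>
  have "card (verts Q) \<le> m"
    using card_verts_le[OF nil] m by (simp add: brauer_star_quiver)
  then show ?thesis
    using spanning_chain_iso_linA[OF tree _ _ comp p(2) iso] p by (simp add: valid_path_def)
qed

section \<open>Brauer line algebras\<close>

lemma inc_line: "inc m line_ends v = {i. i < m \<and> (i = v \<or> Suc i = v)}"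
  by (auto simp: inc_def line_ends_def)

lemma gdeg_line: "2 \<le> gdeg m line_ends v \<longleftrightarrow> 1 \<le> v \<and> v < m"
proof
  assume "2 \<le> gdeg m line_ends v"
  show "1 \<le> v \<and> v < m"
  proof (rule ccontr)
    assume "\<not> (1 \<le> v \<and> v < m)"
    then have "inc m line_ends v \<subseteq> {v - (if v = 0 then 0 else 1)}" by (auto simp: inc_line)
    from card_mono[OF _ this] show False using \<open>2 \<le> gdeg m line_ends v\<close> by (simp add: gdeg_def)
  qed
next
  assume "1 \<le> v \<and> v < m"
  then have "inc m line_ends v = {v - 1, v}" "v - 1 \<noteq> v" by (auto simp: inc_line)
  then show "2 \<le> gdeg m line_ends v" by (simp add: gdeg_def)
qed

lemma gdeg_line_eq: "1 \<le> v \<Longrightarrow> v < m \<Longrightarrow> gdeg m line_ends v = 2"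
proof -
  assume v: "1 \<le> v" "v < m"
  then have "inc m line_ends v = {v - 1, v}" "v - 1 \<noteq> v" by (auto simp: inc_line)
  then show ?thesis by (simp add: gdeg_def)
qed

text \<open>The arrow around the vertex Suc k of the line: from edge k to edge Suc k if u
  holds, and back otherwise.\<close>

definition lsrc :: "nat \<Rightarrow> bool \<Rightarrow> nat" where
  "lsrc k u = (if u then k else Suc k)"

definition larr :: "nat \<Rightarrow> bool \<Rightarrow> nat \<times> nat" where
  "larr k u = (Suc k, lsrc k u)"

abbreviation lpath :: "nat \<Rightarrow> bool \<Rightarrow> (nat \<times> nat) list \<Rightarrow> nat \<times> (nat \<times> nat) list" where
  "lpath k u bs \<equiv> (lsrc k u, larr k u # bs)"

lemma lsrc_inj [simp]: "lsrc k u = lsrc k u' \<longleftrightarrow> u = u'"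
  by (auto simp: lsrc_def)

lemma larr_eq_iff [simp]: "larr k u = larr l u' \<longleftrightarrow> k = l \<and> u = u'"
  by (auto simp: larr_def)

text \<open>A transitive map on two points fixes neither of them, so around an inner vertex it must
  be the swap and the cyclic order is forced.\<close>

lemma cyclic_orders_line:
  assumes cyc: "cyclic_orders m line_ends succ" and v: "1 \<le> v" "v < m"
  shows "succ v v = v - 1" "succ v (v - 1) = v"
proof -
  have inc: "inc m line_ends v = {v - 1, v}" using v by (auto simp: inc_line)
  have c: "\<forall>i\<in>{v - 1, v}. succ v i \<in> {v - 1, v}"
    "\<forall>i\<in>{v - 1, v}. \<forall>j\<in>{v - 1, v}. \<exists>k. (succ v ^^ k) i = j"
    using cyc unfolding cyclic_orders_def inc[symmetric] by blast+
  have ne: "succ v i \<noteq> i" if "i \<in> {v - 1, v}" for i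
  proof
    assume fx: "succ v i = i"
    have "(succ v ^^ k) i = i" for k by (induction k) (auto simp: fx)
    then have "j = i" if "j \<in> {v - 1, v}" for j using c(2) \<open>i \<in> _\<close> that by metis
    then show False using v by (metis diff_le_self insertI1 insertI2 Suc_diff_1 Suc_n_not_le_n less_le_trans zero_less_one singletonI)
  qed
  show "succ v v = v - 1" using c(1) ne[of v] by auto
  show "succ v (v - 1) = v" using c(1) ne[of "v - 1"] by auto
qed

text \<open>The line has N + 1 edges, and its inner vertices 1, ..., N are those of degree two; the
  arrows \<open>larr k\<close> with k < N belong to vertex k + 1.\<close>

locale brauer_line =
  fixes N :: nat and succ :: "nat \<Rightarrow> nat \<Rightarrow> nat"
  assumes N: "1 \<le> N" and cyc: "cyclic_orders (Suc N) line_ends succ"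
begin

abbreviation "QB \<equiv> brauer_quiver (Suc N) line_ends succ"

lemma vertsQB: "verts QB = {..<Suc N}"
  using N by (simp add: brauer_quiver_def)

lemma arrsQB: "b \<in> arrs QB \<longleftrightarrow> (\<exists>k u. k < N \<and> b = larr k u)"
proof -
  have "b \<in> arrs QB \<longleftrightarrow> 1 \<le> fst b \<and> fst b < Suc N \<and> (snd b = fst b \<or> Suc (snd b) = fst b)"
    using N by (cases b) (auto simp: brauer_quiver_def inc_line gdeg_line)
  also have "\<dots> \<longleftrightarrow> (\<exists>k<N. fst b = Suc k \<and> (snd b = Suc k \<or> snd b = k))"
    by (cases "fst b") auto
  also have "\<dots> \<longleftrightarrow> (\<exists>k u. k < N \<and> b = larr k u)"
    by (cases b) (auto simp: larr_def lsrc_def)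
  finally show ?thesis .
qed

lemma srcQB: "src QB (larr k u) = lsrc k u"
  using N by (simp add: brauer_quiver_def larr_def)

lemma succ_line: "k < N \<Longrightarrow> succ (Suc k) (lsrc k u) = lsrc k (\<not> u)"
  using cyclic_orders_line[OF cyc, of "Suc k"] by (auto simp: lsrc_def)

lemma tgtQB: "k < N \<Longrightarrow> tgt QB (larr k u) = lsrc k (\<not> u)"
  using N succ_line[of k u] by (simp add: brauer_quiver_def larr_def)

lemma finQB: "finite_quiver QB"
proof -
  have "arrs QB \<subseteq> (\<lambda>(k, u). larr k u) ` ({..<N} \<times> UNIV)" using arrsQB by force
  then have "finite (arrs QB)" by (rule finite_subset) simp
  moreover have "\<forall>b\<in>arrs QB. src QB b \<in> verts QB \<and> tgt QB b \<in> verts QB"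
  proof
    fix b assume "b \<in> arrs QB"
    then obtain k u where "k < N" "b = larr k u" using arrsQB by blast
    then show "src QB b \<in> verts QB \<and> tgt QB b \<in> verts QB"
      by (auto simp: srcQB tgtQB vertsQB lsrc_def)
  qed
  ultimately show ?thesis by (auto simp: finite_quiver_def vertsQB)
qed

lemma chain_line: "chain QB i (b # bs) \<longleftrightarrow>
  (\<exists>k u. k < N \<and> b = larr k u \<and> i = lsrc k u \<and> chain QB (lsrc k (\<not> u)) bs)"
  using srcQB tgtQB by (auto simp: arrsQB)

lemma chain_line_Nil: "chain QB i [] \<longleftrightarrow> i \<le> N"
  by (simp add: vertsQB less_Suc_eq_le)

lemma lsrc_le: "k < N \<Longrightarrow> lsrc k u \<le> N"
  by (simp add: lsrc_def)

lemma bcycle_line: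
  "k < N \<Longrightarrow> bcycle (Suc N) line_ends succ (Suc k) (lsrc k u) = [larr k u, larr k (\<not> u)]"
  using succ_line[of k u]
  by (simp add: bcycle_def gdeg_line_eq numeral_2_eq_2 larr_def)

lemma edge_at_vertex: "i \<in> inc (Suc N) line_ends v \<and> 2 \<le> gdeg (Suc N) line_ends v \<longleftrightarrow>
  (\<exists>k u. k < N \<and> v = Suc k \<and> i = lsrc k u)"
proof
  assume "i \<in> inc (Suc N) line_ends v \<and> 2 \<le> gdeg (Suc N) line_ends v"
  then have "1 \<le> v" "v < Suc N" "i = lsrc (v - 1) (i \<noteq> v)"
    by (auto simp: gdeg_line inc_line lsrc_def)
  then show "\<exists>k u. k < N \<and> v = Suc k \<and> i = lsrc k u" by (intro exI[of _ "v - 1"] exI[of _ "i \<noteq> v"]) auto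
qed (auto simp: gdeg_line inc_line lsrc_def split: if_splits)

text \<open>The edge k + 1 joins the vertices k + 1 and k + 2; the two cycles of length two at this
  edge, one around each end, are identified.\<close>

abbreviation socle_rel :: "nat \<Rightarrow> nat \<times> (nat \<times> nat) list \<Rightarrow> 'k::field" where
  "socle_rel k \<equiv> (\<lambda>p. bvec (Suc k, [larr k False, larr k True]) p
    - bvec (Suc k, [larr (Suc k) True, larr (Suc k) False]) p)"

text \<open>Two composable arrows lie on a common cycle exactly when they belong to the same vertex,
  which is why the zero relations of length two are indexed by k and l distinct.\<close>

lemma line_rels: "x \<in> brauer_rels (Suc N) line_ends succ \<longleftrightarrow>
  (\<exists>k. Suc k < N \<and> x = socle_rel k) \<or>
  (\<exists>k u. k < N \<and> x = bvec (lpath k u [larr k (\<not> u), larr k u])) \<or>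
  (\<exists>k u l u'. k < N \<and> l < N \<and> k \<noteq> l \<and> lsrc k (\<not> u) = lsrc l u' \<and>
     x = (bvec (lpath k u [larr l u']) :: _ \<Rightarrow> 'k::field))"
  (is "_ \<longleftrightarrow> ?A \<or> ?B \<or> ?C")
proof -
  let ?bc = "bcycle (Suc N) line_ends succ"
  let ?A' = "{(\<lambda>p. bvec (i, ?bc (fst (line_ends i)) i) p - bvec (i, ?bc (snd (line_ends i)) i) p :: 'k) | i.
          i < Suc N \<and> 2 \<le> gdeg (Suc N) line_ends (fst (line_ends i)) \<and> 2 \<le> gdeg (Suc N) line_ends (snd (line_ends i))}"
  let ?B' = "{bvec (i, ?bc v i @ [(v, i)]) :: _ \<Rightarrow> 'k | v i.
          i \<in> inc (Suc N) line_ends v \<and> 2 \<le> gdeg (Suc N) line_ends v}"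
  let ?sub = "\<lambda>a b. \<exists>v i xs ys. i \<in> inc (Suc N) line_ends v \<and> 2 \<le> gdeg (Suc N) line_ends v \<and>
    ?bc v i = xs @ [a, b] @ ys"
  let ?C' = "{bvec (snd a, [a, b]) :: _ \<Rightarrow> 'k | a b. composable QB a b \<and>
          \<not> ?sub a b}"
  have R: "brauer_rels (Suc N) line_ends succ = ?A' \<union> ?B' \<union> ?C'"
    using N by (simp add: brauer_rels_def)
  have A: "x \<in> ?A' \<longleftrightarrow> ?A"
  proof -
    have eq: "?bc (fst (line_ends (Suc k))) (Suc k) = [larr k False, larr k True]"
      "?bc (snd (line_ends (Suc k))) (Suc k) = [larr (Suc k) True, larr (Suc k) False]"
      if "Suc k < N" for k
      using bcycle_line[of k False] bcycle_line[of "Suc k" True] that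
      by (auto simp: line_ends_def lsrc_def)
    have shift: "(\<exists>i. 1 \<le> i \<and> i < N \<and> H i) \<longleftrightarrow> (\<exists>k. Suc k < N \<and> H (Suc k))" for H
    proof
      assume "\<exists>i. 1 \<le> i \<and> i < N \<and> H i"
      then obtain i where "1 \<le> i" "i < N" "H i" by blast
      then show "\<exists>k. Suc k < N \<and> H (Suc k)" by (intro exI[of _ "i - 1"]) simp
    qed auto
    have "x \<in> ?A' \<longleftrightarrow> (\<exists>i. 1 \<le> i \<and> i < N \<and>
        x = (\<lambda>p. bvec (i, ?bc (fst (line_ends i)) i) p - bvec (i, ?bc (snd (line_ends i)) i) p))"
      unfolding gdeg_line by (auto simp: line_ends_def)
    also have "\<dots> \<longleftrightarrow> (\<exists>k. Suc k < N \<and>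
        x = (\<lambda>p. bvec (Suc k, ?bc (fst (line_ends (Suc k))) (Suc k)) p
          - bvec (Suc k, ?bc (snd (line_ends (Suc k))) (Suc k)) p))"
      by (rule shift)
    also have "\<dots> \<longleftrightarrow> ?A" using eq by (intro ex_cong1 conj_cong refl) simp
    finally show ?thesis .
  qed
  have "x \<in> ?B' \<longleftrightarrow> (\<exists>k u. k < N \<and> x = bvec (lsrc k u, ?bc (Suc k) (lsrc k u) @ [larr k u]))"
    unfolding edge_at_vertex by (auto simp: larr_def)
  also have "\<dots> \<longleftrightarrow> ?B" by (intro ex_cong1 conj_cong refl) (simp add: bcycle_line)
  finally have B: "x \<in> ?B' \<longleftrightarrow> ?B" .
  have "\<not> ?sub (larr k u) (larr l u') \<longleftrightarrow> k \<noteq> l"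
    if kl: "k < N" "l < N" "lsrc k (\<not> u) = lsrc l u'" for k u l u'
  proof
    assume "k \<noteq> l"
    have "k = l" if "?bc v i = xs @ [larr k u, larr l u'] @ ys" for v i xs ys
    proof -
      have "fst ` set (?bc v i) \<subseteq> {v}" by (auto simp: bcycle_def)
      then show "k = l" unfolding that by (auto simp: larr_def)
    qed
    then show "\<not> ?sub (larr k u) (larr l u')" using \<open>k \<noteq> l\<close> by blast
  next
    assume no: "\<not> ?sub (larr k u) (larr l u')"
    show "k \<noteq> l"
    proof
      assume "k = l"
      then have "?bc (Suc k) (lsrc k u) = [] @ [larr k u, larr l u'] @ []"
        using bcycle_line[OF kl(1), of u] kl(3) by simp
      moreover have "lsrc k u \<in> inc (Suc N) line_ends (Suc k) \<and> 2 \<le> gdeg (Suc N) line_ends (Suc k)"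
        unfolding edge_at_vertex using kl by blast
      ultimately show False using no by blast
    qed
  qed
  note * = this
  have comp: "composable QB a b \<longleftrightarrow> (\<exists>k u l u'. k < N \<and> l < N \<and> lsrc k (\<not> u) = lsrc l u' \<and>
      a = larr k u \<and> b = larr l u')" for a b
    unfolding composable_def arrsQB using srcQB tgtQB by auto
  have C: "x \<in> ?C' \<longleftrightarrow> ?C"
  proof
    assume "x \<in> ?C'"
    then obtain a b where ab: "x = bvec (snd a, [a, b])" "composable QB a b"
      "\<not> ?sub a b" by blast
    then obtain k u l u' where kl: "k < N" "l < N" "lsrc k (\<not> u) = lsrc l u'"
      "a = larr k u" "b = larr l u'" unfolding comp by blast
    then have "k \<noteq> l" using * ab(3) by blast
    moreover have "x = bvec (lpath k u [larr l u'])"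
      using kl ab(1) by (simp add: larr_def)
    ultimately show ?C
      by (intro exI[of _ k] exI[of _ u] exI[of _ l] exI[of _ u'] conjI kl(1-3))
  next
    assume ?C
    then obtain k u l u' where kl: "k < N" "l < N" "k \<noteq> l" "lsrc k (\<not> u) = lsrc l u'"
      "x = bvec (lpath k u [larr l u'])" by blast
    have "x = bvec (snd (larr k u), [larr k u, larr l u'])"
      using kl(5) by (simp add: larr_def)
    moreover have "composable QB (larr k u) (larr l u')" unfolding comp using kl by blast
    ultimately show "x \<in> ?C'" using *[OF kl(1,2,4)] kl(3)
      by (intro CollectI exI[of _ "larr k u"] exI[of _ "larr l u'"] conjI) simp_all
  qed
  show ?thesis unfolding R Un_iff A B C by blast
qed

lemma line_rels_carrier: "(brauer_rels (Suc N) line_ends succ :: (_ \<Rightarrow> 'k::field) set) \<subseteq> pa_carrier QB"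
proof
  fix x :: "nat \<times> (nat \<times> nat) list \<Rightarrow> 'k"
  assume "x \<in> brauer_rels (Suc N) line_ends succ"
  then consider k where "Suc k < N" "x = (\<lambda>p. bvec (Suc k, [larr k False, larr k True]) p
     + (- 1) * bvec (Suc k, [larr (Suc k) True, larr (Suc k) False]) p)"
    | k u where "k < N" "x = bvec (lpath k u [larr k (\<not> u), larr k u])"
    | k u l u' where "k < N" "l < N" "lsrc k (\<not> u) = lsrc l u'"
      "x = bvec (lpath k u [larr l u'])"
    unfolding line_rels by auto
  then show "x \<in> pa_carrier QB"
  proof cases
    case 1
    have "valid_path QB (Suc k, [larr k False, larr k True])"
      "valid_path QB (Suc k, [larr (Suc k) True, larr (Suc k) False])"
      using 1(1) unfolding valid_path_def fst_conv snd_conv chain_line chain_line_Nil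
      by (auto simp: lsrc_def)
    then show ?thesis unfolding 1(2) by (intro pa_carrier_add pa_carrier_scale) simp_all
  qed (auto simp: valid_path_def chain_line chain_line_Nil lsrc_le simp del: chain.simps)
qed

lemma line_rels_length:
  assumes "x \<in> brauer_rels (Suc N) line_ends succ" "x p \<noteq> 0"
  shows "1 \<le> length (snd p)"
  using assms unfolding line_rels by (auto simp: bvec_def split: if_splits)

text \<open>Among three consecutive arrows either two neighbours belong to different vertices, a
  zero relation, or all three turn around one vertex, a cycle followed by its first arrow.\<close>

lemma line_long_ideal:
  assumes "valid_path QB p" "3 \<le> length (snd p)"
  shows "bvec p \<in> ideal_gen QB (brauer_rels (Suc N) line_ends succ :: (_ \<Rightarrow> 'k::field) set)"
proof -
  obtain i b c d bs where p: "p = (i, b # c # d # bs)"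
    using assms(2) by (cases p; cases "snd p"; cases "tl (snd p)"; cases "tl (tl (snd p))") auto
  have ch: "chain QB i (b # c # d # bs)" using assms(1) by (simp add: p valid_path_def del: chain.simps)
  obtain k u where k: "k < N" "b = larr k u" "i = lsrc k u" "chain QB (lsrc k (\<not> u)) (c # d # bs)"
    using ch unfolding chain_line[of i] by blast
  obtain l u' where l: "l < N" "c = larr l u'" "lsrc k (\<not> u) = lsrc l u'"
    "chain QB (lsrc l (\<not> u')) (d # bs)"
    using k(4) unfolding chain_line[of "lsrc k (\<not> u)"] by blast
  obtain j u'' where j: "j < N" "d = larr j u''" "lsrc l (\<not> u') = lsrc j u''"
    using l(4) unfolding chain_line[of "lsrc l (\<not> u')"] by blast
  let ?I = "ideal_gen QB (brauer_rels (Suc N) line_ends succ :: (_ \<Rightarrow> 'k) set)"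
  consider "k \<noteq> l" | "l \<noteq> j" | "k = l" "l = j" by blast
  then show ?thesis
  proof cases
    case 1
    have "bvec (i, [b, c]) \<in> ?I"
      by (rule ideal_gen.gen) (use 1 k l line_rels in blast)
    then show ?thesis using bvec_ideal_factor[OF finQB, of i "[]" "[b, c]" "d # bs"] assms(1) p by simp
  next
    case 2
    have "bvec (lsrc l u', [c, d]) \<in> ?I"
      by (rule ideal_gen.gen) (use 2 l j line_rels in blast)
    moreover have "pend QB i [b] = lsrc l u'" using k l by (simp add: tgtQB)
    ultimately show ?thesis using bvec_ideal_factor[OF finQB, of i "[b]" "[c, d]" bs] assms(1) p by simp
  next
    case 3
    then have "u' = (\<not> u)" "u'' = u" using l j by auto
    then have "bvec (i, [b, c, d]) \<in> ?I"
      by (intro ideal_gen.gen) (use 3 k l j line_rels in blast)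
    then show ?thesis using bvec_ideal_factor[OF finQB, of i "[]" "[b, c, d]" bs] assms(1) p by simp
  qed
qed

end

lemma rad_sq_zero_of_brauer_line:
  fixes A :: "('k::field, 'e) alg"
  assumes pb: "path_basis Q A \<psi> P" and m: "1 \<le> m" and B: "brauer_graph_alg m line_ends (triv_ext A)"
  shows "rad_sq_zero A"
proof -
  obtain succ where cyc: "cyclic_orders m line_ends succ"
    and iq: "iso_quot (brauer_quiver m line_ends succ) (brauer_rels m line_ends succ) (triv_ext A)"
    using B unfolding brauer_graph_alg_def by blast
  let ?QB = "brauer_quiver m line_ends succ"
  let ?R = "brauer_rels m line_ends succ :: (nat \<times> (nat \<times> nat) list \<Rightarrow> 'k) set"
  obtain \<Phi> where homQB: "pa_hom_onto ?QB (triv_ext A) \<Phi>"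
    and kerQB: "\<And>x. x \<in> pa_carrier ?QB \<Longrightarrow> \<Phi> x = azero (triv_ext A) \<longleftrightarrow> x \<in> ideal_gen ?QB ?R"
    using iq unfolding iso_quot_def by auto
  have *: "finite_quiver ?QB \<and> ?R \<subseteq> pa_carrier ?QB \<and>
      (\<forall>r p. r \<in> ?R \<longrightarrow> r p \<noteq> 0 \<longrightarrow> 1 \<le> length (snd p)) \<and>
      (\<forall>p. valid_path ?QB p \<longrightarrow> 3 \<le> length (snd p) \<longrightarrow> bvec p \<in> ideal_gen ?QB ?R)"
    proof (cases "m = 1")
      \<comment> \<open>For one edge the quiver is a loop with square zero, so even the paths of
        length two lie in the ideal.\<close>
      case True
      have QB: "?QB = \<lparr>verts = {0}, arrs = {(0, 0)}, src = (\<lambda>_. 0), tgt = (\<lambda>_. 0)\<rparr>"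
        and R: "?R = {bvec (0, [(0, 0), (0, 0)])}"
        using True by (simp_all add: brauer_quiver_def brauer_rels_def)
      have fin: "finite_quiver ?QB" unfolding QB by (simp add: finite_quiver_def)
      have "bvec p \<in> ideal_gen ?QB ?R" if p: "valid_path ?QB p" "3 \<le> length (snd p)" for p
      proof -
        obtain i b c bs where q: "p = (i, b # c # bs)"
          using p(2) by (cases p; cases "snd p"; cases "tl (snd p)") auto
        then have "i = 0" "b = (0, 0)" "c = (0, 0)"
          using p(1) unfolding QB by (auto simp: valid_path_def)
        then show ?thesis
          using bvec_ideal_factor[OF fin, of 0 "[]" "[(0, 0), (0, 0)]" bs ?R] p(1) q
            ideal_gen.gen[of "bvec (0, [(0, 0), (0, 0)])" ?R ?QB] R by simp
      qed
      moreover have "?R \<subseteq> pa_carrier ?QB" unfolding R QB by (simp add: valid_path_def)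
      ultimately show ?thesis using fin R by (auto simp: bvec_def)
    next
      case False
      then obtain N where mN: "m = Suc N" "1 \<le> N" using m by (cases m) auto
      then interpret brauer_line N succ using cyc by unfold_locales simp_all
      show ?thesis
        unfolding mN(1)
        by (intro conjI allI impI finQB line_rels_carrier line_rels_length line_long_ideal)
    qed
  note fin = *[THEN conjunct1] and Rc = *[THEN conjunct2, THEN conjunct1]
    and len = *[THEN conjunct2, THEN conjunct2, THEN conjunct1, rule_format]
    and long = *[THEN conjunct2, THEN conjunct2, THEN conjunct2, rule_format]
  interpret path_basis Q A \<psi> P by fact
  interpret triv_ext_quotient Q A \<psi> P ?QB "ideal_gen ?QB ?R" \<Phi>
  proof
    show "finite_quiver ?QB" by (rule fin)
    show "x (i, []) = 0" if "x \<in> ideal_gen ?QB ?R" for x i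
    proof (rule ccontr)
      assume nz: "x (i, []) \<noteq> 0"
      have "1 \<le> length (snd (i, [] :: (nat \<times> nat) list))"
        by (rule ideal_gen_length[OF _ that nz]) (rule len)
      then show False by simp
    qed
  qed (rule homQB | erule kerQB)+
  show ?thesis
  proof (rule rad_sq_zeroI)
    fix x :: "nat \<times> (nat \<times> nat) list \<Rightarrow> 'k"
    assume x: "x \<in> pa_carrier ?QB" and l: "\<And>p. x p \<noteq> 0 \<Longrightarrow> 3 \<le> length (snd p)"
    show "x \<in> ideal_gen ?QB ?R"
    proof (rule supp_ideal[OF fin Rc x])
      fix p assume p: "x p \<noteq> 0"
      then have "valid_path ?QB p" using x unfolding pa_carrier_def by blast
      then show "bvec p \<in> ideal_gen ?QB ?R" using long l p by blast
    qed
  qed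
qed

section \<open>Gentle trees with radical square zero\<close>

text \<open>Every path in a multiple xa ends with a. If two such paths composed, a followed by the
  rest of the second would give an oriented cycle at the source of a. So xa has square zero and 1 +
  xa is inverse to 1 - xa.\<close>

lemma arrow_in_jac_rad:
  fixes A :: "('k::field, 'e) alg" and Q :: "('v, 'a) quiver"
  assumes pb: "path_basis Q A \<psi> P" and tree: "is_tree_quiver Q" and a: "a \<in> arrs Q"
  shows "\<psi> (bvec (src Q a, [a])) \<in> jac_rad A"
proof -
  interpret path_basis Q A \<psi> P by fact
  let ?b = "bvec (src Q a, [a]) :: 'v \<times> 'a list \<Rightarrow> 'k"
  have b: "?b \<in> pa_carrier Q" using a finQ by (auto simp: valid_path_def finite_quiver_def)
  have one: "pa_one Q \<in> pa_carrier Q" by (rule pa_carrier_one[OF finQ])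
  have "\<exists>y\<in>acarr A. amul A y (aadd A (aone A) (asmul A (-1) (amul A x (\<psi> ?b)))) = aone A"
    if x: "x \<in> acarr A" for x
  proof -
    obtain u where u: "u \<in> pa_carrier Q" "\<psi> u = x" using x by (rule psi_onto)
    let ?X = "pa_mult Q u ?b"
    have X: "?X \<in> pa_carrier Q" by (rule pa_carrier_mult[OF finQ u(1) b])
    have last: "\<exists>as. snd p = as @ [a] \<and> chain Q (fst p) as \<and> pend Q (fst p) as = src Q a"
      if p: "?X p \<noteq> 0" for p
    proof -
      obtain q r where q: "u q \<noteq> 0" "?b r \<noteq> 0" "joins Q q r p"
        using p by (rule pa_mult_support)
      then have "r = (src Q a, [a])" by (auto simp: bvec_def split: if_splits)
      moreover have "valid_path Q q" using q u(1) unfolding pa_carrier_def by blast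
      ultimately show ?thesis using q(3)
        by (intro exI[of _ "snd q"]) (auto simp: joins_def cat_def valid_path_def)
    qed
    have XX: "pa_mult Q ?X ?X = (\<lambda>_. 0)"
    proof (rule ext, rule ccontr)
      fix p assume "pa_mult Q ?X ?X p \<noteq> 0"
      then obtain q r where q: "?X q \<noteq> 0" "?X r \<noteq> 0" "joins Q q r p"
        by (rule pa_mult_support)
      obtain as where as: "snd q = as @ [a]" "pend Q (fst q) as = src Q a" using last[OF q(1)] by blast
      obtain bs where bs: "snd r = bs @ [a]" "chain Q (fst r) bs" "pend Q (fst r) bs = src Q a"
        using last[OF q(2)] by blast
      have "fst r = tgt Q a" using q(3) as by (simp add: joins_def pend_append)
      then have "chain Q (src Q a) (a # bs)" "pend Q (src Q a) (a # bs) = src Q a"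
        using bs a by auto
      then show False using tree_no_cycle[OF tree] by blast
    qed
    let ?Y = "\<lambda>p. pa_one Q p + 1 * ?X p" and ?Z = "\<lambda>p. pa_one Q p + (-1) * ?X p"
    have Y: "?Y \<in> pa_carrier Q" and Z: "?Z \<in> pa_carrier Q"
      by (intro pa_carrier_add one pa_carrier_scale X)+
    have YZ: "pa_mult Q ?Y ?Z = pa_one Q"
      unfolding pa_mult_lin_left pa_mult_lin_right XX pa_mult_one_left[OF finQ X]
        pa_mult_one_right[OF X] pa_mult_one_right[OF one] by simp
    have "amul A (\<psi> ?Y) (aadd A (aone A) (asmul A (-1) (amul A x (\<psi> ?b)))) = aone A"
      using psi_mult[OF Y Z] unfolding YZ psi_lin[OF one X, of "-1"] psi_one psi_mult[OF u(1) b] u(2)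
      by simp
    then show ?thesis using psi_in[OF Y] by blast
  qed
  then show ?thesis unfolding jac_rad_def using psi_in[OF b] by blast
qed

section \<open>Trees with at most two arrows at each vertex\<close>

lemma uwalk_closed:
  assumes "uwalk Q v ws u" "v \<in> W"
    and "\<And>b. b \<in> arrs Q \<Longrightarrow> src Q b \<in> W \<longleftrightarrow> tgt Q b \<in> W"
  shows "u \<in> W"
  using assms(1,2)
proof (induction ws arbitrary: v)
  case (Cons b ws)
  have "step_to Q b \<in> W"
    using Cons.prems assms(3)[of "fst b"] by (auto simp: step_from_def step_to_def split: if_splits)
  then show ?case using Cons by auto
qed simp

text \<open>Take a longest simple walk. An arrow leaving it at one of its ends would prolong it, and
  one leaving it at an inner vertex would be a third arrow there. So its vertex set is closed under
  adjacency, and by connectedness it is everything.\<close>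

lemma spanning_simple_walk:
  assumes tree: "is_tree_quiver Q"
    and deg: "\<And>v. v \<in> verts Q \<Longrightarrow> card {b \<in> arrs Q. src Q b = v \<or> tgt Q b = v} \<le> 2"
  obtains N w a where "simple_walk Q N w a" "card (verts Q) = Suc N"
proof -
  have fin: "finite_quiver Q" using tree by (simp add: is_tree_quiver_def)
  then obtain v where v: "v \<in> verts Q" by (auto simp: finite_quiver_def)
  let ?H = "\<lambda>N. \<exists>w a. simple_walk Q N w a"
  have "?H 0" using v by (intro exI[of _ "\<lambda>_. v"]) (simp add: simple_walk_def)
  moreover have "\<forall>N. ?H N \<longrightarrow> N \<le> card (verts Q)"
    using simple_walk_card[OF fin] by (meson less_imp_le)
  ultimately obtain N where N: "?H N" "\<And>M. ?H M \<Longrightarrow> M \<le> N"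
    using Nat.ex_has_greatest_nat[of ?H 0 "card (verts Q)"] by blast
  then obtain w a where w: "simple_walk Q N w a" by blast
  let ?W = "w ` {..N}"
  have closed: "y \<in> ?W" if b: "b \<in> arrs Q" "{src Q b, tgt Q b} = {w i, y}" and i: "i \<le> N" for b i y
  proof (rule ccontr)
    assume y: "y \<notin> ?W"
    have yv: "y \<in> verts Q"
    proof -
      have "y \<in> {src Q b, tgt Q b}" using b by simp
      then show ?thesis using fin b(1) by (auto simp: finite_quiver_def)
    qed
    consider "i = N" | "i = 0" | "0 < i" "i < N" using i by linarith
    then show False
    proof cases
      case 1
      have "simple_walk Q (Suc N) (w(Suc N := y)) (a(N := b))"
        unfolding simple_walk_def
      proof (intro conjI allI impI)
        show "w(Suc N := y) ` {..Suc N} \<subseteq> verts Q"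
          using w yv by (auto simp: simple_walk_def)
        show "inj_on (w(Suc N := y)) {..Suc N}"
          using y simple_walk_inj[OF w] by (auto simp: inj_on_def le_Suc_eq)
        fix k assume "k < Suc N"
        show "(a(N := b)) k \<in> arrs Q"
          using \<open>k < Suc N\<close> w b(1) by (auto simp: simple_walk_def)
        show "{src Q ((a(N := b)) k), tgt Q ((a(N := b)) k)} = {(w(Suc N := y)) k, (w(Suc N := y)) (Suc k)}"
          using \<open>k < Suc N\<close> simple_walk_arrow[OF w, of k] b(2) 1 by (cases "k = N") auto
      qed
      then show False using N(2)[of "Suc N"] by auto
    next
      case 2
      \<comment> \<open>Here the new vertex is put in front of the walk, shifting all indices by
        one.\<close>
      have "simple_walk Q (Suc N) (case_nat y w) (case_nat b a)"
        unfolding simple_walk_def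
      proof (intro conjI allI impI)
        show "case_nat y w ` {..Suc N} \<subseteq> verts Q"
          using w yv by (auto simp: simple_walk_def image_subset_iff split: nat.split)
        show "inj_on (case_nat y w) {..Suc N}"
          using y simple_walk_inj[OF w] by (auto simp: inj_on_def split: nat.splits)
        fix k assume "k < Suc N"
        show "case_nat b a k \<in> arrs Q"
          using \<open>k < Suc N\<close> w b(1) by (auto simp: simple_walk_def split: nat.split)
        show "{src Q (case_nat b a k), tgt Q (case_nat b a k)} = {case_nat y w k, case_nat y w (Suc k)}"
          using \<open>k < Suc N\<close> simple_walk_arrow[OF w] b(2) 2 by (cases k) auto
      qed
      then show False using N(2)[of "Suc N"] by auto
    next
      case 3
      let ?S = "{c \<in> arrs Q. src Q c = w i \<or> tgt Q c = w i}"
      have mem: "c \<in> ?S" if "c \<in> arrs Q" "w i \<in> {src Q c, tgt Q c}" for c using that by auto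
      have e: "{src Q (a (i - 1)), tgt Q (a (i - 1))} = {w (i - 1), w i}"
        "{src Q (a i), tgt Q (a i)} = {w i, w (Suc i)}"
        using simple_walk_arrow[OF w, of "i - 1"] simple_walk_arrow[OF w, of i] 3 by simp_all
      have aw: "a (i - 1) \<in> arrs Q" "a i \<in> arrs Q" using w 3 by (simp_all add: simple_walk_def)
      have "{a (i - 1), a i, b} \<subseteq> ?S"
        using mem[OF aw(1)] mem[OF aw(2)] mem[OF b(1)] e b(2) by blast
      moreover have "card {a (i - 1), a i, b} = 3"
      proof -
        have "a (i - 1) \<noteq> a i"
        proof
          assume "a (i - 1) = a i"
          then have "i - 1 = i" by (rule inj_onD[OF simple_walk_inj_arrows[OF w]]) (use 3 in auto)
          then show False using 3 by simp
        qed
        moreover have "y \<notin> {w (i - 1), w i}" "y \<notin> {w i, w (Suc i)}" using y 3 by auto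
        then have "b \<noteq> a (i - 1)" "b \<noteq> a i" using e b(2) by blast+
        ultimately show ?thesis by auto
      qed
      moreover have "finite ?S" using fin by (auto simp: finite_quiver_def)
      ultimately have "3 \<le> card ?S" by (metis card_mono)
      moreover have "w i \<in> verts Q" using w i by (auto simp: simple_walk_def)
      ultimately show False using deg[of "w i"] by simp
    qed
  qed
  have "src Q b \<in> ?W \<longleftrightarrow> tgt Q b \<in> ?W" if b: "b \<in> arrs Q" for b
  proof
    assume "src Q b \<in> ?W"
    then obtain i where "i \<le> N" "src Q b = w i" by auto
    then show "tgt Q b \<in> ?W" using closed[OF b, of i "tgt Q b"] by simp
  next
    assume "tgt Q b \<in> ?W"
    then obtain i where "i \<le> N" "tgt Q b = w i" by auto
    then show "src Q b \<in> ?W" using closed[OF b, of i "src Q b"] by (simp add: insert_commute)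
  qed
  note cl = this
  have "verts Q \<subseteq> ?W"
  proof
    fix u assume "u \<in> verts Q"
    moreover have w0: "w 0 \<in> verts Q" "w 0 \<in> ?W" using w by (auto simp: simple_walk_def)
    ultimately obtain ws where "uwalk Q (w 0) ws u"
      using tree unfolding is_tree_quiver_def by blast
    then show "u \<in> ?W" using w0(2) cl by (rule uwalk_closed)
  qed
  then have "card (verts Q) \<le> card ?W" by (intro card_mono) auto
  also have "\<dots> = Suc N" using w by (simp add: simple_walk_def card_image)
  finally have "card (verts Q) = Suc N" using simple_walk_card[OF fin w] by simp
  then show ?thesis using w that by blast
qed

text \<open>Vertices of the walk become edges of the Brauer line, and the arrow between two of them
  becomes the inner vertex shared by these edges. Of the two arrows around that vertex one
  represents the arrow of Q and the opposite one its dual; either product is the dual of an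
  idempotent.\<close>

lemma brauer_line_of_walk:
  fixes A :: "('k::field, 'e) alg"
  assumes pb: "path_basis Q A \<psi> P" and P: "P = {p. valid_path Q p \<and> length (snd p) \<le> 1}"
    and tree: "is_tree_quiver Q" and w: "simple_walk Q N w a" and n: "card (verts Q) = Suc N" and N: "1 \<le> N"
  shows "brauer_graph_alg (Suc N) line_ends (triv_ext A)"
proof -
  define succ :: "nat \<Rightarrow> nat \<Rightarrow> nat"
    where "succ v i = (if 1 \<le> v \<and> v \<le> N then if i = v then v - 1 else v else i)" for v i
  have cyc: "cyclic_orders (Suc N) line_ends succ"
    unfolding cyclic_orders_def
  proof (intro allI conjI ballI)
    fix v i assume "i \<in> inc (Suc N) line_ends v"
    then show "succ v i \<in> inc (Suc N) line_ends v" by (auto simp: inc_line succ_def)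
  next
    fix v show "inj_on (succ v) (inc (Suc N) line_ends v)"
      by (auto simp: inj_on_def inc_line succ_def)
  next
    fix v i j assume ij: "i \<in> inc (Suc N) line_ends v" "j \<in> inc (Suc N) line_ends v"
    show "\<exists>k. (succ v ^^ k) i = j"
    proof (cases "i = j")
      case True then show ?thesis by (intro exI[of _ 0]) simp
    next
      case False
      then show ?thesis using ij by (intro exI[of _ 1]) (auto simp: inc_line succ_def)
    qed
  qed
  interpret L: brauer_line N succ by (unfold_locales) (use N cyc in auto)
  interpret path_basis Q A \<psi> P by fact
  let ?QB = "brauer_quiver (Suc N) line_ends succ"
  let ?R = "brauer_rels (Suc N) line_ends succ :: (nat \<times> (nat \<times> nat) list \<Rightarrow> 'k) set"
  have span: "w ` {..N} = verts Q" "a ` {..<N} = arrs Q"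
    using simple_walk_spanning[OF tree w] n by simp_all
  have winj: "i = j" if "w i = w j" "i \<le> N" "j \<le> N" for i j using simple_walk_inj[OF w] that by blast
  have ainj: "k = l" if "a k = a l" "k < N" "l < N" for k l
    using inj_onD[OF simple_walk_inj_arrows[OF w]] that by auto
  \<comment> \<open>Records whether the k-th arrow of Q points along the walk.\<close>
  define o' where "o' k \<longleftrightarrow> src Q (a k) = w k" for k
  have st: "src Q (a k) = w (lsrc k (o' k)) \<and> tgt Q (a k) = w (lsrc k (\<not> o' k))" if "k < N" for k
    using simple_walk_arrow[OF w that] by (auto simp: o'_def lsrc_def doubleton_eq_iff)
  define arr where "arr k = (src Q (a k), [a k])" for k
  have arr_inj: "k = l" if "arr k = arr l" "k < N" "l < N" for k l
    using that ainj by (auto simp: arr_def)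
  have arrP: "arr k \<in> P" if "k < N" for k
    using w that finQ by (auto simp: P arr_def valid_path_def simple_walk_def finite_quiver_def)
  have wP: "(w i, []) \<in> P" if "i \<le> N" for i
    using span(1) that by (auto simp: P valid_path_def)
  \<comment> \<open>An arrow of the Brauer quiver represents an arrow of Q if it points the same
    way, and the dual of that arrow otherwise. A path of length two is nonzero only if it goes back
    and forth around one vertex.\<close>
  define g where "g q = (if \<not> valid_path ?QB q then None else
    case snd q of [] \<Rightarrow> Some ((w (fst q), []), True)
    | [x] \<Rightarrow> Some (arr (fst x - 1), snd x = lsrc (fst x - 1) (o' (fst x - 1)))
    | [x, y] \<Rightarrow> if fst x = fst y then Some ((w (fst q), []), False) else None
    | _ \<Rightarrow> None)" for q
  have valid0: "valid_path ?QB (i, []) \<longleftrightarrow> i \<le> N" for i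
    by (simp add: valid_path_def L.chain_line_Nil del: chain.simps)
  have valid1: "valid_path ?QB (lpath k u [])" if "k < N" for k u
    using that by (auto simp: valid_path_def L.chain_line L.chain_line_Nil lsrc_def simp del: chain.simps)
  have valid2: "valid_path ?QB (lpath k u [larr l u'])"
    if "k < N" "l < N" "lsrc k (\<not> u) = lsrc l u'" for k u l u'
    using that by (auto simp: valid_path_def L.chain_line L.chain_line_Nil L.lsrc_le simp del: chain.simps)
  have valid_cases: "(\<exists>i\<le>N. q = (i, [])) \<or> (\<exists>k u. k < N \<and> q = lpath k u []) \<or>
      (\<exists>k u l u'. k < N \<and> l < N \<and> lsrc k (\<not> u) = lsrc l u' \<and>
        q = lpath k u [larr l u']) \<or> 3 \<le> length (snd q)"
    if q: "valid_path ?QB q" for q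
  proof -
    obtain i as where ias: "q = (i, as)" by (cases q)
    consider "as = []" | x where "as = [x]" | x y where "as = [x, y]" | "3 \<le> length as"
      by (cases as; cases "tl as"; cases "tl (tl as)") auto
    then show ?thesis
    proof cases
      case 1 then show ?thesis using q ias valid0 by blast
    next
      case 2 then show ?thesis using q ias unfolding valid_path_def fst_conv snd_conv
        by (simp only: ias fst_conv snd_conv L.chain_line) blast
    next
      case 3 then show ?thesis using q ias unfolding valid_path_def fst_conv snd_conv
        by (simp only: ias fst_conv snd_conv L.chain_line) blast
    next
      case 4 then show ?thesis using ias by simp
    qed
  qed
  have g0: "g (i, []) = Some ((w i, []), True)" if "i \<le> N" for i
    using valid0 that by (simp add: g_def)
  have g1: "g (lpath k u []) = Some (arr k, u = o' k)" if "k < N" for k u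
    using valid1[OF that] by (simp add: g_def) (simp add: larr_def)
  have g2: "g (lpath k u [larr l u']) =
      (if k = l then Some ((w (lsrc k u), []), False) else None)"
    if "k < N" "l < N" "lsrc k (\<not> u) = lsrc l u'" for k u l u'
    using valid2[OF that] by (simp add: g_def) (simp add: larr_def)
  have g3: "g q = None" if "3 \<le> length (snd q)" for q
    using that by (auto simp: g_def split: list.splits)
  have g_valid: "valid_path ?QB q" if "g q \<noteq> None" for q
  proof (rule ccontr)
    assume "\<not> valid_path ?QB q"
    then show False using that by (simp add: g_def)
  qed
  have g_cases: "(\<exists>i\<le>N. q = (i, []) \<and> s = ((w i, []), True)) \<or>
      (\<exists>k u. k < N \<and> q = lpath k u [] \<and> s = (arr k, u = o' k)) \<or>
      (\<exists>k u. k < N \<and> q = lpath k u [larr k (\<not> u)] \<and>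
        s = ((w (lsrc k u), []), False))" if s: "g q = Some s" for q s
  proof -
    have "g q \<noteq> None" using s by simp
    then have "valid_path ?QB q" by (rule g_valid)
    from valid_cases[OF this] show ?thesis
    proof (elim disjE exE conjE)
      fix i assume i: "i \<le> N" "q = (i, [])"
      then have "s = ((w i, []), True)" using s g0[OF i(1)] by simp
      then show ?thesis using i by blast
    next
      fix k u assume k: "k < N" "q = lpath k u []"
      then have "s = (arr k, u = o' k)" using s g1[OF k(1), of u] by simp
      then show ?thesis using k by blast
    next
      fix k u l u' assume k: "k < N" "l < N" "lsrc k (\<not> u) = lsrc l u'"
        "q = lpath k u [larr l u']"
      have eq: "Some s = (if k = l then Some ((w (lsrc k u), []), False) else None)"
        using s g2[OF k(1-3)] unfolding k(4) by simp
      then have "k = l" by (metis option.distinct(1))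
      moreover have "s = ((w (lsrc k u), []), False)" using eq \<open>k = l\<close> by simp
      moreover have "u' = (\<not> u)" using k(3) \<open>k = l\<close> by simp
      ultimately have "q = lpath k u [larr k (\<not> u)] \<and>
        s = ((w (lsrc k u), []), False)" using k(4) by simp
      then show ?thesis using k(1) by blast
    next
      assume "3 \<le> length (snd q)"
      then show ?thesis using s g3 by simp
    qed
  qed
  have arr_left: "joins Q r (arr k) (arr l) \<longleftrightarrow> k = l \<and> r = (src Q (a k), [])" if kl: "k < N" "l < N" for r k l
  proof
    assume "joins Q r (arr k) (arr l)"
    then have e: "[a l] = snd r @ [a k]" "fst r = src Q (a l)" by (simp_all add: joins_def arr_def cat_def)
    then have "snd r = []" "a k = a l" by (cases "snd r"; simp)+
    moreover from this have "k = l" using ainj kl by blast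
    ultimately show "k = l \<and> r = (src Q (a k), [])" using e(2) by (simp add: prod_eq_iff)
  next
    assume "k = l \<and> r = (src Q (a k), [])"
    then show "joins Q r (arr k) (arr l)" by (simp add: joins_def arr_def cat_def)
  qed
  have arr_right: "joins Q (arr l) r (arr k) \<longleftrightarrow> k = l \<and> r = (tgt Q (a k), [])" if kl: "k < N" "l < N" for r k l
  proof
    assume "joins Q (arr l) r (arr k)"
    then have e: "a k = a l" "snd r = []" "fst r = tgt Q (a l)"
      by (simp_all add: joins_def arr_def cat_def)
    moreover from this have "k = l" using ainj kl by blast
    ultimately show "k = l \<and> r = (tgt Q (a k), [])" by (simp add: prod_eq_iff)
  next
    assume "k = l \<and> r = (tgt Q (a k), [])"
    then show "joins Q (arr l) r (arr k)" by (simp add: joins_def arr_def cat_def)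
  qed
  interpret triv_ext_presentation Q A \<psi> P ?QB ?R g w
  proof
    show "finite_quiver ?QB" by (rule L.finQB)
    have "inj_on w {..N}" using w by (simp add: simple_walk_def)
    then show "bij_betw w (verts ?QB) (verts Q)"
      using span(1) by (simp add: bij_betw_def L.vertsQB lessThan_Suc_atMost)
    show "g (i, []) = Some ((w i, []), True)" if "i \<in> verts ?QB" for i
      using that g0 by (simp add: L.vertsQB less_Suc_eq_le)
    show "snd q = []" if "g q = Some ((v, []), True)" for q v
      using g_cases[OF that] by (auto simp: arr_def)
    show "valid_path ?QB q \<and> p \<in> P" if q: "g q = Some (p, b)" for q p b
    proof
      show "valid_path ?QB q" by (rule g_valid) (use q in simp)
      show "p \<in> P" using g_cases[OF q] wP arrP L.lsrc_le by auto
    qed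
  next
    let ?S = "verts ?QB \<times> {as. set as \<subseteq> arrs ?QB \<and> length as \<le> 2}"
    have "{q. g q \<noteq> None} \<subseteq> ?S"
    proof
      fix q assume "q \<in> {q. g q \<noteq> None}"
      then have q: "g q \<noteq> None" by blast
      then have "valid_path ?QB q" by (rule g_valid)
      moreover have "length (snd q) \<le> 2" using g3[of q] q by (metis Suc_le_eq not_less numeral_2_eq_2 numeral_3_eq_3)
      ultimately show "q \<in> ?S"
        using chain_start[OF L.finQB, of "fst q" "snd q"] chain_arrs[of ?QB "fst q" "snd q"]
        by (simp add: valid_path_def mem_Times_iff)
    qed
    moreover have "finite ?S"
      using L.finQB by (intro finite_cartesian_product finite_lists_length_le) (auto simp: finite_quiver_def)
    ultimately show "finite {q. g q \<noteq> None}" by (rule finite_subset)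
  next
    fix p b assume "p \<in> P"
    then have p: "chain Q (fst p) (snd p)" "length (snd p) \<le> 1" unfolding P by (simp_all add: valid_path_def)
    show "\<exists>q. g q = Some (p, b)"
    proof (cases "snd p")
      case Nil
      then have pv: "p = (fst p, [])" by (simp add: prod_eq_iff)
      have "fst p \<in> verts Q" using p(1) Nil by simp
      then obtain i where i: "i \<le> N" "fst p = w i" using span(1) by blast
      show ?thesis
      proof (cases b)
        case True
        have "g (i, []) = Some (p, b)" using g0[OF i(1)] True i(2) pv by simp
        then show ?thesis by blast
      next
        case False
        \<comment> \<open>Either cycle at edge i represents the dual of the idempotent; the one to
          the right is used, except at the last edge, where only the left one exists.\<close>
        define k where "k = (if i < N then i else i - 1)"
        define u where "u = (i < N)"
        have k: "k < N" "lsrc k u = i" using i N by (auto simp: k_def u_def lsrc_def)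
        have "g (lpath k u [larr k (\<not> u)]) = Some (p, b)"
          using g2[OF k(1) k(1), of u "\<not> u"] False k(2) i(2) pv by simp
        then show ?thesis by blast
      qed
    next
      case (Cons c cs)
      then have "snd p = [c]" using p(2) by simp
      then have pc: "p = (src Q c, [c])" "c \<in> arrs Q" using p(1) by (auto simp: prod_eq_iff)
      then obtain k where k: "k < N" "c = a k" using span(2) by blast
      have "g (lsrc k (b = o' k), [larr k (b = o' k)]) = Some (p, b)"
        using g1[OF k(1), of "b = o' k"] pc(1) k(2) by (cases b) (simp_all add: arr_def)
      then show ?thesis by blast
    qed
  next
    fix q s assume "g q = Some s"
    from g_cases[OF this]
    show "basis_ends Q s = (w (fst q), w (pend ?QB (fst q) (snd q)))"
    proof (elim disjE exE conjE)
      fix i assume "i \<le> N" "q = (i, [])" "s = ((w i, []), True)"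
      then show ?thesis by (simp add: basis_ends_def)
    next
      fix k u assume k: "k < N" "q = lpath k u []" "s = (arr k, u = o' k)"
      then show ?thesis
        using st[OF k(1)] by (cases u; cases "o' k") (auto simp: basis_ends_def L.tgtQB arr_def)
    next
      fix k u assume "k < N" "q = lpath k u [larr k (\<not> u)]"
        "s = ((w (lsrc k u), []), False)"
      then show ?thesis by (simp add: basis_ends_def L.tgtQB)
    qed
  next
    fix q1 q2 q r b
    assume j: "joins ?QB q1 q2 q" and v: "valid_path ?QB q" and ne: "snd q1 \<noteq> []" "snd q2 \<noteq> []"
      and r: "r \<in> P"
    have v12: "valid_path ?QB q1" "valid_path ?QB q2" using valid_joins[OF L.finQB j] v by auto
    have rl: "length (snd r) \<le> 1" using r by (simp add: P)
    have q: "q = (fst q1, snd q1 @ snd q2)" using j by (simp add: joins_def cat_def)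
    show "g q = Some (r, b) \<longleftrightarrow> (\<exists>s1 s2. g q1 = Some s1 \<and> g q2 = Some s2 \<and> basis_prod Q s1 s2 (r, b))"
    proof (cases "length (snd q1) = 1 \<and> length (snd q2) = 1")
      case True
      obtain k u where k: "k < N" "q1 = lpath k u []"
        using valid_cases[OF v12(1)] True by auto
      obtain l u' where l: "l < N" "q2 = lpath l u' []"
        using valid_cases[OF v12(2)] True by auto
      have e: "lsrc k (\<not> u) = lsrc l u'" using j k l by (simp add: joins_def L.tgtQB)
      have lhs: "g q = Some (r, b) \<longleftrightarrow> k = l \<and> r = (w (lsrc k u), []) \<and> \<not> b"
        using g2[OF k(1) l(1) e] unfolding q k(2) l(2) by auto
      have rhs: "(\<exists>s1 s2. g q1 = Some s1 \<and> g q2 = Some s2 \<and> basis_prod Q s1 s2 (r, b)) \<longleftrightarrow>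
          basis_prod Q (arr k, u = o' k) (arr l, u' = o' l) (r, b)"
        unfolding k(2) l(2) g1[OF k(1)] g1[OF l(1)] by simp
      have kl: "u' = (\<not> u)" if "k = l" using e that by simp
      have no: "\<not> joins Q (arr k) (arr l) r" using rl by (auto simp: joins_def arr_def cat_def)
      \<comment> \<open>Four cases. Two arrows of Q multiply to a path too long for P, and two duals
        multiply to zero; neither is possible with k = l, where the directions are opposite. An
        arrow and a dual cancel exactly when they come from the same arrow, leaving the dual of its
        source or of its target.\<close>
      have "(k = l \<and> r = (w (lsrc k u), []) \<and> \<not> b) =
          basis_prod Q (arr k, u = o' k) (arr l, u' = o' l) (r, b)" (is ?eq)
      proof (cases "u = o' k"; cases "u' = o' l")
        assume "u = o' k" "u' = o' l"
        then show ?eq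
          using no kl by auto
      next
        assume "u = o' k" "u' \<noteq> o' l"
        then show ?eq
          using arr_left[OF k(1) l(1)] st[OF k(1)] by auto
      next
        assume a: "u \<noteq> o' k" "u' = o' l"
        then have "lsrc k u = lsrc k (\<not> o' k)" by auto
        then show ?eq
          using a arr_right[OF k(1) l(1)] st[OF k(1)] by auto
      next
        assume "u \<noteq> o' k" "u' \<noteq> o' l"
        then show ?eq
          using kl by auto
      qed
      then show ?thesis unfolding lhs rhs .
    next
      case False
      have nz: "length (snd q1) \<noteq> 0" "length (snd q2) \<noteq> 0" using ne by auto
      have "3 \<le> length (snd q1) + length (snd q2)" using nz False by arith
      then have "3 \<le> length (snd q)" by (subst q) simp
      then have "g q = None" by (rule g3)
      moreover have "\<not> basis_prod Q s1 s2 (r, b)" if s: "g q1 = Some s1" "g q2 = Some s2" for s1 s2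
      proof -
        have "(\<exists>k c. length (snd q1) = 1 \<and> s1 = (arr k, c)) \<or> (\<exists>v. length (snd q1) = 2 \<and> s1 = ((v, []), False))"
          using g_cases[OF s(1)] ne by auto
        moreover have "(\<exists>k c. length (snd q2) = 1 \<and> s2 = (arr k, c)) \<or> (\<exists>v. length (snd q2) = 2 \<and> s2 = ((v, []), False))"
          using g_cases[OF s(2)] ne by auto
        moreover have "\<not> basis_prod Q (arr k, c) ((v, []), False) (r, b)"
          "\<not> basis_prod Q ((v, []), False) (arr k, c) (r, b)" for k c v
          by (cases c; auto simp: joins_def cat_def arr_def)+
        moreover have "\<not> basis_prod Q ((v, []), False) ((v', []), False) (r, b)" for v v' by simp
        ultimately show ?thesis using False by blast
      qed
      ultimately show ?thesis by (metis option.distinct(1))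
    qed
  next
    fix x assume "x \<in> ?R"
    then consider k where "Suc k < N" "x = L.socle_rel k"
      | k u where "k < N" "x = bvec (lpath k u [larr k (\<not> u), larr k u])"
      | k u l u' where "k < N" "l < N" "k \<noteq> l" "lsrc k (\<not> u) = lsrc l u'"
        "x = bvec (lpath k u [larr l u'])"
      unfolding L.line_rels by blast
    then show "(\<exists>q. valid_path ?QB q \<and> g q = None \<and> x = bvec q) \<or>
      (\<exists>q q'. g q \<noteq> None \<and> g q' = g q \<and> x = (\<lambda>p. bvec q p - bvec q' p))"
    proof cases
      case 1
      have "g (Suc k, [larr k False, larr k True]) = Some ((w (Suc k), []), False)"
        "g (Suc k, [larr (Suc k) True, larr (Suc k) False]) = Some ((w (Suc k), []), False)"
        using g2[of k k False True] g2[of "Suc k" "Suc k" True False] 1(1) by (simp_all add: lsrc_def)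
      then show ?thesis using 1(2) by (intro disjI2) (metis option.distinct(1))
    next
      case 2
      have "valid_path ?QB (lpath k u [larr k (\<not> u), larr k u])"
        using 2(1) by (auto simp: valid_path_def L.chain_line L.chain_line_Nil L.lsrc_le simp del: chain.simps)
      moreover have "g (lpath k u [larr k (\<not> u), larr k u]) = None"
        by (rule g3) simp
      ultimately show ?thesis using 2(2) by blast
    next
      case 3
      then show ?thesis using g2[OF 3(1,2,4)] valid2[OF 3(1,2,4)] by (intro disjI1) auto
    qed
  next
    fix q assume v: "valid_path ?QB q" and gq: "g q = None"
    from valid_cases[OF v] consider i where "i \<le> N" "q = (i, [])"
      | k u where "k < N" "q = lpath k u []"
      | k u l u' where "k < N" "l < N" "lsrc k (\<not> u) = lsrc l u'"
        "q = lpath k u [larr l u']"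
      | "3 \<le> length (snd q)"
      by blast
    then show "bvec q \<in> ideal_gen ?QB ?R"
    proof cases
      case 3
      then have "k \<noteq> l" using gq g2[OF 3(1-3)] by auto
      then have "bvec q \<in> ?R" unfolding L.line_rels using 3 by blast
      then show ?thesis by (rule ideal_gen.gen)
    next
      case 4 then show ?thesis by (rule L.line_long_ideal[OF v])
    qed (use gq g0 g1 in auto)
  next
    fix q q' assume "g q \<noteq> None" and e: "g q' = g q"
    then obtain s where s: "g q = Some s" "g q' = Some s" by (metis not_None_eq)
    have zero: "(\<lambda>p. bvec q p - bvec q p) \<in> ideal_gen ?QB ?R" by (simp add: ideal_gen.zero)
    have rel: "L.socle_rel k \<in> ideal_gen ?QB ?R"
      if "Suc k < N" for k
      by (rule ideal_gen.gen) (use that L.line_rels in blast)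
    have "q' = q \<or> (\<exists>k u k' u'. k < N \<and> k' < N \<and> q = lpath k u [larr k (\<not> u)] \<and>
        q' = lpath k' u' [larr k' (\<not> u')] \<and> w (lsrc k u) = w (lsrc k' u'))"
      (is "_ \<or> ?loops") using g_cases[OF s(1)]
    proof (elim disjE exE conjE)
      fix i assume i: "i \<le> N" "q = (i, [])" "s = ((w i, []), True)"
      from g_cases[OF s(2)] show ?thesis
      proof (elim disjE exE conjE)
        fix j assume "j \<le> N" "q' = (j, [])" "s = ((w j, []), True)"
        then have "q' = q" using i winj[of i j] by simp
        then show ?thesis ..
      qed (use i in \<open>simp_all add: arr_def\<close>)
    next
      fix k u assume k: "k < N" "q = lpath k u []" "s = (arr k, u = o' k)"
      from g_cases[OF s(2)] show ?thesis
      proof (elim disjE exE conjE)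
        fix l u' assume l: "l < N" "q' = lpath l u' []" "s = (arr l, u' = o' l)"
        then have "k = l" using k arr_inj[of k l] by simp
        then have "q' = q" using k l by auto
        then show ?thesis ..
      qed (use k in \<open>simp_all add: arr_def\<close>)
    next
      fix k u assume k: "k < N" "q = lpath k u [larr k (\<not> u)]"
        "s = ((w (lsrc k u), []), False)"
      from g_cases[OF s(2)] show ?thesis
      proof (elim disjE exE conjE)
        fix l u' assume l: "l < N" "q' = lpath l u' [larr l (\<not> u')]"
          "s = ((w (lsrc l u'), []), False)"
        then have "w (lsrc k u) = w (lsrc l u')" using k(3) by simp
        then have ?loops using k l by blast
        then show ?thesis ..
      qed (use k in \<open>simp_all add: arr_def\<close>)
    qed
    then show "(\<lambda>p. bvec q p - bvec q' p) \<in> ideal_gen ?QB ?R"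
    proof (elim disjE exE conjE)
      assume "q' = q" then show ?thesis using zero by simp
    next
      fix k u k' u' assume k: "k < N" "k' < N"
        "q = lpath k u [larr k (\<not> u)]"
        "q' = lpath k' u' [larr k' (\<not> u')]" "w (lsrc k u) = w (lsrc k' u')"
      then have "lsrc k u = lsrc k' u'" using winj L.lsrc_le by blast
      \<comment> \<open>Two back-and-forth paths at the same edge are equal or turn around its two
        ends, and then they differ by a socle relation up to sign.\<close>
      then consider "k = k'" "u = u'" | "k' = Suc k" "\<not> u" "u'" | "k = Suc k'" "u" "\<not> u'"
        by (cases u; cases u') (auto simp: lsrc_def)
      then show ?thesis
      proof cases
        case 1 then show ?thesis using k zero by simp
      next
        case 2 then show ?thesis using k rel[of k] by (simp add: lsrc_def)
      next
        case 3
        then have "(\<lambda>p. (-1) * (bvec (Suc k', [larr k' False, larr k' True]) p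
          - bvec (Suc k', [larr (Suc k') True, larr (Suc k') False]) p)) \<in> ideal_gen ?QB ?R"
          using k by (intro ideal_gen_scale[OF L.finQB L.line_rels_carrier] rel) simp
        then show ?thesis using 3 k by (simp add: lsrc_def)
      qed
    qed
  qed
  show ?thesis unfolding brauer_graph_alg_def using cyc presentation by blast
qed

text \<open>With one edge the star and the line have, by definition, the same quiver and the same
  relation.\<close>

lemma brauer_line_of_point:
  assumes "brauer_graph_alg 1 star_ends B"
  shows "brauer_graph_alg 1 line_ends B"
proof -
  obtain succ where succ: "iso_quot (brauer_quiver 1 star_ends succ) (brauer_rels 1 star_ends succ) B"
    using assms unfolding brauer_graph_alg_def by blast
  have "cyclic_orders 1 line_ends (\<lambda>v i. i)"
    by (auto simp: cyclic_orders_def inc_line intro: exI[of _ 0])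
  moreover have "iso_quot (brauer_quiver 1 line_ends (\<lambda>v i. i)) (brauer_rels 1 line_ends (\<lambda>v i. i)) B"
    using succ by (simp add: brauer_quiver_def brauer_rels_def)
  ultimately show ?thesis unfolding brauer_graph_alg_def by blast
qed

text \<open>Admissibility puts long paths into I, and by \<open>monomial_ideal\<close> such a path
  contains a relation; a finite quiver has only finitely many shorter paths.\<close>

lemma gentle_finite_basis:
  assumes "gentle Q Rel TYPE('k::field)"
  shows "finite (nonzero_paths Q Rel)"
proof -
  let ?I = "ideal_gen Q (rel_elems Q Rel) :: ('a \<times> 'b list \<Rightarrow> 'k) set"
  have fin: "finite_quiver Q" and comp: "\<forall>(a, b)\<in>Rel. composable Q a b"
    and "\<exists>m\<ge>2. arrow_ideal_pow Q m \<subseteq> ?I"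
    using assms by (simp_all add: gentle_def Let_def)
  then obtain m where m: "arrow_ideal_pow Q m \<subseteq> ?I" by blast
  let ?S = "verts Q \<times> {as. set as \<subseteq> arrs Q \<and> length as \<le> m}"
  have "(nonzero_paths Q Rel) \<subseteq>
      ?S"
  proof
    fix p assume "p \<in> (nonzero_paths Q Rel)"
    then have p: "valid_path Q p" "\<not> has_rel Rel (snd p)" by auto
    have "length (snd p) \<le> m"
    proof (rule ccontr)
      assume "\<not> length (snd p) \<le> m"
      then have "(bvec p :: _ \<Rightarrow> 'k) \<in> arrow_ideal_pow Q m"
        unfolding arrow_ideal_pow_def mem_Collect_eq
      proof (intro conjI allI impI)
        show "(bvec p :: _ \<Rightarrow> 'k) \<in> pa_carrier Q" using p(1) by simp
        fix q assume "(bvec p :: _ \<Rightarrow> 'k) q \<noteq> 0"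
        then have "q = p" by (auto simp: bvec_def split: if_splits)
        then show "m \<le> length (snd q)" using \<open>\<not> length (snd p) \<le> m\<close> by simp
      qed
      then have "\<forall>q. (bvec p :: _ \<Rightarrow> 'k) q \<noteq> 0 \<longrightarrow> has_rel Rel (snd q)"
        using m monomial_ideal[OF fin comp, of "bvec p :: _ \<Rightarrow> 'k"] by blast
      from spec[OF this, of p] have "has_rel Rel (snd p)" by (simp add: bvec_def)
      then show False using p(2) by simp
    qed
    then show "p \<in> ?S"
      using p(1) chain_start[OF fin, of "fst p" "snd p"] chain_arrs[of Q "fst p" "snd p"]
      by (simp add: valid_path_def mem_Times_iff)
  qed
  moreover have "finite ?S"
    using fin by (intro finite_cartesian_product finite_lists_length_le) (auto simp: finite_quiver_def)
  ultimately show ?thesis by (rule finite_subset)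
qed

text \<open>If the radical squares to zero, all composable pairs of arrows are relations, so a vertex
  through which a path passes has exactly one incoming and one outgoing arrow.\<close>

lemma gentle_rad_sq_zero_degree:
  assumes gentle: "gentle Q Rel TYPE('k::field)"
    and all: "\<And>a b. composable Q a b \<Longrightarrow> (a, b) \<in> Rel" and v: "v \<in> verts Q"
  shows "card {b \<in> arrs Q. src Q b = v \<or> tgt Q b = v} \<le> 2"
proof -
  let ?I = "ideal_gen Q (rel_elems Q Rel) :: ('a \<times> 'b list \<Rightarrow> 'k) set"
  have inI: "bvec (src Q a, [a, b]) \<in> ?I" if "composable Q a b" for a b
    using all[OF that] by (intro ideal_gen.gen) (auto simp: rel_elems_def)
  have two: "card {a \<in> arrs Q. tgt Q a = v} \<le> 2" "card {a \<in> arrs Q. src Q a = v} \<le> 2"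
    using gentle v by (simp_all add: gentle_def Let_def)
  have g: "card {b. composable Q a b \<and> bvec (src Q a, [a, b]) \<in> ?I} \<le> 1"
    "card {c. composable Q c a \<and> bvec (src Q c, [c, a]) \<in> ?I} \<le> 1" if "a \<in> arrs Q" for a
    using gentle that by (simp_all add: gentle_def Let_def)
  have one: "card {b. composable Q a b} \<le> 1" "card {c. composable Q c a} \<le> 1" if "a \<in> arrs Q" for a
  proof -
    have "{b. composable Q a b \<and> bvec (src Q a, [a, b]) \<in> ?I} = {b. composable Q a b}"
      "{c. composable Q c a \<and> bvec (src Q c, [c, a]) \<in> ?I} = {c. composable Q c a}"
      using inI by auto
    then show "card {b. composable Q a b} \<le> 1" "card {c. composable Q c a} \<le> 1"
      using g[OF that] by simp_all
  qed
  let ?In = "{a \<in> arrs Q. tgt Q a = v}" and ?Out = "{a \<in> arrs Q. src Q a = v}"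
  have eq: "{b \<in> arrs Q. src Q b = v \<or> tgt Q b = v} = ?Out \<union> ?In" by auto
  show ?thesis
  proof (cases "?In = {} \<or> ?Out = {}")
    case True
    then show ?thesis unfolding eq
      using two by (elim disjE) (simp_all only: Un_empty_left Un_empty_right)
  next
    case False
    then obtain i j where i: "i \<in> ?In" and j: "j \<in> ?Out" by blast
    then have "?Out = {b. composable Q i b}" "?In = {c. composable Q c j}"
      by (auto simp: composable_def)
    then have "card ?Out \<le> 1" "card ?In \<le> 1" using one[of i] one[of j] i j by auto
    then show ?thesis unfolding eq using card_Un_le[of ?Out ?In] by linarith
  qed
qed

section \<open>The two equivalences\<close>

theorem theorem3p9:
  fixes Q :: "('v, 'a) quiver" and Rel :: "('a \<times> 'a) set"
    and A :: "('k::field, 'e) alg" and n :: nat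
  assumes "alg_closed TYPE('k)"
    and "gentle_tree Q Rel TYPE('k)"
    and "card (verts Q) = n"
    and "iso_quot Q (rel_elems Q Rel) A"
  shows "(brauer_star_alg (triv_ext A) \<longleftrightarrow> iso_quot (linA n) {} A)
       \<and> (brauer_line_alg (triv_ext A) \<longleftrightarrow> rad_sq_zero A)"
proof -
  have gentle: "gentle Q Rel TYPE('k)" and tree: "is_tree_quiver Q"
    using assms(2) by (simp_all add: gentle_tree_def)
  have fin: "finite_quiver Q" and comp: "\<forall>(a, b)\<in>Rel. composable Q a b"
    using gentle by (simp_all add: gentle_def Let_def)
  let ?P = "nonzero_paths Q Rel"
  obtain \<psi> where pb: "path_basis Q A \<psi> ?P"
    using path_basis_of_iso[OF fin comp assms(4) gentle_finite_basis[OF gentle]] by blast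
  have n: "1 \<le> n"
    using fin assms(3) by (auto simp: finite_quiver_def Suc_le_eq card_gt_0_iff)
  have star: "brauer_star_alg (triv_ext A) \<longleftrightarrow> iso_quot (linA n) {} A"
  proof
    assume "brauer_star_alg (triv_ext A)"
    then obtain m where "1 \<le> m" "brauer_graph_alg m star_ends (triv_ext A)"
      unfolding brauer_star_alg_def by blast
    then show "iso_quot (linA n) {} A"
      using linA_of_brauer_star[OF tree pb comp assms(4)] assms(3) by blast
  next
    assume "iso_quot (linA n) {} A"
    then show "brauer_star_alg (triv_ext A)"
      unfolding brauer_star_alg_def using brauer_star_of_linA n by blast
  qed
  have line: "brauer_line_alg (triv_ext A) \<longleftrightarrow> rad_sq_zero A"
  proof
    assume "brauer_line_alg (triv_ext A)"
    then show "rad_sq_zero A"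
      unfolding brauer_line_alg_def using rad_sq_zero_of_brauer_line[OF pb] by blast
  next
    assume rad: "rad_sq_zero A"
    interpret path_basis Q A \<psi> ?P by fact
    \<comment> \<open>Both arrows are radical, so their product is zero in A and the path formed by
      a and b is not in P. A path of length two contains a relation only by being one.\<close>
    have all: "(a, b) \<in> Rel" if ab: "composable Q a b" for a b
    proof -
      have abv: "valid_path Q (src Q a, [a])" "valid_path Q (src Q b, [b])" "valid_path Q (src Q a, [a, b])"
        using ab fin by (auto simp: composable_def valid_path_def finite_quiver_def)
      have j: "joins Q (src Q a, [a]) (src Q b, [b]) (src Q a, [a, b])"
        using ab by (simp add: joins_def cat_def composable_def)
      have "amul A (\<psi> (bvec (src Q a, [a]))) (\<psi> (bvec (src Q b, [b]))) = azero A"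
        using rad arrow_in_jac_rad[OF pb tree] ab unfolding rad_sq_zero_def composable_def by blast
      then have "\<psi> (pa_mult Q (bvec (src Q a, [a])) (bvec (src Q b, [b]))) = azero A"
        using psi_mult abv by simp
      then have "\<psi> (bvec (src Q a, [a, b])) = azero A" unfolding pa_mult_bvec_joins[OF j] .
      then have "\<forall>p\<in>?P. bvec (src Q a, [a, b]) p = (0 :: 'k)" using ker[of "bvec (src Q a, [a, b])"] abv by simp
      then have "(src Q a, [a, b]) \<notin> ?P" by (metis bvec_def zero_neq_one)
      then have "has_rel Rel [a, b]" using abv by simp
      then show ?thesis by (auto simp: has_rel_def Cons_eq_append_conv)
    qed
    obtain N w a where w: "simple_walk Q N w a" "card (verts Q) = Suc N"
      using spanning_simple_walk[OF tree gentle_rad_sq_zero_degree[OF gentle all]] by blast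
    have "brauer_graph_alg n line_ends (triv_ext A)"
    proof (cases N)
      \<comment> \<open>A single vertex has no arrow to build a line from; A is then the path
        algebra of a point, and the star with one edge serves as the line.\<close>
      case 0
      then have n1: "n = 1" using w assms(3) by simp
      obtain v where v: "v \<in> verts Q" using fin by (auto simp: finite_quiver_def)
      have "iso_quot (linA (card (verts Q))) {} A"
        by (rule spanning_chain_iso_linA[OF tree, of v "[]", OF _ _ comp _ assms(4)])
          (use v w 0 in \<open>simp_all add: has_rel_def\<close>)
      then show ?thesis
        using brauer_line_of_point[OF brauer_star_of_linA[of 1 A]] n1 assms(3) by simp
    next
      case (Suc N')
      \<comment> \<open>All composable pairs being relations, only trivial paths and arrows are
        nonzero.\<close>
      have P: "?P = {p. valid_path Q p \<and> length (snd p) \<le> 1}"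
      proof (intro Collect_cong conj_cong refl)
        fix p assume p: "valid_path Q p"
        show "\<not> has_rel Rel (snd p) \<longleftrightarrow> length (snd p) \<le> 1"
        proof
          assume nr: "\<not> has_rel Rel (snd p)"
          show "length (snd p) \<le> 1"
          proof (rule ccontr)
            assume "\<not> length (snd p) \<le> 1"
            then obtain b c bs where bc: "snd p = b # c # bs" by (cases "snd p"; cases "tl (snd p)") auto
            then have "composable Q b c"
              using p fin by (cases bs) (auto simp: valid_path_def composable_def)
            then have "(b, c) \<in> Rel" by (rule all)
            moreover have "snd p = [] @ [b, c] @ bs" using bc by simp
            ultimately show False using nr unfolding has_rel_def by blast
          qed
        qed (auto simp: has_rel_def)
      qed
      show ?thesis using brauer_line_of_walk[OF pb P tree w] w(2) assms(3) Suc by simp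
    qed
    then show "brauer_line_alg (triv_ext A)" unfolding brauer_line_alg_def using n by blast
  qed
  show ?thesis using star line by blast
qed

end
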